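(* Let $\Gamma$ be a group. Then Kaplansky's stable finiteness conjecture holds over $\Gamma$ (that is, $\mathbb{F}[\Gamma]$ is stably finite for every field $\mathbb{F}$) if and only if $\Gamma$ is $A$-surjunctive.
   Context: Let $\Gamma$ be a group and $F$ a finite set. Let $F^\Gamma=\prod_{\gamma\in\Gamma}F$ carry the prodiscrete topology (product of the discrete topologies) and the usual left shift action of $\Gamma$, $(\gamma x)(g)=x(\gamma^{-1}g)$. A cellular automaton over $\Gamma$ with alphabet $F$ is a continuous $\Gamma$-equivariant map $f\colon F^\Gamma\to F^\Gamma$. If $F$ is a finite abelian group and $f$ is a group homomorphism, then $f$ is called an additive cellular automaton. $\Gamma$ is $A$-surjunctive if every injective additive cellular automaton over $\Gamma$ (for every finite abelian group $F$ as alphabet) is surjective. A ring $R$ with identity is directly finite if for all $x,y\in R$, $xy=1$ implies $yx=1$; it is stably finite if $\mathbb{M}_d(R)$ is directly finite for every $d\ge1$. *)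

theory Defs
  imports "HOL-Analysis.Function_Topology" "HOL-Algebra.Product_Groups" "HOL-Algebra.Ring"
begin

subsection \<open>Cellular automata\<close>

definition config_space :: "('g, 'm) monoid_scheme \<Rightarrow> 'b set \<Rightarrow> ('g \<Rightarrow> 'b) topology" where
  "config_space G F = product_topology (\<lambda>_. discrete_topology F) (carrier G)"

definition shift :: "('g, 'm) monoid_scheme \<Rightarrow> 'g \<Rightarrow> ('g \<Rightarrow> 'b) \<Rightarrow> 'g \<Rightarrow> 'b" where
  "shift G \<gamma> x = (\<lambda>g\<in>carrier G. x (inv\<^bsub>G\<^esub> \<gamma> \<otimes>\<^bsub>G\<^esub> g))"

definition cellular_automaton ::
    "('g, 'm) monoid_scheme \<Rightarrow> 'b set \<Rightarrow> (('g \<Rightarrow> 'b) \<Rightarrow> 'g \<Rightarrow> 'b) \<Rightarrow> bool" where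
  "cellular_automaton G F f \<longleftrightarrow>
     continuous_map (config_space G F) (config_space G F) f \<and>
     (\<forall>\<gamma>\<in>carrier G. \<forall>x\<in>topspace (config_space G F). f (shift G \<gamma> x) = shift G \<gamma> (f x))"

text \<open>The finite abelian alphabet is written multiplicatively, as usual in HOL-Algebra.\<close>

definition additive_cellular_automaton ::
    "('g, 'm) monoid_scheme \<Rightarrow> ('b, 'n) monoid_scheme \<Rightarrow> (('g \<Rightarrow> 'b) \<Rightarrow> 'g \<Rightarrow> 'b) \<Rightarrow> bool" where
  "additive_cellular_automaton G A f \<longleftrightarrow>
     cellular_automaton G (carrier A) f \<and>
     f \<in> hom (product_group (carrier G) (\<lambda>_. A)) (product_group (carrier G) (\<lambda>_. A))"

text \<open>A formula of HOL cannot quantify over all types, so the type \<open>'b\<close> in which the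
  alphabets live is a parameter. Any infinite \<open>'b\<close> carries an isomorphic copy of every finite
  group, so for such \<open>'b\<close> this is \<open>A\<close>-surjunctivity with respect to all finite abelian alphabets.\<close>

definition A_surjunctive :: "'b itself \<Rightarrow> ('g, 'm) monoid_scheme \<Rightarrow> bool" where
  "A_surjunctive (_ :: 'b itself) G \<longleftrightarrow>
     (\<forall>(A :: 'b monoid) f.
        comm_group A \<and> finite (carrier A) \<and> additive_cellular_automaton G A f \<and>
        inj_on f (topspace (config_space G (carrier A))) \<longrightarrow>
        f ` topspace (config_space G (carrier A)) = topspace (config_space G (carrier A)))"


subsection \<open>Group rings, matrix rings and stable finiteness\<close>

text \<open>The product is the convolution \<open>(a b)(g) = \<Sum>\<^sub>h a(h) b(h\<inverse> g)\<close>, summed over the finite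
  support of \<open>a\<close> because \<open>finsum\<close> is only meaningful over finite index sets.\<close>

definition group_ring :: "('k, 'l) ring_scheme \<Rightarrow> ('g, 'm) monoid_scheme \<Rightarrow> ('g \<Rightarrow> 'k) ring" where
  "group_ring K G =
     \<lparr>carrier = {a \<in> carrier G \<rightarrow>\<^sub>E carrier K. finite {g \<in> carrier G. a g \<noteq> \<zero>\<^bsub>K\<^esub>}},
      mult = (\<lambda>a b. \<lambda>g\<in>carrier G.
        \<Oplus>\<^bsub>K\<^esub>h\<in>{h \<in> carrier G. a h \<noteq> \<zero>\<^bsub>K\<^esub>}. a h \<otimes>\<^bsub>K\<^esub> b (inv\<^bsub>G\<^esub> h \<otimes>\<^bsub>G\<^esub> g)),
      one = (\<lambda>g\<in>carrier G. if g = \<one>\<^bsub>G\<^esub> then \<one>\<^bsub>K\<^esub> else \<zero>\<^bsub>K\<^esub>),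
      zero = (\<lambda>g\<in>carrier G. \<zero>\<^bsub>K\<^esub>),
      add = (\<lambda>a b. \<lambda>g\<in>carrier G. a g \<oplus>\<^bsub>K\<^esub> b g)\<rparr>"

definition matrix_ring :: "nat \<Rightarrow> ('r, 'l) ring_scheme \<Rightarrow> (nat \<times> nat \<Rightarrow> 'r) ring" where
  "matrix_ring d R =
     \<lparr>carrier = {..<d} \<times> {..<d} \<rightarrow>\<^sub>E carrier R,
      mult = (\<lambda>M N. \<lambda>(i, j)\<in>{..<d} \<times> {..<d}. \<Oplus>\<^bsub>R\<^esub>k\<in>{..<d}. M (i, k) \<otimes>\<^bsub>R\<^esub> N (k, j)),
      one = (\<lambda>(i, j)\<in>{..<d} \<times> {..<d}. if i = j then \<one>\<^bsub>R\<^esub> else \<zero>\<^bsub>R\<^esub>),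
      zero = (\<lambda>(i, j)\<in>{..<d} \<times> {..<d}. \<zero>\<^bsub>R\<^esub>),
      add = (\<lambda>M N. \<lambda>(i, j)\<in>{..<d} \<times> {..<d}. M (i, j) \<oplus>\<^bsub>R\<^esub> N (i, j))\<rparr>"

definition directly_finite :: "('r, 'l) ring_scheme \<Rightarrow> bool" where
  "directly_finite R \<longleftrightarrow>
     (\<forall>x\<in>carrier R. \<forall>y\<in>carrier R. x \<otimes>\<^bsub>R\<^esub> y = \<one>\<^bsub>R\<^esub> \<longrightarrow> y \<otimes>\<^bsub>R\<^esub> x = \<one>\<^bsub>R\<^esub>)"

definition stably_finite :: "('r, 'l) ring_scheme \<Rightarrow> bool" where
  "stably_finite R \<longleftrightarrow> (\<forall>d\<ge>1. directly_finite (matrix_ring d R))"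

text \<open>As above, the type \<open>'k\<close> in which the fields live is a parameter; \<open>K\<close> ranges over all fields,
  of any characteristic and finite or infinite, whose carrier is a subset of \<open>'k\<close>. A statement that
  holds for every infinite \<open>'k\<close> covers all fields.\<close>

definition Kaplansky_stable_finiteness :: "'k itself \<Rightarrow> ('g, 'm) monoid_scheme \<Rightarrow> bool" where
  "Kaplansky_stable_finiteness (_ :: 'k itself) G \<longleftrightarrow>
     (\<forall>K :: 'k ring. field K \<longrightarrow> stably_finite (group_ring K G))"

end

theory Submission
  imports Defs "HOL-Algebra.Weak_Morphisms" "HOL-Algebra.UnivPoly" "HOL-Algebra.Finite_Extensions"
    "HOL-Number_Theory.Residues"
begin

text \<open>
  \<^bold>\<open>Matrices as automata.\<close> For a ring \<open>R\<close>, a \<open>d \<times> d\<close> matrix \<open>M\<close> over \<open>R[G]\<close> acts on the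
  configurations with values in \<open>R\<^sup>d\<close> by \<open>(M x)(g) = \<Sum>\<^sub>h M(h) x(g h)\<close>. This is an additive cellular
  automaton, the product of matrices becomes composition of automata, and \<open>M\<close> can be read off
  from its action on configurations with a single nonzero entry.

  \<^bold>\<open>From \<open>A\<close>-surjunctivity to stable finiteness.\<close> If \<open>R\<close> is a finite ring and \<open>M N = 1\<close>, then the
  automaton of \<open>N\<close> is injective, hence surjective, so \<open>M\<close> is its two-sided inverse and \<open>N M = 1\<close>.
  An arbitrary field \<open>K\<close> is reduced to this case: suppose that \<open>M N = 1\<close> but \<open>N M - 1\<close> has a nonzero
  coefficient \<open>c\<close>. Every finite subset of \<open>K\<close> lies in a subring \<open>S\<close> which has a proper ideal \<open>I\<close> with
  \<open>S/I\<close> finite. This is applied to the coefficients of \<open>M\<close> and \<open>N\<close> together with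
  the inverse of \<open>c\<close>. Over \<open>S/I\<close> the relation \<open>M N = 1\<close> forces \<open>N M = 1\<close>, so the unit \<open>c\<close> of \<open>S\<close> lies in
  \<open>I\<close>, which is absurd. The subring \<open>S\<close> is found by adjoining one element at a time, starting from the
  prime field (\<open>finite_subset_finite_residue\<close>).

  \<^bold>\<open>From stable finiteness to \<open>A\<close>-surjunctivity.\<close> Let \<open>f\<close> be an injective additive cellular
  automaton with alphabet \<open>A\<close>, and let \<open>p\<close> be a prime dividing the order of some element of \<open>A\<close>. The
  automaton preserves the configurations with values in \<open>p A\<close> and those with values in the \<open>p\<close>-torsion
  \<open>A[p]\<close>. If it is surjective on both then it is surjective: for a configuration \<open>y\<close> there is \<open>w\<close> with
  \<open>p y = f(p w)\<close>, so that \<open>y - f w\<close> takes values in \<open>A[p]\<close>. Since \<open>p A\<close> is smaller than \<open>A\<close>, induction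
  leaves \<open>A[p]\<close>, which is isomorphic to some \<open>F\<^sub>p\<^sup>d\<close>. There \<open>f\<close> is given by a matrix \<open>M\<close> over
  \<open>F\<^sub>p[G]\<close>, and \<open>M\<close> has a left inverse: if some unit row did not lie in the row space of \<open>M\<close>, a linear
  functional on \<open>F\<^sub>p[G]\<^sup>d\<close> that vanishes on the row space but not on this unit row would be a nonzero
  configuration in the kernel of \<open>f\<close> (\<open>injective_matrix_action_left_inverse\<close>). By
  direct finiteness the left inverse is a right inverse too, and \<open>f\<close> is surjective.
\<close>

section \<open>Finite products indexed by pairs\<close>

lemma (in comm_monoid) finprod_cartesian_product:
  assumes "finite A" "finite B" "\<And>a b. a \<in> A \<Longrightarrow> b \<in> B \<Longrightarrow> f a b \<in> carrier G"
  shows "(\<Otimes>a\<in>A. \<Otimes>b\<in>B. f a b) = (\<Otimes>p\<in>A \<times> B. f (fst p) (snd p))"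
  using assms(1,3)
proof (induction A)
  case (insert a A)
  have split: "insert a A \<times> B = ({a} \<times> B) \<union> (A \<times> B)" by auto
  have "(\<Otimes>p\<in>{a} \<times> B. f (fst p) (snd p)) = (\<Otimes>b\<in>B. f a b)"
  proof -
    have "{a} \<times> B = Pair a ` B" by auto
    moreover have "(\<lambda>p. f (fst p) (snd p)) \<in> Pair a ` B \<rightarrow> carrier G"
      using insert.prems by auto
    ultimately show ?thesis
      using finprod_reindex[of "\<lambda>p. f (fst p) (snd p)" "Pair a" B] by (simp add: inj_on_def)
  qed
  moreover have "(\<Otimes>p\<in>insert a A \<times> B. f (fst p) (snd p))
      = (\<Otimes>p\<in>{a} \<times> B. f (fst p) (snd p)) \<otimes> (\<Otimes>p\<in>A \<times> B. f (fst p) (snd p))"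
    unfolding split using insert assms(2) by (intro finprod_Un_disjoint) auto
  ultimately show ?case
    using insert assms(2) by (simp add: Pi_def)
qed simp

lemma (in comm_monoid) finprod_swap:
  assumes "finite A" "finite B" "\<And>a b. a \<in> A \<Longrightarrow> b \<in> B \<Longrightarrow> f a b \<in> carrier G"
  shows "(\<Otimes>a\<in>A. \<Otimes>b\<in>B. f a b) = (\<Otimes>b\<in>B. \<Otimes>a\<in>A. f a b)"
  using assms(1,3)
proof (induction A)
  case (insert a A)
  have "(\<Otimes>b\<in>B. \<Otimes>a\<in>insert a A. f a b) = (\<Otimes>b\<in>B. f a b \<otimes> (\<Otimes>a\<in>A. f a b))"
    using insert by (intro finprod_cong') (auto simp: Pi_def)
  also have "\<dots> = (\<Otimes>b\<in>B. f a b) \<otimes> (\<Otimes>b\<in>B. \<Otimes>a\<in>A. f a b)"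
    using insert by (intro finprod_multf) auto
  finally show ?case using insert assms(2) by (simp add: Pi_def)
qed simp

lemmas (in abelian_monoid) finsum_cartesian_product = add.finprod_cartesian_product
lemmas (in abelian_monoid) finsum_swap = add.finprod_swap
lemmas (in abelian_monoid) finsum_mono_neutral_cong_left = add.finprod_mono_neutral_cong_left
lemmas (in abelian_monoid) finsum_zero_eqI = add.finprod_one_eqI

section \<open>Coefficients in group rings and their matrix rings\<close>

locale group_ring_data = G: group G + R: ring R
  for G :: "('g, 'm) monoid_scheme" and R :: "('r, 'l) ring_scheme"
begin

abbreviation "GR \<equiv> group_ring R G"

lemma carrier_group_ring:
  "a \<in> carrier GR \<longleftrightarrow> a \<in> carrier G \<rightarrow>\<^sub>E carrier R \<and> finite {g \<in> carrier G. a g \<noteq> \<zero>\<^bsub>R\<^esub>}"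
  by (simp add: group_ring_def)

lemma group_ring_coeff_closed [simp, intro]:
  "a \<in> carrier GR \<Longrightarrow> g \<in> carrier G \<Longrightarrow> a g \<in> carrier R"
  by (auto simp: carrier_group_ring)

lemma group_ring_mult_apply:
  assumes a: "a \<in> carrier GR" and b: "b \<in> carrier GR" and g: "g \<in> carrier G"
    and H: "finite H" "H \<subseteq> carrier G" "\<And>h. h \<in> carrier G - H \<Longrightarrow> a h = \<zero>\<^bsub>R\<^esub>"
  shows "(a \<otimes>\<^bsub>GR\<^esub> b) g = (\<Oplus>\<^bsub>R\<^esub>h\<in>H. a h \<otimes>\<^bsub>R\<^esub> b (inv\<^bsub>G\<^esub> h \<otimes>\<^bsub>G\<^esub> g))"
proof -
  have "(\<Oplus>\<^bsub>R\<^esub>h\<in>{h \<in> carrier G. a h \<noteq> \<zero>\<^bsub>R\<^esub>}. a h \<otimes>\<^bsub>R\<^esub> b (inv\<^bsub>G\<^esub> h \<otimes>\<^bsub>G\<^esub> g))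
      = (\<Oplus>\<^bsub>R\<^esub>h\<in>H. a h \<otimes>\<^bsub>R\<^esub> b (inv\<^bsub>G\<^esub> h \<otimes>\<^bsub>G\<^esub> g))"
  proof (rule R.finsum_mono_neutral_cong_left)
    show "a i \<otimes>\<^bsub>R\<^esub> b (inv\<^bsub>G\<^esub> i \<otimes>\<^bsub>G\<^esub> g) = \<zero>\<^bsub>R\<^esub>" if "i \<in> H - {h \<in> carrier G. a h \<noteq> \<zero>\<^bsub>R\<^esub>}" for i
    proof -
      have "i \<in> carrier G" "a i = \<zero>\<^bsub>R\<^esub>" using that H(2) by auto
      then show ?thesis using b g by simp
    qed
  qed (use assms in \<open>auto simp: Pi_def subset_iff\<close>)
  then show ?thesis using g by (simp add: group_ring_def)
qed

lemma group_ring_mult_closed: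
  assumes a: "a \<in> carrier GR" and b: "b \<in> carrier GR"
  shows "a \<otimes>\<^bsub>GR\<^esub> b \<in> carrier GR"
proof -
  define H where "H = {h \<in> carrier G. a h \<noteq> \<zero>\<^bsub>R\<^esub>}"
  define U where "U = {h \<in> carrier G. b h \<noteq> \<zero>\<^bsub>R\<^esub>}"
  have fin: "finite H" "finite U" using a b by (auto simp: carrier_group_ring H_def U_def)
  have "(a \<otimes>\<^bsub>GR\<^esub> b) g = \<zero>\<^bsub>R\<^esub>"
    if g: "g \<in> carrier G" "g \<notin> (\<lambda>(h, u). h \<otimes>\<^bsub>G\<^esub> u) ` (H \<times> U)" for g
  proof -
    have "(a \<otimes>\<^bsub>GR\<^esub> b) g = (\<Oplus>\<^bsub>R\<^esub>h\<in>H. a h \<otimes>\<^bsub>R\<^esub> b (inv\<^bsub>G\<^esub> h \<otimes>\<^bsub>G\<^esub> g))"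
      by (rule group_ring_mult_apply) (use a b g fin in \<open>auto simp: H_def\<close>)
    also have "\<dots> = \<zero>\<^bsub>R\<^esub>"
    proof (rule R.finsum_zero_eqI)
      fix h assume h: "h \<in> H"
      then have hc: "h \<in> carrier G" by (simp add: H_def)
      have "g = h \<otimes>\<^bsub>G\<^esub> (inv\<^bsub>G\<^esub> h \<otimes>\<^bsub>G\<^esub> g)" using hc g by (simp add: G.m_assoc[symmetric])
      then have "inv\<^bsub>G\<^esub> h \<otimes>\<^bsub>G\<^esub> g \<notin> U" using g h by (auto simp: image_iff)
      then have "b (inv\<^bsub>G\<^esub> h \<otimes>\<^bsub>G\<^esub> g) = \<zero>\<^bsub>R\<^esub>" using hc g by (simp add: U_def)
      then show "a h \<otimes>\<^bsub>R\<^esub> b (inv\<^bsub>G\<^esub> h \<otimes>\<^bsub>G\<^esub> g) = \<zero>\<^bsub>R\<^esub>" using hc a by simp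
    qed
    finally show ?thesis .
  qed
  then have "{g \<in> carrier G. (a \<otimes>\<^bsub>GR\<^esub> b) g \<noteq> \<zero>\<^bsub>R\<^esub>} \<subseteq> (\<lambda>(h, u). h \<otimes>\<^bsub>G\<^esub> u) ` (H \<times> U)" by blast
  then have "finite {g \<in> carrier G. (a \<otimes>\<^bsub>GR\<^esub> b) g \<noteq> \<zero>\<^bsub>R\<^esub>}"
    using fin by (meson finite_SigmaI finite_imageI finite_subset)
  moreover have "a \<otimes>\<^bsub>GR\<^esub> b \<in> carrier G \<rightarrow>\<^sub>E carrier R"
    using a b by (auto simp: group_ring_def intro!: R.finsum_closed)
  ultimately show ?thesis by (simp add: carrier_group_ring)
qed

lemma group_ring_add_apply: "g \<in> carrier G \<Longrightarrow> (a \<oplus>\<^bsub>GR\<^esub> b) g = a g \<oplus>\<^bsub>R\<^esub> b g"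
  by (simp add: group_ring_def)

lemma group_ring_zero_apply: "g \<in> carrier G \<Longrightarrow> \<zero>\<^bsub>GR\<^esub> g = \<zero>\<^bsub>R\<^esub>"
  by (simp add: group_ring_def)

lemma group_ring_one_apply:
  "g \<in> carrier G \<Longrightarrow> \<one>\<^bsub>GR\<^esub> g = (if g = \<one>\<^bsub>G\<^esub> then \<one>\<^bsub>R\<^esub> else \<zero>\<^bsub>R\<^esub>)"
  by (simp add: group_ring_def)

lemma group_ring_eqI:
  assumes "a \<in> carrier GR" "b \<in> carrier GR" "\<And>g. g \<in> carrier G \<Longrightarrow> a g = b g"
  shows "a = b"
  using assms by (intro PiE_ext[of a "carrier G" _ b]) (auto simp: carrier_group_ring)

lemma group_ring_add_closed:
  assumes "a \<in> carrier GR" "b \<in> carrier GR"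
  shows "a \<oplus>\<^bsub>GR\<^esub> b \<in> carrier GR"
proof -
  have "{g \<in> carrier G. (a \<oplus>\<^bsub>GR\<^esub> b) g \<noteq> \<zero>\<^bsub>R\<^esub>}
      \<subseteq> {g \<in> carrier G. a g \<noteq> \<zero>\<^bsub>R\<^esub>} \<union> {g \<in> carrier G. b g \<noteq> \<zero>\<^bsub>R\<^esub>}"
    by (auto simp: group_ring_add_apply)
  moreover have "finite ({g \<in> carrier G. a g \<noteq> \<zero>\<^bsub>R\<^esub>} \<union> {g \<in> carrier G. b g \<noteq> \<zero>\<^bsub>R\<^esub>})"
    using assms by (simp add: carrier_group_ring)
  ultimately have "finite {g \<in> carrier G. (a \<oplus>\<^bsub>GR\<^esub> b) g \<noteq> \<zero>\<^bsub>R\<^esub>}"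
    using finite_subset by blast
  moreover have "a \<oplus>\<^bsub>GR\<^esub> b \<in> carrier G \<rightarrow>\<^sub>E carrier R"
    using assms by (auto simp: group_ring_def)
  ultimately show ?thesis by (simp add: carrier_group_ring)
qed

lemma abelian_group_group_ring: "abelian_group GR"
proof (rule abelian_groupI)
  show zero: "\<zero>\<^bsub>GR\<^esub> \<in> carrier GR" by (auto simp: group_ring_def)
  show "\<exists>y\<in>carrier GR. y \<oplus>\<^bsub>GR\<^esub> x = \<zero>\<^bsub>GR\<^esub>" if x: "x \<in> carrier GR" for x
  proof
    have "{g \<in> carrier G. \<ominus>\<^bsub>R\<^esub> x g \<noteq> \<zero>\<^bsub>R\<^esub>} \<subseteq> {g \<in> carrier G. x g \<noteq> \<zero>\<^bsub>R\<^esub>}" by auto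
    then show y: "(\<lambda>g\<in>carrier G. \<ominus>\<^bsub>R\<^esub> x g) \<in> carrier GR"
      using x finite_subset unfolding carrier_group_ring
      by (auto simp: PiE_iff cong: conj_cong intro: finite_subset)
    show "(\<lambda>g\<in>carrier G. \<ominus>\<^bsub>R\<^esub> x g) \<oplus>\<^bsub>GR\<^esub> x = \<zero>\<^bsub>GR\<^esub>"
      by (rule group_ring_eqI)
        (use x y zero in \<open>auto simp: group_ring_add_closed group_ring_add_apply group_ring_zero_apply R.l_neg\<close>)
  qed
  show "\<zero>\<^bsub>GR\<^esub> \<oplus>\<^bsub>GR\<^esub> x = x" if "x \<in> carrier GR" for x
    by (rule group_ring_eqI)
      (use that zero in \<open>auto simp: group_ring_add_closed group_ring_add_apply group_ring_zero_apply\<close>)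
  show "x \<oplus>\<^bsub>GR\<^esub> y \<oplus>\<^bsub>GR\<^esub> z = x \<oplus>\<^bsub>GR\<^esub> (y \<oplus>\<^bsub>GR\<^esub> z)"
    if "x \<in> carrier GR" "y \<in> carrier GR" "z \<in> carrier GR" for x y z
    by (rule group_ring_eqI)
      (use that in \<open>auto simp: group_ring_add_closed group_ring_add_apply R.a_assoc\<close>)
  show "x \<oplus>\<^bsub>GR\<^esub> y = y \<oplus>\<^bsub>GR\<^esub> x" if "x \<in> carrier GR" "y \<in> carrier GR" for x y
    by (rule group_ring_eqI)
      (use that in \<open>auto simp: group_ring_add_closed group_ring_add_apply R.a_comm\<close>)
qed (simp add: group_ring_add_closed)

lemma group_ring_one_closed: "\<one>\<^bsub>GR\<^esub> \<in> carrier GR"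
proof -
  have "{g \<in> carrier G. \<one>\<^bsub>GR\<^esub> g \<noteq> \<zero>\<^bsub>R\<^esub>} \<subseteq> {\<one>\<^bsub>G\<^esub>}"
    by (auto simp: group_ring_one_apply split: if_splits)
  then have "finite {g \<in> carrier G. \<one>\<^bsub>GR\<^esub> g \<noteq> \<zero>\<^bsub>R\<^esub>}" using finite_subset by blast
  then show ?thesis by (auto simp: carrier_group_ring group_ring_def)
qed

lemma group_ring_finsum_apply:
  assumes "finite A" "\<And>k. k \<in> A \<Longrightarrow> f k \<in> carrier GR" "g \<in> carrier G"
  shows "(\<Oplus>\<^bsub>GR\<^esub>k\<in>A. f k) g = (\<Oplus>\<^bsub>R\<^esub>k\<in>A. f k g)"
  using assms(1,2)
proof (induction A)
  interpret GR: abelian_group GR by (rule abelian_group_group_ring)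
  case empty
  show ?case using assms(3) by (simp add: group_ring_zero_apply)
next
  interpret GR: abelian_group GR by (rule abelian_group_group_ring)
  case (insert a A)
  then show ?case using assms(3) by (simp add: group_ring_add_apply Pi_def)
qed

text \<open>All entries of a matrix are treated with one common finite support.\<close>

definition matrix_support :: "nat \<Rightarrow> (nat \<times> nat \<Rightarrow> 'g \<Rightarrow> 'r) \<Rightarrow> 'g set" where
  "matrix_support d M = {h \<in> carrier G. \<exists>i<d. \<exists>k<d. M (i, k) h \<noteq> \<zero>\<^bsub>R\<^esub>}"

lemma matrix_entry_closed [simp, intro]:
  "M \<in> carrier (matrix_ring d GR) \<Longrightarrow> i < d \<Longrightarrow> k < d \<Longrightarrow> M (i, k) \<in> carrier GR"
  by (auto simp: matrix_ring_def)

lemma matrix_coeff_closed [simp, intro]: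
  "M \<in> carrier (matrix_ring d GR) \<Longrightarrow> i < d \<Longrightarrow> k < d \<Longrightarrow> g \<in> carrier G \<Longrightarrow> M (i, k) g \<in> carrier R"
  by (meson group_ring_coeff_closed matrix_entry_closed)

lemma finite_matrix_support:
  assumes "M \<in> carrier (matrix_ring d GR)"
  shows "finite (matrix_support d M)"
proof -
  have "matrix_support d M = (\<Union>i<d. \<Union>k<d. {h \<in> carrier G. M (i, k) h \<noteq> \<zero>\<^bsub>R\<^esub>})"
    by (auto simp: matrix_support_def)
  moreover have "finite {h \<in> carrier G. M (i, k) h \<noteq> \<zero>\<^bsub>R\<^esub>}" if "i < d" "k < d" for i k
    using matrix_entry_closed[OF assms that] carrier_group_ring by blast
  ultimately show ?thesis by simp
qed

text \<open>The nested sums hidden in the product of matrices over a group ring are flattened into one sum over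
  \<open>{..<d} \<times> H\<close>. The freedom to choose any finite \<open>H\<close> that contains the support makes it possible to
  compare several products over a common index set.\<close>

lemma matrix_mult_apply:
  assumes M: "M \<in> carrier (matrix_ring d GR)" and N: "N \<in> carrier (matrix_ring d GR)"
    and ij: "i < d" "j < d" and g: "g \<in> carrier G"
    and H: "finite H" "H \<subseteq> carrier G" "matrix_support d M \<subseteq> H"
  shows "(M \<otimes>\<^bsub>matrix_ring d GR\<^esub> N) (i, j) g
    = (\<Oplus>\<^bsub>R\<^esub>p\<in>{..<d} \<times> H. M (i, fst p) (snd p) \<otimes>\<^bsub>R\<^esub> N (fst p, j) (inv\<^bsub>G\<^esub> (snd p) \<otimes>\<^bsub>G\<^esub> g))"
proof -
  have "(M \<otimes>\<^bsub>matrix_ring d GR\<^esub> N) (i, j) g = (\<Oplus>\<^bsub>GR\<^esub>k\<in>{..<d}. M (i, k) \<otimes>\<^bsub>GR\<^esub> N (k, j)) g"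
    using ij by (simp add: matrix_ring_def)
  also have "\<dots> = (\<Oplus>\<^bsub>R\<^esub>k\<in>{..<d}. (M (i, k) \<otimes>\<^bsub>GR\<^esub> N (k, j)) g)"
    by (rule group_ring_finsum_apply) (use M N ij g group_ring_mult_closed in auto)
  also have "\<dots> = (\<Oplus>\<^bsub>R\<^esub>k\<in>{..<d}. \<Oplus>\<^bsub>R\<^esub>h\<in>H. M (i, k) h \<otimes>\<^bsub>R\<^esub> N (k, j) (inv\<^bsub>G\<^esub> h \<otimes>\<^bsub>G\<^esub> g))"
  proof (rule R.finsum_cong')
    fix k assume k: "k \<in> {..<d}"
    have "M (i, k) h = \<zero>\<^bsub>R\<^esub>" if "h \<in> carrier G - H" for h
      using that H(3) ij k by (auto simp: matrix_support_def)
    then show "(M (i, k) \<otimes>\<^bsub>GR\<^esub> N (k, j)) g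
        = (\<Oplus>\<^bsub>R\<^esub>h\<in>H. M (i, k) h \<otimes>\<^bsub>R\<^esub> N (k, j) (inv\<^bsub>G\<^esub> h \<otimes>\<^bsub>G\<^esub> g))"
      using M N ij k g H by (intro group_ring_mult_apply) auto
  qed (use M N ij g H in \<open>auto simp: subset_iff intro!: R.finsum_closed R.m_closed\<close>)
  also have "\<dots> = (\<Oplus>\<^bsub>R\<^esub>p\<in>{..<d} \<times> H. M (i, fst p) (snd p) \<otimes>\<^bsub>R\<^esub> N (fst p, j) (inv\<^bsub>G\<^esub> (snd p) \<otimes>\<^bsub>G\<^esub> g))"
    by (rule R.finsum_cartesian_product)
      (use M N ij g H in \<open>auto simp: subset_iff intro!: R.m_closed\<close>)
  finally show ?thesis .
qed

lemma matrix_mult_closed: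
  assumes M: "M \<in> carrier (matrix_ring d GR)" and N: "N \<in> carrier (matrix_ring d GR)"
  shows "M \<otimes>\<^bsub>matrix_ring d GR\<^esub> N \<in> carrier (matrix_ring d GR)"
proof -
  interpret GR: abelian_group GR by (rule abelian_group_group_ring)
  show ?thesis
    using M N by (auto simp: matrix_ring_def PiE_iff intro!: GR.finsum_closed group_ring_mult_closed)
qed

lemma matrix_one_apply:
  "i < d \<Longrightarrow> j < d \<Longrightarrow> g \<in> carrier G \<Longrightarrow>
   \<one>\<^bsub>matrix_ring d GR\<^esub> (i, j) g = (if i = j \<and> g = \<one>\<^bsub>G\<^esub> then \<one>\<^bsub>R\<^esub> else \<zero>\<^bsub>R\<^esub>)"
  by (simp add: matrix_ring_def group_ring_one_apply group_ring_zero_apply)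

lemma matrix_one_closed: "\<one>\<^bsub>matrix_ring d GR\<^esub> \<in> carrier (matrix_ring d GR)"
proof -
  interpret GR: abelian_group GR by (rule abelian_group_group_ring)
  show ?thesis by (auto simp: matrix_ring_def group_ring_one_closed)
qed

lemma matrix_eqI:
  assumes M: "M \<in> carrier (matrix_ring d GR)" and N: "N \<in> carrier (matrix_ring d GR)"
    and eq: "\<And>i j g. i < d \<Longrightarrow> j < d \<Longrightarrow> g \<in> carrier G \<Longrightarrow> M (i, j) g = N (i, j) g"
  shows "M = N"
proof (rule PiE_ext[of M "{..<d} \<times> {..<d}" "\<lambda>_. carrier GR" N])
  show "M p = N p" if "p \<in> {..<d} \<times> {..<d}" for p
    using that by (cases p) (auto intro!: group_ring_eqI eq M N)
qed (use M N in \<open>auto simp: matrix_ring_def\<close>)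

lemma matrix_carrierI:
  assumes "finite W"
    and "\<And>i k g. i < d \<Longrightarrow> k < d \<Longrightarrow> g \<in> carrier G \<Longrightarrow> F i k g \<in> carrier R"
    and "\<And>i k g. i < d \<Longrightarrow> k < d \<Longrightarrow> g \<in> carrier G \<Longrightarrow> g \<notin> W \<Longrightarrow> F i k g = \<zero>\<^bsub>R\<^esub>"
  shows "(\<lambda>(i, k)\<in>{..<d} \<times> {..<d}. \<lambda>g\<in>carrier G. F i k g) \<in> carrier (matrix_ring d GR)"
proof -
  have "(\<lambda>g\<in>carrier G. F i k g) \<in> carrier GR" if "i < d" "k < d" for i k
  proof -
    have "{g \<in> carrier G. (\<lambda>g\<in>carrier G. F i k g) g \<noteq> \<zero>\<^bsub>R\<^esub>} \<subseteq> W"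
      using assms(3) that by auto
    then have "finite {g \<in> carrier G. (\<lambda>g\<in>carrier G. F i k g) g \<noteq> \<zero>\<^bsub>R\<^esub>}"
      using assms(1) finite_subset by blast
    moreover have "(\<lambda>g\<in>carrier G. F i k g) \<in> carrier G \<rightarrow>\<^sub>E carrier R"
      using assms(2) that by auto
    ultimately show ?thesis unfolding carrier_group_ring by (rule conjI[rotated])
  qed
  then show ?thesis by (auto simp: matrix_ring_def)
qed

end

section \<open>Additive cellular automata and their alphabets\<close>

lemma topspace_config_space [simp]: "topspace (config_space G F) = carrier G \<rightarrow>\<^sub>E F"
  by (simp add: config_space_def)

lemma (in group) shift_in_config:
  assumes "\<gamma> \<in> carrier G" "x \<in> carrier G \<rightarrow>\<^sub>E F"
  shows "shift G \<gamma> x \<in> carrier G \<rightarrow>\<^sub>E F"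
  using assms by (auto simp: shift_def)

text \<open>For an additive map, continuity is continuity at the trivial configuration, and by equivariance only
  the coordinate at the identity of the group matters. There, a basic open neighbourhood of the trivial
  configuration prescribes the values at finitely many places. This replaces the product topology by
  the existence of a finite window \<open>W\<close>.\<close>

lemma (in group) additive_cellular_automaton_iff:
  assumes A: "comm_group A"
  shows "additive_cellular_automaton G A f \<longleftrightarrow>
     f \<in> hom (product_group (carrier G) (\<lambda>_. A)) (product_group (carrier G) (\<lambda>_. A)) \<and>
     (\<forall>\<gamma>\<in>carrier G. \<forall>x\<in>carrier G \<rightarrow>\<^sub>E carrier A. f (shift G \<gamma> x) = shift G \<gamma> (f x)) \<and>
     (\<exists>W. finite W \<and> W \<subseteq> carrier G \<and>
        (\<forall>x\<in>carrier G \<rightarrow>\<^sub>E carrier A. (\<forall>w\<in>W. x w = \<one>\<^bsub>A\<^esub>) \<longrightarrow> f x \<one> = \<one>\<^bsub>A\<^esub>))"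
    (is "_ \<longleftrightarrow> ?hom \<and> ?equi \<and> ?loc")
proof -
  interpret A: comm_group A by (rule A)
  let ?P = "product_group (carrier G) (\<lambda>_. A)"
  interpret P: group ?P by (simp add: A.is_group)
  have "continuous_map (config_space G (carrier A)) (config_space G (carrier A)) f \<longleftrightarrow> ?loc"
    if hom: ?hom and equi: ?equi
  proof
    assume "continuous_map (config_space G (carrier A)) (config_space G (carrier A)) f"
    then have "continuous_map (config_space G (carrier A)) (discrete_topology (carrier A)) (\<lambda>x. f x \<one>)"
      by (simp add: config_space_def continuous_map_componentwise)
    then have "openin (config_space G (carrier A)) {x \<in> carrier G \<rightarrow>\<^sub>E carrier A. f x \<one> \<in> {\<one>\<^bsub>A\<^esub>}}"
      using openin_continuous_map_preimage[where U = "{\<one>\<^bsub>A\<^esub>}"] by fastforce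
    moreover have "\<one>\<^bsub>?P\<^esub> \<in> {x \<in> carrier G \<rightarrow>\<^sub>E carrier A. f x \<one> \<in> {\<one>\<^bsub>A\<^esub>}}"
      using hom_one[OF hom P.is_group P.is_group] by simp
    ultimately obtain U where U: "finite {g \<in> carrier G. U g \<noteq> carrier A}" "\<one>\<^bsub>?P\<^esub> \<in> Pi\<^sub>E (carrier G) U"
        "Pi\<^sub>E (carrier G) U \<subseteq> {x \<in> carrier G \<rightarrow>\<^sub>E carrier A. f x \<one> \<in> {\<one>\<^bsub>A\<^esub>}}"
      unfolding config_space_def openin_product_topology_alt topspace_discrete_topology by blast
    show ?loc
    proof (intro exI conjI ballI impI)
      fix x assume x: "x \<in> carrier G \<rightarrow>\<^sub>E carrier A" "\<forall>w\<in>{g \<in> carrier G. U g \<noteq> carrier A}. x w = \<one>\<^bsub>A\<^esub>"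
      have "x g \<in> U g" if "g \<in> carrier G" for g
        using x U(2) that by (cases "U g = carrier A") (auto simp: PiE_iff)
      then have "x \<in> Pi\<^sub>E (carrier G) U" using x(1) by (auto simp: PiE_iff)
      then show "f x \<one> = \<one>\<^bsub>A\<^esub>" using U(3) by auto
    qed (use U in auto)
  next
    assume ?loc
    then obtain W where W: "finite W" "W \<subseteq> carrier G"
        "\<And>x. x \<in> carrier G \<rightarrow>\<^sub>E carrier A \<Longrightarrow> \<forall>w\<in>W. x w = \<one>\<^bsub>A\<^esub> \<Longrightarrow> f x \<one> = \<one>\<^bsub>A\<^esub>"
      by blast
    have fcl: "f x \<in> carrier G \<rightarrow>\<^sub>E carrier A" if "x \<in> carrier G \<rightarrow>\<^sub>E carrier A" for x
      using hom_in_carrier[OF hom] that by simp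
    have agree: "f x g = f y g"
      if x: "x \<in> carrier G \<rightarrow>\<^sub>E carrier A" and y: "y \<in> carrier G \<rightarrow>\<^sub>E carrier A" and g: "g \<in> carrier G"
        and eq: "\<And>w. w \<in> W \<Longrightarrow> x (g \<otimes> w) = y (g \<otimes> w)" for x y g
    proof -
      define z where "z = x \<otimes>\<^bsub>?P\<^esub> inv\<^bsub>?P\<^esub> y"
      have z: "z \<in> carrier ?P" using x y unfolding z_def by (intro P.m_closed P.inv_closed) auto
      have zg: "z h = x h \<otimes>\<^bsub>A\<^esub> inv\<^bsub>A\<^esub> y h" if "h \<in> carrier G" for h
        using that y by (simp add: z_def A.is_group)
      have "shift G (inv g) z w = \<one>\<^bsub>A\<^esub>" if "w \<in> W" for w
      proof -
        have "shift G (inv g) z w = z (g \<otimes> w)" using that W(2) g by (auto simp: shift_def)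
        also have "\<dots> = y (g \<otimes> w) \<otimes>\<^bsub>A\<^esub> inv\<^bsub>A\<^esub> y (g \<otimes> w)" using that W(2) g zg eq[OF that] by auto
        also have "\<dots> = \<one>\<^bsub>A\<^esub>" using y that W(2) g by (intro A.r_inv) auto
        finally show ?thesis .
      qed
      then have "f (shift G (inv g) z) \<one> = \<one>\<^bsub>A\<^esub>"
        using z g by (intro W(3) shift_in_config ballI) simp_all
      moreover have "f (shift G (inv g) z) = shift G (inv g) (f z)" using equi z g by simp
      ultimately have "f z g = \<one>\<^bsub>A\<^esub>" using g by (simp add: shift_def)
      moreover have "f z = f x \<otimes>\<^bsub>?P\<^esub> inv\<^bsub>?P\<^esub> (f y)"
        unfolding z_def using hom_mult[OF hom, of x "inv\<^bsub>?P\<^esub> y"] x y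
          group_hom.hom_inv[of ?P ?P f y] hom P.inv_closed[of y]
        by (simp add: group_hom_def group_hom_axioms_def P.is_group del: inv_product_group mult_product_group)
      ultimately have "f x g \<otimes>\<^bsub>A\<^esub> inv\<^bsub>A\<^esub> f y g = \<one>\<^bsub>A\<^esub>"
        using g fcl[OF y] by (simp add: A.is_group)
      then show ?thesis using fcl[OF x] fcl[OF y] g
        by (metis A.inv_closed A.inv_equality A.inv_inv PiE_mem)
    qed
    show "continuous_map (config_space G (carrier A)) (config_space G (carrier A)) f"
      unfolding config_space_def continuous_map_componentwise
    proof (intro conjI ballI)
      show "f ` topspace (product_topology (\<lambda>_. discrete_topology (carrier A)) (carrier G)) \<subseteq> extensional (carrier G)"
        using fcl by (auto simp: PiE_iff)
      fix g assume g: "g \<in> carrier G"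
      have fin: "finite ((\<otimes>) g ` W)" using W by simp
      show "continuous_map (product_topology (\<lambda>_. discrete_topology (carrier A)) (carrier G))
              (discrete_topology (carrier A)) (\<lambda>x. f x g)"
        unfolding continuous_map_def
      proof (intro conjI allI impI)
        show "(\<lambda>x. f x g) \<in> topspace (product_topology (\<lambda>_. discrete_topology (carrier A)) (carrier G))
            \<rightarrow> topspace (discrete_topology (carrier A))"
          using fcl g by (auto simp: PiE_iff)
        fix V
        show "openin (product_topology (\<lambda>_. discrete_topology (carrier A)) (carrier G))
           {x \<in> topspace (product_topology (\<lambda>_. discrete_topology (carrier A)) (carrier G)). f x g \<in> V}"
          unfolding openin_product_topology_alt
        proof (intro ballI)
          fix x assume "x \<in> {x \<in> topspace (product_topology (\<lambda>_. discrete_topology (carrier A)) (carrier G)). f x g \<in> V}"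
          then have x: "x \<in> carrier G \<rightarrow>\<^sub>E carrier A" "f x g \<in> V" by auto
          define U where "U h = (if h \<in> (\<otimes>) g ` W then {x h} else carrier A)" for h
          have "finite {h \<in> carrier G. U h \<noteq> topspace (discrete_topology (carrier A))}"
            by (rule finite_subset[OF _ fin]) (auto simp: U_def)
          moreover have "\<forall>h\<in>carrier G. openin (discrete_topology (carrier A)) (U h)"
            using x by (auto simp: U_def)
          moreover have "x \<in> Pi\<^sub>E (carrier G) U" using x by (auto simp: U_def PiE_iff)
          moreover have "Pi\<^sub>E (carrier G) U \<subseteq> {x \<in> topspace (product_topology (\<lambda>_. discrete_topology (carrier A)) (carrier G)). f x g \<in> V}"
          proof
            fix y assume y: "y \<in> Pi\<^sub>E (carrier G) U"
            have "U h \<subseteq> carrier A" if "h \<in> carrier G" for h using x that by (auto simp: U_def)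
            then have y': "y \<in> carrier G \<rightarrow>\<^sub>E carrier A" using y by (auto simp: PiE_iff)
            have "y (g \<otimes> w) = x (g \<otimes> w)" if "w \<in> W" for w
            proof -
              have "y (g \<otimes> w) \<in> U (g \<otimes> w)" using y that W(2) g by (auto simp: PiE_iff)
              then show ?thesis using that by (simp add: U_def)
            qed
            then have "f y g = f x g" using agree y' x g by blast
            then show "y \<in> {x \<in> topspace (product_topology (\<lambda>_. discrete_topology (carrier A)) (carrier G)). f x g \<in> V}"
              using y' x by simp
          qed
          ultimately show "\<exists>U. finite {i \<in> carrier G. U i \<noteq> topspace (discrete_topology (carrier A))} \<and>
               (\<forall>i\<in>carrier G. openin (discrete_topology (carrier A)) (U i)) \<and> x \<in> Pi\<^sub>E (carrier G) U \<and>
               Pi\<^sub>E (carrier G) U \<subseteq> {x \<in> topspace (product_topology (\<lambda>_. discrete_topology (carrier A)) (carrier G)). f x g \<in> V}"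
            by blast
        qed
      qed
    qed
  qed
  then show ?thesis
    unfolding additive_cellular_automaton_def cellular_automaton_def by auto
qed

text \<open>The property of a single alphabet whose validity for all finite abelian alphabets is
  \<open>A\<close>-surjunctivity. In contrast to \<open>A_surjunctive\<close>, it allows alphabets in different types.\<close>

definition surjunctive_alphabet :: "('g, 'm) monoid_scheme \<Rightarrow> ('a, 'n) monoid_scheme \<Rightarrow> bool" where
  "surjunctive_alphabet G A \<longleftrightarrow>
     (\<forall>f. additive_cellular_automaton G A f \<and> inj_on f (carrier G \<rightarrow>\<^sub>E carrier A) \<longrightarrow>
        f ` (carrier G \<rightarrow>\<^sub>E carrier A) = carrier G \<rightarrow>\<^sub>E carrier A)"

text \<open>An isomorphism of alphabets, applied at every place of a configuration, conjugates the additive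
  cellular automata over one alphabet into those over the other.\<close>

lemma (in group) surjunctive_alphabet_iso:
  assumes A: "comm_group A" and B: "comm_group B" and iso: "A \<cong> B"
    and surj: "surjunctive_alphabet G A"
  shows "surjunctive_alphabet G B"
  unfolding surjunctive_alphabet_def
proof (intro allI impI)
  fix f assume f: "additive_cellular_automaton G B f \<and> inj_on f (carrier G \<rightarrow>\<^sub>E carrier B)"
  interpret A: comm_group A by (rule A)
  interpret B: comm_group B by (rule B)
  obtain \<phi> where \<phi>: "\<phi> \<in> iso A B" using iso unfolding is_iso_def by auto
  define \<psi> where "\<psi> = inv_into (carrier A) \<phi>"
  have \<psi>: "\<psi> \<in> iso B A" unfolding \<psi>_def using A.iso_set_sym[OF \<phi>] .
  have \<phi>c: "\<phi> a \<in> carrier B" if "a \<in> carrier A" for a using \<phi> that by (auto simp: iso_def hom_def)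
  have \<psi>c: "\<psi> b \<in> carrier A" if "b \<in> carrier B" for b using \<psi> that by (auto simp: iso_def hom_def)
  have \<phi>\<psi>: "\<phi> (\<psi> b) = b" if "b \<in> carrier B" for b
    using \<phi> that unfolding \<psi>_def iso_def bij_betw_def by (auto intro: f_inv_into_f)
  have \<psi>\<phi>: "\<psi> (\<phi> a) = a" if "a \<in> carrier A" for a
    using \<phi> that unfolding \<psi>_def iso_def bij_betw_def by (auto intro: inv_into_f_f)
  have \<phi>m: "\<phi> (a \<otimes>\<^bsub>A\<^esub> b) = \<phi> a \<otimes>\<^bsub>B\<^esub> \<phi> b" if "a \<in> carrier A" "b \<in> carrier A" for a b
    using \<phi> that by (auto simp: iso_def hom_def)
  have \<psi>m: "\<psi> (a \<otimes>\<^bsub>B\<^esub> b) = \<psi> a \<otimes>\<^bsub>A\<^esub> \<psi> b" if "a \<in> carrier B" "b \<in> carrier B" for a b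
    using \<psi> that by (auto simp: iso_def hom_def)
  have \<phi>1: "\<phi> \<one>\<^bsub>A\<^esub> = \<one>\<^bsub>B\<^esub>" and \<psi>1: "\<psi> \<one>\<^bsub>B\<^esub> = \<one>\<^bsub>A\<^esub>"
    using hom_one[of \<phi> A B] hom_one[of \<psi> B A] \<phi> \<psi> by (auto simp: iso_def A.is_group B.is_group)
  define \<Phi> where "\<Phi> x = (\<lambda>g\<in>carrier G. \<phi> (x g))" for x :: "'a \<Rightarrow> 'c"
  define \<Psi> where "\<Psi> x = (\<lambda>g\<in>carrier G. \<psi> (x g))" for x :: "'a \<Rightarrow> 'e"
  have \<Phi>c: "\<Phi> x \<in> carrier G \<rightarrow>\<^sub>E carrier B" if "x \<in> carrier G \<rightarrow>\<^sub>E carrier A" for x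
    using that by (auto simp: \<Phi>_def intro!: \<phi>c)
  have \<Psi>c: "\<Psi> x \<in> carrier G \<rightarrow>\<^sub>E carrier A" if "x \<in> carrier G \<rightarrow>\<^sub>E carrier B" for x
    using that by (auto simp: \<Psi>_def intro!: \<psi>c)
  have \<Phi>\<Psi>: "\<Phi> (\<Psi> x) = x" if "x \<in> carrier G \<rightarrow>\<^sub>E carrier B" for x
    by (rule PiE_ext[OF \<Phi>c[OF \<Psi>c[OF that]] that]) (use that in \<open>auto simp: \<Phi>_def \<Psi>_def \<phi>\<psi> PiE_iff\<close>)
  have \<Psi>\<Phi>: "\<Psi> (\<Phi> x) = x" if "x \<in> carrier G \<rightarrow>\<^sub>E carrier A" for x
    by (rule PiE_ext[OF \<Psi>c[OF \<Phi>c[OF that]] that]) (use that in \<open>auto simp: \<Phi>_def \<Psi>_def \<psi>\<phi> PiE_iff\<close>)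
  have f_hom: "f \<in> hom (product_group (carrier G) (\<lambda>_. B)) (product_group (carrier G) (\<lambda>_. B))"
    and f_equi: "\<And>\<gamma> x. \<gamma> \<in> carrier G \<Longrightarrow> x \<in> carrier G \<rightarrow>\<^sub>E carrier B \<Longrightarrow> f (shift G \<gamma> x) = shift G \<gamma> (f x)"
    using f unfolding additive_cellular_automaton_iff[OF B] by auto
  have "\<exists>W. finite W \<and> W \<subseteq> carrier G \<and>
      (\<forall>x\<in>carrier G \<rightarrow>\<^sub>E carrier B. (\<forall>w\<in>W. x w = \<one>\<^bsub>B\<^esub>) \<longrightarrow> f x \<one> = \<one>\<^bsub>B\<^esub>)"
    using f unfolding additive_cellular_automaton_iff[OF B] by (elim conjE)
  then obtain W where W: "finite W" "W \<subseteq> carrier G"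
      "\<And>x. x \<in> carrier G \<rightarrow>\<^sub>E carrier B \<Longrightarrow> \<forall>w\<in>W. x w = \<one>\<^bsub>B\<^esub> \<Longrightarrow> f x \<one> = \<one>\<^bsub>B\<^esub>"
    by (elim exE conjE) (rule that, auto)
  have fcl: "f x \<in> carrier G \<rightarrow>\<^sub>E carrier B" if "x \<in> carrier G \<rightarrow>\<^sub>E carrier B" for x
    using hom_in_carrier[OF f_hom] that by simp
  define f' where "f' x = \<Psi> (f (\<Phi> x))" for x
  have "additive_cellular_automaton G A f'"
    unfolding additive_cellular_automaton_iff[OF A]
  proof (intro conjI ballI)
    show "f' \<in> hom (product_group (carrier G) (\<lambda>_. A)) (product_group (carrier G) (\<lambda>_. A))"
    proof (rule homI)
      show "f' x \<in> carrier (product_group (carrier G) (\<lambda>_. A))"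
        if "x \<in> carrier (product_group (carrier G) (\<lambda>_. A))" for x
        using that \<Psi>c fcl \<Phi>c by (simp add: f'_def)
      fix x y assume "x \<in> carrier (product_group (carrier G) (\<lambda>_. A))" "y \<in> carrier (product_group (carrier G) (\<lambda>_. A))"
      then have x: "x \<in> carrier G \<rightarrow>\<^sub>E carrier A" and y: "y \<in> carrier G \<rightarrow>\<^sub>E carrier A" by auto
      have "\<Phi> (x \<otimes>\<^bsub>product_group (carrier G) (\<lambda>_. A)\<^esub> y) = \<Phi> x \<otimes>\<^bsub>product_group (carrier G) (\<lambda>_. B)\<^esub> \<Phi> y"
        using x y by (auto simp: \<Phi>_def \<phi>m PiE_iff)
      then have "f (\<Phi> (x \<otimes>\<^bsub>product_group (carrier G) (\<lambda>_. A)\<^esub> y))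
          = f (\<Phi> x) \<otimes>\<^bsub>product_group (carrier G) (\<lambda>_. B)\<^esub> f (\<Phi> y)"
        using hom_mult[OF f_hom] \<Phi>c x y by simp
      then show "f' (x \<otimes>\<^bsub>product_group (carrier G) (\<lambda>_. A)\<^esub> y) = f' x \<otimes>\<^bsub>product_group (carrier G) (\<lambda>_. A)\<^esub> f' y"
        using fcl[OF \<Phi>c[OF x]] fcl[OF \<Phi>c[OF y]] by (auto simp: f'_def \<Psi>_def \<psi>m PiE_iff)
    qed
    fix \<gamma> x assume \<gamma>: "\<gamma> \<in> carrier G" and x: "x \<in> carrier G \<rightarrow>\<^sub>E carrier A"
    have "\<Phi> (shift G \<gamma> x) = shift G \<gamma> (\<Phi> x)" using \<gamma> by (auto simp: \<Phi>_def shift_def)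
    moreover have "\<Psi> (shift G \<gamma> z) = shift G \<gamma> (\<Psi> z)" for z using \<gamma> by (auto simp: \<Psi>_def shift_def)
    ultimately show "f' (shift G \<gamma> x) = shift G \<gamma> (f' x)"
      using f_equi \<gamma> \<Phi>c[OF x] by (simp add: f'_def)
  next
    show "\<exists>W. finite W \<and> W \<subseteq> carrier G \<and>
        (\<forall>x\<in>carrier G \<rightarrow>\<^sub>E carrier A. (\<forall>w\<in>W. x w = \<one>\<^bsub>A\<^esub>) \<longrightarrow> f' x \<one> = \<one>\<^bsub>A\<^esub>)"
    proof (intro exI conjI ballI impI)
      fix x assume x: "x \<in> carrier G \<rightarrow>\<^sub>E carrier A" "\<forall>w\<in>W. x w = \<one>\<^bsub>A\<^esub>"
      have "\<forall>w\<in>W. \<Phi> x w = \<one>\<^bsub>B\<^esub>" using x W(2) \<phi>1 by (auto simp: \<Phi>_def)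
      then have "f (\<Phi> x) \<one> = \<one>\<^bsub>B\<^esub>" using W(3) \<Phi>c x by blast
      then show "f' x \<one> = \<one>\<^bsub>A\<^esub>" by (simp add: f'_def \<Psi>_def \<psi>1)
    qed (use W in auto)
  qed
  moreover have "inj_on f' (carrier G \<rightarrow>\<^sub>E carrier A)"
  proof (rule inj_onI)
    fix x y assume x: "x \<in> carrier G \<rightarrow>\<^sub>E carrier A" and y: "y \<in> carrier G \<rightarrow>\<^sub>E carrier A" and "f' x = f' y"
    then have "\<Phi> (\<Psi> (f (\<Phi> x))) = \<Phi> (\<Psi> (f (\<Phi> y)))" by (simp add: f'_def)
    then have "f (\<Phi> x) = f (\<Phi> y)" using \<Phi>\<Psi>[OF fcl[OF \<Phi>c]] x y by simp
    then have "\<Phi> x = \<Phi> y" using inj_onD[OF conjunct2[OF f] _ \<Phi>c[OF x] \<Phi>c[OF y]] by blast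
    then have "\<Psi> (\<Phi> x) = \<Psi> (\<Phi> y)" by (rule arg_cong)
    then show "x = y" unfolding \<Psi>\<Phi>[OF x] \<Psi>\<Phi>[OF y] .
  qed
  ultimately have im: "f' ` (carrier G \<rightarrow>\<^sub>E carrier A) = carrier G \<rightarrow>\<^sub>E carrier A"
    by (rule surj[unfolded surjunctive_alphabet_def, rule_format, OF conjI])
  show "f ` (carrier G \<rightarrow>\<^sub>E carrier B) = carrier G \<rightarrow>\<^sub>E carrier B"
  proof
    show "carrier G \<rightarrow>\<^sub>E carrier B \<subseteq> f ` (carrier G \<rightarrow>\<^sub>E carrier B)"
    proof
      fix y assume y: "y \<in> carrier G \<rightarrow>\<^sub>E carrier B"
      have "\<Psi> y \<in> f' ` (carrier G \<rightarrow>\<^sub>E carrier A)" by (simp only: im \<Psi>c[OF y])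
      then obtain x where x: "x \<in> carrier G \<rightarrow>\<^sub>E carrier A" "\<Psi> y = f' x"
        by (rule imageE) (rule that)
      then have "\<Phi> (\<Psi> y) = \<Phi> (\<Psi> (f (\<Phi> x)))" by (simp add: f'_def)
      then have "y = f (\<Phi> x)" using \<Phi>\<Psi>[OF fcl[OF \<Phi>c[OF x(1)]]] \<Phi>\<Psi>[OF y] by simp
      then show "y \<in> f ` (carrier G \<rightarrow>\<^sub>E carrier B)" using \<Phi>c x by blast
    qed
  qed (use fcl in auto)
qed

text \<open>Transports alphabets such as \<open>R\<^sup>d\<close>, whose elements are functions, into the type over which
  \<open>A_surjunctive\<close> quantifies.\<close>

lemma finite_comm_group_copy:
  assumes A: "comm_group (A :: ('a, 'n) monoid_scheme)" and fin: "finite (carrier A)"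
    and inf: "infinite (UNIV :: 'b set)"
  obtains B :: "'b monoid" where "comm_group B" "finite (carrier B)" "A \<cong> B"
proof -
  interpret A: comm_group A by (rule A)
  obtain \<phi> :: "'a \<Rightarrow> 'b" where \<phi>: "inj_on \<phi> (carrier A)"
    using fin inf by (meson finite_imp_inj_to_nat_seg infinite_countable_subset comp_inj_on inj_on_subset subset_UNIV)
  define B where "B = image_group \<phi> A"
  have "\<phi> \<in> iso A B"
    using inj_imp_image_group_iso[OF \<phi>] unfolding B_def by simp
  moreover have "group B"
    using A.inj_imp_image_group_is_group[OF \<phi>] unfolding B_def by simp
  ultimately have "comm_group B" "A \<cong> B" 
    using A.iso_imp_comm_group[of B] group.is_monoid by (auto simp: is_iso_def)
  moreover have "finite (carrier B)" using fin by (simp add: B_def image_group_carrier)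
  ultimately show ?thesis using that by blast
qed

lemma (in group) A_surjunctive_imp_surjunctive_alphabet:
  assumes inf: "infinite (UNIV :: 'c set)" and S: "A_surjunctive TYPE('c) G"
    and A: "comm_group A" "finite (carrier A)"
  shows "surjunctive_alphabet G A"
proof -
  obtain B :: "'c monoid" where B: "comm_group B" "finite (carrier B)" "A \<cong> B"
    using finite_comm_group_copy[OF A inf] by blast
  interpret A: comm_group A by (rule A(1))
  have "surjunctive_alphabet G B"
    using S B by (auto simp: A_surjunctive_def surjunctive_alphabet_def)
  then show ?thesis
    using surjunctive_alphabet_iso[OF B(1) A(1)] A.iso_sym[OF B(3)] by blast
qed

section \<open>Matrices over a group ring as cellular automata\<close>

context group_ring_data
begin

abbreviation vec :: "nat \<Rightarrow> (nat \<Rightarrow> 'r) monoid" where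
  "vec d \<equiv> product_group {..<d} (\<lambda>_. add_monoid R)"

abbreviation configs :: "nat \<Rightarrow> ('g \<Rightarrow> nat \<Rightarrow> 'r) set" where
  "configs d \<equiv> carrier G \<rightarrow>\<^sub>E ({..<d} \<rightarrow>\<^sub>E carrier R)"

lemma comm_group_vec: "comm_group (vec d)"
proof -
  have "group (vec d)" by (rule product_group) (simp add: R.a_group)
  then show ?thesis
    by (rule group.group_comm_groupI) (auto simp: PiE_iff R.a_comm)
qed

lemma config_coeff_closed [simp, intro]:
  "x \<in> configs d \<Longrightarrow> g \<in> carrier G \<Longrightarrow> k < d \<Longrightarrow> x g k \<in> carrier R"
  by (fastforce simp: PiE_iff)

lemma config_eqI:
  assumes "x \<in> configs d" "y \<in> configs d"
    and eq: "\<And>g k. g \<in> carrier G \<Longrightarrow> k < d \<Longrightarrow> x g k = y g k"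
  shows "x = y"
proof (rule PiE_ext[OF assms(1,2)])
  fix g assume g: "g \<in> carrier G"
  show "x g = y g"
    by (rule PiE_ext[of _ "{..<d}" "\<lambda>_. carrier R"]) (use assms g in \<open>auto simp: PiE_iff\<close>)
qed

text \<open>The matrix acts by multiplying on the right inside the group, \<open>x(g h)\<close>, so that the action commutes
  with the left shift.\<close>

definition matrix_action :: "nat \<Rightarrow> (nat \<times> nat \<Rightarrow> 'g \<Rightarrow> 'r) \<Rightarrow> ('g \<Rightarrow> nat \<Rightarrow> 'r) \<Rightarrow> 'g \<Rightarrow> nat \<Rightarrow> 'r" where
  "matrix_action d M x = (\<lambda>g\<in>carrier G. \<lambda>i\<in>{..<d}.
     \<Oplus>\<^bsub>R\<^esub>p\<in>{..<d} \<times> matrix_support d M. M (i, fst p) (snd p) \<otimes>\<^bsub>R\<^esub> x (g \<otimes>\<^bsub>G\<^esub> snd p) (fst p))"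

lemma matrix_support_subset: "matrix_support d M \<subseteq> carrier G"
  by (auto simp: matrix_support_def)

lemma matrix_action_apply:
  assumes M: "M \<in> carrier (matrix_ring d GR)" and x: "x \<in> configs d"
    and gi: "g \<in> carrier G" "i < d"
    and H: "finite H" "H \<subseteq> carrier G" "matrix_support d M \<subseteq> H"
  shows "matrix_action d M x g i
    = (\<Oplus>\<^bsub>R\<^esub>p\<in>{..<d} \<times> H. M (i, fst p) (snd p) \<otimes>\<^bsub>R\<^esub> x (g \<otimes>\<^bsub>G\<^esub> snd p) (fst p))"
proof -
  have "(\<Oplus>\<^bsub>R\<^esub>p\<in>{..<d} \<times> matrix_support d M. M (i, fst p) (snd p) \<otimes>\<^bsub>R\<^esub> x (g \<otimes>\<^bsub>G\<^esub> snd p) (fst p))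
      = (\<Oplus>\<^bsub>R\<^esub>p\<in>{..<d} \<times> H. M (i, fst p) (snd p) \<otimes>\<^bsub>R\<^esub> x (g \<otimes>\<^bsub>G\<^esub> snd p) (fst p))"
  proof (rule R.finsum_mono_neutral_cong_left)
    fix p assume p: "p \<in> {..<d} \<times> H - {..<d} \<times> matrix_support d M"
    then have "M (i, fst p) (snd p) = \<zero>\<^bsub>R\<^esub>" "fst p < d" "snd p \<in> carrier G"
      using gi H(2) unfolding matrix_support_def by (cases p; auto; blast)+
    then show "M (i, fst p) (snd p) \<otimes>\<^bsub>R\<^esub> x (g \<otimes>\<^bsub>G\<^esub> snd p) (fst p) = \<zero>\<^bsub>R\<^esub>"
      using x gi by (simp add: config_coeff_closed)
  qed (use M x gi H in \<open>auto intro!: R.m_closed\<close>)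
  then show ?thesis using gi by (simp add: matrix_action_def)
qed

lemma matrix_action_closed:
  assumes M: "M \<in> carrier (matrix_ring d GR)" and x: "x \<in> configs d"
  shows "matrix_action d M x \<in> configs d"
  unfolding matrix_action_def
proof (simp only: restrict_PiE_iff, intro ballI R.finsum_closed Pi_I R.m_closed)
  fix g i p assume *: "g \<in> carrier G" "i \<in> {..<d}" "p \<in> {..<d} \<times> matrix_support d M"
  then have p: "fst p < d" "snd p \<in> carrier G" using matrix_support_subset[of d M] by auto
  show "M (i, fst p) (snd p) \<in> carrier R" using M p * by auto
  show "x (g \<otimes>\<^bsub>G\<^esub> snd p) (fst p) \<in> carrier R" using x p * by auto
qed

text \<open>Substituting \<open>v = h u\<close> in
  \<open>\<Sum>\<^sub>h M(h) \<Sum>\<^sub>u N(u) x(g h u)\<close> turns the inner sum into \<open>\<Sum>\<^sub>v N(h\<inverse> v) x(g v)\<close>, and exchanging the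
  sums produces the convolution product. The set \<open>V = H U\<close> of all products, with \<open>U\<close> the support of
  \<open>N\<close>, is a range for \<open>v\<close> that works for every \<open>h\<close>.\<close>

lemma matrix_action_mult:
  assumes M: "M \<in> carrier (matrix_ring d GR)" and N: "N \<in> carrier (matrix_ring d GR)"
    and x: "x \<in> configs d"
  shows "matrix_action d M (matrix_action d N x) = matrix_action d (M \<otimes>\<^bsub>matrix_ring d GR\<^esub> N) x"
proof (rule config_eqI)
  note Nx = matrix_action_closed[OF N x] and MN = matrix_mult_closed[OF M N]
  show "matrix_action d M (matrix_action d N x) \<in> configs d"
    and "matrix_action d (M \<otimes>\<^bsub>matrix_ring d GR\<^esub> N) x \<in> configs d"
    by (rule matrix_action_closed M N x MN)+
  fix g i assume g: "g \<in> carrier G" and i: "i < d"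
  define H where "H = matrix_support d M"
  define V where "V = (\<lambda>(h, u). h \<otimes>\<^bsub>G\<^esub> u) ` (H \<times> matrix_support d N)"
  let ?D = "{..<d}"
  have H: "finite H" "H \<subseteq> carrier G" "matrix_support d M \<subseteq> H"
    using finite_matrix_support[OF M] matrix_support_subset by (auto simp: H_def)
  have V: "finite V" "V \<subseteq> carrier G"
    using H finite_matrix_support[OF N] matrix_support_subset[of d N] by (auto simp: V_def)
  have V_supp: "u \<in> (\<otimes>\<^bsub>G\<^esub>) (inv\<^bsub>G\<^esub> h) ` V" if "h \<in> H" "u \<in> matrix_support d N" for h u
  proof (rule image_eqI)
    show "h \<otimes>\<^bsub>G\<^esub> u \<in> V" using that by (auto simp: V_def)
    show "u = inv\<^bsub>G\<^esub> h \<otimes>\<^bsub>G\<^esub> (h \<otimes>\<^bsub>G\<^esub> u)"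
      using that H(2) matrix_support_subset by (simp add: G.m_assoc[symmetric] subset_iff)
  qed
  have step: "matrix_action d N x (g \<otimes>\<^bsub>G\<^esub> h) k
      = (\<Oplus>\<^bsub>R\<^esub>q\<in>?D \<times> V. N (k, fst q) (inv\<^bsub>G\<^esub> h \<otimes>\<^bsub>G\<^esub> snd q) \<otimes>\<^bsub>R\<^esub> x (g \<otimes>\<^bsub>G\<^esub> snd q) (fst q))"
    if h: "h \<in> H" and k: "k < d" for h k
  proof -
    have hc: "h \<in> carrier G" using h H(2) by auto
    define \<tau> where "\<tau> q = (fst q, inv\<^bsub>G\<^esub> h \<otimes>\<^bsub>G\<^esub> snd q)" for q :: "nat \<times> 'g"
    have im: "?D \<times> (\<otimes>\<^bsub>G\<^esub>) (inv\<^bsub>G\<^esub> h) ` V = \<tau> ` (?D \<times> V)" by (force simp: \<tau>_def)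
    have "matrix_action d N x (g \<otimes>\<^bsub>G\<^esub> h) k = (\<Oplus>\<^bsub>R\<^esub>p\<in>?D \<times> (\<otimes>\<^bsub>G\<^esub>) (inv\<^bsub>G\<^esub> h) ` V.
        N (k, fst p) (snd p) \<otimes>\<^bsub>R\<^esub> x (g \<otimes>\<^bsub>G\<^esub> h \<otimes>\<^bsub>G\<^esub> snd p) (fst p))"
      by (rule matrix_action_apply) (use N x g hc k V V_supp[OF h] in auto)
    also have "\<dots> = (\<Oplus>\<^bsub>R\<^esub>q\<in>?D \<times> V. N (k, fst (\<tau> q)) (snd (\<tau> q)) \<otimes>\<^bsub>R\<^esub> x (g \<otimes>\<^bsub>G\<^esub> h \<otimes>\<^bsub>G\<^esub> snd (\<tau> q)) (fst (\<tau> q)))"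
      unfolding im
    proof (rule R.finsum_reindex)
      show "inj_on \<tau> (?D \<times> V)" using V hc by (auto simp: inj_on_def \<tau>_def subset_iff)
    qed (use N x g hc k V in \<open>auto simp: \<tau>_def subset_iff intro!: R.m_closed\<close>)
    also have "\<dots> = (\<Oplus>\<^bsub>R\<^esub>q\<in>?D \<times> V. N (k, fst q) (inv\<^bsub>G\<^esub> h \<otimes>\<^bsub>G\<^esub> snd q) \<otimes>\<^bsub>R\<^esub> x (g \<otimes>\<^bsub>G\<^esub> snd q) (fst q))"
    proof (rule R.finsum_cong')
      fix q assume q: "q \<in> ?D \<times> V"
      then have "snd q \<in> carrier G" using V(2) by auto
      then have "h \<otimes>\<^bsub>G\<^esub> (inv\<^bsub>G\<^esub> h \<otimes>\<^bsub>G\<^esub> snd q) = snd q" "inv\<^bsub>G\<^esub> h \<otimes>\<^bsub>G\<^esub> snd q \<in> carrier G"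
        using hc by (simp_all add: G.m_assoc[symmetric])
      then have "g \<otimes>\<^bsub>G\<^esub> h \<otimes>\<^bsub>G\<^esub> (inv\<^bsub>G\<^esub> h \<otimes>\<^bsub>G\<^esub> snd q) = g \<otimes>\<^bsub>G\<^esub> snd q"
        using g hc by (simp add: G.m_assoc)
      then show "N (k, fst (\<tau> q)) (snd (\<tau> q)) \<otimes>\<^bsub>R\<^esub> x (g \<otimes>\<^bsub>G\<^esub> h \<otimes>\<^bsub>G\<^esub> snd (\<tau> q)) (fst (\<tau> q))
          = N (k, fst q) (inv\<^bsub>G\<^esub> h \<otimes>\<^bsub>G\<^esub> snd q) \<otimes>\<^bsub>R\<^esub> x (g \<otimes>\<^bsub>G\<^esub> snd q) (fst q)"
        by (simp add: \<tau>_def)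
    qed (use N x g hc k V in \<open>auto simp: subset_iff intro!: R.m_closed\<close>)
    finally show ?thesis .
  qed
  have cl: "M (i, fst p) (snd p) \<in> carrier R"
      "N (fst p, fst q) (inv\<^bsub>G\<^esub> snd p \<otimes>\<^bsub>G\<^esub> snd q) \<in> carrier R" "x (g \<otimes>\<^bsub>G\<^esub> snd q) (fst q) \<in> carrier R"
    if "p \<in> ?D \<times> H" "q \<in> ?D \<times> V" for p q
    using that M N x g i H V by (auto simp: subset_iff)
  have clM: "M (i, fst p) (snd p) \<in> carrier R" if "p \<in> ?D \<times> H" for p
    using that M i H by (auto simp: subset_iff)
  have MN_coeff: "(M \<otimes>\<^bsub>matrix_ring d GR\<^esub> N) (j, l) v
      = (\<Oplus>\<^bsub>R\<^esub>p\<in>?D \<times> H. M (j, fst p) (snd p) \<otimes>\<^bsub>R\<^esub> N (fst p, l) (inv\<^bsub>G\<^esub> (snd p) \<otimes>\<^bsub>G\<^esub> v))"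
    if "j < d" "l < d" "v \<in> carrier G" for j l v
    by (rule matrix_mult_apply) (use M N H that in auto)
  have MN_supp: "matrix_support d (M \<otimes>\<^bsub>matrix_ring d GR\<^esub> N) \<subseteq> V"
  proof (rule ccontr)
    assume "\<not> matrix_support d (M \<otimes>\<^bsub>matrix_ring d GR\<^esub> N) \<subseteq> V"
    then obtain v j l where v: "v \<in> carrier G" "v \<notin> V" "j < d" "l < d"
        "(M \<otimes>\<^bsub>matrix_ring d GR\<^esub> N) (j, l) v \<noteq> \<zero>\<^bsub>R\<^esub>"
      unfolding matrix_support_def by blast
    have "(\<Oplus>\<^bsub>R\<^esub>p\<in>?D \<times> H. M (j, fst p) (snd p) \<otimes>\<^bsub>R\<^esub> N (fst p, l) (inv\<^bsub>G\<^esub> (snd p) \<otimes>\<^bsub>G\<^esub> v)) = \<zero>\<^bsub>R\<^esub>"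
    proof (rule R.finsum_zero_eqI)
      fix p assume p: "p \<in> ?D \<times> H"
      then have hc: "snd p \<in> carrier G" "fst p < d" using H(2) by auto
      have "inv\<^bsub>G\<^esub> (snd p) \<otimes>\<^bsub>G\<^esub> v \<notin> matrix_support d N"
      proof
        assume a: "inv\<^bsub>G\<^esub> (snd p) \<otimes>\<^bsub>G\<^esub> v \<in> matrix_support d N"
        have "v = snd p \<otimes>\<^bsub>G\<^esub> (inv\<^bsub>G\<^esub> (snd p) \<otimes>\<^bsub>G\<^esub> v)" using hc v(1) by (simp add: G.m_assoc[symmetric])
        then have "v \<in> V" using a p unfolding V_def by force
        then show False using v(2) by simp
      qed
      then have "N (fst p, l) (inv\<^bsub>G\<^esub> (snd p) \<otimes>\<^bsub>G\<^esub> v) = \<zero>\<^bsub>R\<^esub>"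
        using hc v by (auto simp: matrix_support_def)
      then show "M (j, fst p) (snd p) \<otimes>\<^bsub>R\<^esub> N (fst p, l) (inv\<^bsub>G\<^esub> (snd p) \<otimes>\<^bsub>G\<^esub> v) = \<zero>\<^bsub>R\<^esub>"
        using hc v M by simp
    qed
    then show False using v MN_coeff by simp
  qed
  have "matrix_action d M (matrix_action d N x) g i
      = (\<Oplus>\<^bsub>R\<^esub>p\<in>?D \<times> H. M (i, fst p) (snd p) \<otimes>\<^bsub>R\<^esub> matrix_action d N x (g \<otimes>\<^bsub>G\<^esub> snd p) (fst p))"
    by (rule matrix_action_apply) (use M Nx g i H in auto)
  also have "\<dots> = (\<Oplus>\<^bsub>R\<^esub>p\<in>?D \<times> H. \<Oplus>\<^bsub>R\<^esub>q\<in>?D \<times> V. M (i, fst p) (snd p) \<otimes>\<^bsub>R\<^esub>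
      N (fst p, fst q) (inv\<^bsub>G\<^esub> snd p \<otimes>\<^bsub>G\<^esub> snd q) \<otimes>\<^bsub>R\<^esub> x (g \<otimes>\<^bsub>G\<^esub> snd q) (fst q))"
  proof (rule R.finsum_cong')
    fix p assume p: "p \<in> ?D \<times> H"
    have "M (i, fst p) (snd p) \<otimes>\<^bsub>R\<^esub> matrix_action d N x (g \<otimes>\<^bsub>G\<^esub> snd p) (fst p)
      = M (i, fst p) (snd p) \<otimes>\<^bsub>R\<^esub> (\<Oplus>\<^bsub>R\<^esub>q\<in>?D \<times> V.
          N (fst p, fst q) (inv\<^bsub>G\<^esub> snd p \<otimes>\<^bsub>G\<^esub> snd q) \<otimes>\<^bsub>R\<^esub> x (g \<otimes>\<^bsub>G\<^esub> snd q) (fst q))"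
      using p step[of "snd p" "fst p"] by auto
    also have "\<dots> = (\<Oplus>\<^bsub>R\<^esub>q\<in>?D \<times> V. M (i, fst p) (snd p) \<otimes>\<^bsub>R\<^esub>
          (N (fst p, fst q) (inv\<^bsub>G\<^esub> snd p \<otimes>\<^bsub>G\<^esub> snd q) \<otimes>\<^bsub>R\<^esub> x (g \<otimes>\<^bsub>G\<^esub> snd q) (fst q)))"
      using p V cl[OF p] clM[OF p] by (intro R.finsum_rdistr) (auto intro!: R.m_closed)
    also have "\<dots> = (\<Oplus>\<^bsub>R\<^esub>q\<in>?D \<times> V. M (i, fst p) (snd p) \<otimes>\<^bsub>R\<^esub>
          N (fst p, fst q) (inv\<^bsub>G\<^esub> snd p \<otimes>\<^bsub>G\<^esub> snd q) \<otimes>\<^bsub>R\<^esub> x (g \<otimes>\<^bsub>G\<^esub> snd q) (fst q))"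
      using cl[OF p] by (intro R.finsum_cong') (auto simp: R.m_assoc intro!: R.m_closed)
    finally show "M (i, fst p) (snd p) \<otimes>\<^bsub>R\<^esub> matrix_action d N x (g \<otimes>\<^bsub>G\<^esub> snd p) (fst p) = \<dots>" .
  qed (use cl in \<open>auto intro!: R.finsum_closed R.m_closed\<close>)
  also have "\<dots> = (\<Oplus>\<^bsub>R\<^esub>q\<in>?D \<times> V. \<Oplus>\<^bsub>R\<^esub>p\<in>?D \<times> H. M (i, fst p) (snd p) \<otimes>\<^bsub>R\<^esub>
      N (fst p, fst q) (inv\<^bsub>G\<^esub> snd p \<otimes>\<^bsub>G\<^esub> snd q) \<otimes>\<^bsub>R\<^esub> x (g \<otimes>\<^bsub>G\<^esub> snd q) (fst q))"
    by (rule R.finsum_swap) (use H V cl in \<open>auto intro!: R.m_closed\<close>)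
  also have "\<dots> = (\<Oplus>\<^bsub>R\<^esub>q\<in>?D \<times> V. (M \<otimes>\<^bsub>matrix_ring d GR\<^esub> N) (i, fst q) (snd q) \<otimes>\<^bsub>R\<^esub> x (g \<otimes>\<^bsub>G\<^esub> snd q) (fst q))"
  proof (rule R.finsum_cong')
    fix q assume q: "q \<in> ?D \<times> V"
    have "x (g \<otimes>\<^bsub>G\<^esub> snd q) (fst q) \<in> carrier R" using q x g V by (auto simp: subset_iff)
    then show "(\<Oplus>\<^bsub>R\<^esub>p\<in>?D \<times> H. M (i, fst p) (snd p) \<otimes>\<^bsub>R\<^esub>
      N (fst p, fst q) (inv\<^bsub>G\<^esub> snd p \<otimes>\<^bsub>G\<^esub> snd q) \<otimes>\<^bsub>R\<^esub> x (g \<otimes>\<^bsub>G\<^esub> snd q) (fst q))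
      = (M \<otimes>\<^bsub>matrix_ring d GR\<^esub> N) (i, fst q) (snd q) \<otimes>\<^bsub>R\<^esub> x (g \<otimes>\<^bsub>G\<^esub> snd q) (fst q)"
      using q H V i cl[OF _ q] MN_coeff[of i "fst q" "snd q"]
      by (subst R.finsum_ldistr[symmetric]) (auto intro!: R.m_closed)
  qed (use MN V x g i in \<open>auto simp: subset_iff intro!: R.m_closed\<close>)
  also have "\<dots> = matrix_action d (M \<otimes>\<^bsub>matrix_ring d GR\<^esub> N) x g i"
    by (rule matrix_action_apply[symmetric]) (use MN x g i V MN_supp in auto)
  finally show "matrix_action d M (matrix_action d N x) g i
    = matrix_action d (M \<otimes>\<^bsub>matrix_ring d GR\<^esub> N) x g i" .
qed

definition delta_config :: "nat \<Rightarrow> 'g \<Rightarrow> nat \<Rightarrow> 'g \<Rightarrow> nat \<Rightarrow> 'r" where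
  "delta_config d h k = (\<lambda>g\<in>carrier G. \<lambda>j\<in>{..<d}. if g = h \<and> j = k then \<one>\<^bsub>R\<^esub> else \<zero>\<^bsub>R\<^esub>)"

lemma delta_config_closed: "delta_config d h k \<in> configs d"
  by (auto simp: delta_config_def)

text \<open>The source of the faithfulness of the action.\<close>

lemma matrix_action_delta:
  assumes M: "M \<in> carrier (matrix_ring d GR)" and h: "h \<in> carrier G" and ik: "i < d" "k < d"
  shows "matrix_action d M (delta_config d h k) \<one>\<^bsub>G\<^esub> i = M (i, k) h"
proof -
  let ?H = "insert h (matrix_support d M)"
  have H: "finite ?H" "?H \<subseteq> carrier G" using finite_matrix_support[OF M] matrix_support_subset h by auto
  have "matrix_action d M (delta_config d h k) \<one>\<^bsub>G\<^esub> i
      = (\<Oplus>\<^bsub>R\<^esub>p\<in>{..<d} \<times> ?H. M (i, fst p) (snd p) \<otimes>\<^bsub>R\<^esub> delta_config d h k (\<one>\<^bsub>G\<^esub> \<otimes>\<^bsub>G\<^esub> snd p) (fst p))"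
    by (rule matrix_action_apply) (use M delta_config_closed ik H in auto)
  also have "\<dots> = (\<Oplus>\<^bsub>R\<^esub>p\<in>{..<d} \<times> ?H. if (k, h) = p then M (i, fst p) (snd p) else \<zero>\<^bsub>R\<^esub>)"
  proof (rule R.finsum_cong')
    fix p assume p: "p \<in> {..<d} \<times> ?H"
    then have "snd p \<in> carrier G" "fst p < d" using H by auto
    then show "M (i, fst p) (snd p) \<otimes>\<^bsub>R\<^esub> delta_config d h k (\<one>\<^bsub>G\<^esub> \<otimes>\<^bsub>G\<^esub> snd p) (fst p)
        = (if (k, h) = p then M (i, fst p) (snd p) else \<zero>\<^bsub>R\<^esub>)"
      using M ik by (cases p) (auto simp: delta_config_def)
  qed (use M ik H in auto)
  also have "\<dots> = M (i, k) h"
  proof -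
    have "(\<lambda>p. M (i, fst p) (snd p)) \<in> {..<d} \<times> ?H \<rightarrow> carrier R" using M ik H by auto
    then show ?thesis
      using R.finsum_singleton[of "(k, h)" "{..<d} \<times> ?H" "\<lambda>p. M (i, fst p) (snd p)"] ik H by simp
  qed
  finally show ?thesis .
qed

lemma matrix_action_faithful:
  assumes M: "M \<in> carrier (matrix_ring d GR)" and N: "N \<in> carrier (matrix_ring d GR)"
    and eq: "\<And>x. x \<in> configs d \<Longrightarrow> matrix_action d M x = matrix_action d N x"
  shows "M = N"
proof (rule matrix_eqI[OF M N])
  fix i j g assume *: "i < d" "j < d" "g \<in> carrier G"
  show "M (i, j) g = N (i, j) g"
    using matrix_action_delta[OF M] matrix_action_delta[OF N] eq[OF delta_config_closed] * by metis
qed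

lemma matrix_action_one:
  assumes x: "x \<in> configs d"
  shows "matrix_action d \<one>\<^bsub>matrix_ring d GR\<^esub> x = x"
proof (rule config_eqI[OF matrix_action_closed[OF matrix_one_closed x] x])
  fix g i assume g: "g \<in> carrier G" and i: "i < d"
  let ?I = "\<one>\<^bsub>matrix_ring d GR\<^esub>"
  have xg: "x g k \<in> carrier R" if "k < d" for k using x g that by (rule config_coeff_closed)
  have "matrix_action d ?I x g i
      = (\<Oplus>\<^bsub>R\<^esub>p\<in>{..<d} \<times> {\<one>\<^bsub>G\<^esub>}. ?I (i, fst p) (snd p) \<otimes>\<^bsub>R\<^esub> x (g \<otimes>\<^bsub>G\<^esub> snd p) (fst p))"
    by (rule matrix_action_apply)
      (use matrix_one_closed x g i in \<open>auto simp: matrix_support_def matrix_one_apply split: if_splits\<close>)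
  also have "\<dots> = (\<Oplus>\<^bsub>R\<^esub>p\<in>{..<d} \<times> {\<one>\<^bsub>G\<^esub>}. if (i, \<one>\<^bsub>G\<^esub>) = p then x g (fst p) else \<zero>\<^bsub>R\<^esub>)"
    using xg g i by (intro R.finsum_cong') (auto simp: matrix_one_apply split: if_splits)
  also have "\<dots> = x g i"
  proof -
    have "(\<lambda>p. x g (fst p)) \<in> {..<d} \<times> {\<one>\<^bsub>G\<^esub>} \<rightarrow> carrier R" using x g by auto
    then show ?thesis
      using R.finsum_singleton[of "(i, \<one>\<^bsub>G\<^esub>)" "{..<d} \<times> {\<one>\<^bsub>G\<^esub>}" "\<lambda>p. x g (fst p)"] i by simp
  qed
  finally show "matrix_action d ?I x g i = x g i" .
qed

lemma additive_cellular_automaton_matrix_action: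
  assumes M: "M \<in> carrier (matrix_ring d GR)"
  shows "additive_cellular_automaton G (vec d) (matrix_action d M)"
  unfolding G.additive_cellular_automaton_iff[OF comm_group_vec]
proof (intro conjI ballI)
  let ?H = "matrix_support d M" and ?P = "product_group (carrier G) (\<lambda>_. vec d)"
  have H: "finite ?H" "?H \<subseteq> carrier G" using finite_matrix_support[OF M] matrix_support_subset by auto
  have P: "carrier ?P = configs d" by simp
  note cl = matrix_action_closed[OF M]
  show "matrix_action d M \<in> hom ?P ?P"
  proof (rule homI)
    show "matrix_action d M x \<in> carrier ?P" if "x \<in> carrier ?P" for x
      using that unfolding P by (rule cl)
    fix x y assume "x \<in> carrier ?P" "y \<in> carrier ?P"
    then have x: "x \<in> configs d" and y: "y \<in> configs d" unfolding P .
    have sum: "(a \<otimes>\<^bsub>?P\<^esub> b) g i = a g i \<oplus>\<^bsub>R\<^esub> b g i" if "g \<in> carrier G" "i < d" for a b g i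
      using that by simp
    have closed: "a \<otimes>\<^bsub>?P\<^esub> b \<in> configs d" if "a \<in> configs d" "b \<in> configs d" for a b
      using that by (auto simp: PiE_iff)
    show "matrix_action d M (x \<otimes>\<^bsub>?P\<^esub> y) = matrix_action d M x \<otimes>\<^bsub>?P\<^esub> matrix_action d M y"
    proof (rule config_eqI)
      fix g i assume g: "g \<in> carrier G" and i: "i < d"
      have "matrix_action d M (x \<otimes>\<^bsub>?P\<^esub> y) g i = (\<Oplus>\<^bsub>R\<^esub>p\<in>{..<d} \<times> ?H.
          M (i, fst p) (snd p) \<otimes>\<^bsub>R\<^esub> x (g \<otimes>\<^bsub>G\<^esub> snd p) (fst p) \<oplus>\<^bsub>R\<^esub>
          M (i, fst p) (snd p) \<otimes>\<^bsub>R\<^esub> y (g \<otimes>\<^bsub>G\<^esub> snd p) (fst p))"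
        unfolding matrix_action_apply[OF M closed[OF x y] g i H subset_refl]
      proof (rule R.finsum_cong')
        fix p assume "p \<in> {..<d} \<times> ?H"
        then have "snd p \<in> carrier G" "fst p < d" using H by auto
        then show "M (i, fst p) (snd p) \<otimes>\<^bsub>R\<^esub> (x \<otimes>\<^bsub>?P\<^esub> y) (g \<otimes>\<^bsub>G\<^esub> snd p) (fst p)
            = M (i, fst p) (snd p) \<otimes>\<^bsub>R\<^esub> x (g \<otimes>\<^bsub>G\<^esub> snd p) (fst p) \<oplus>\<^bsub>R\<^esub>
              M (i, fst p) (snd p) \<otimes>\<^bsub>R\<^esub> y (g \<otimes>\<^bsub>G\<^esub> snd p) (fst p)"
          using sum[of "g \<otimes>\<^bsub>G\<^esub> snd p" "fst p" x y] M x y g i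
          by (simp add: R.r_distr matrix_coeff_closed config_coeff_closed del: mult_product_group)
      qed (use M x y g i H in \<open>auto simp: subset_iff intro!: R.m_closed R.a_closed\<close>)
      also have "\<dots> = matrix_action d M x g i \<oplus>\<^bsub>R\<^esub> matrix_action d M y g i"
        unfolding matrix_action_apply[OF M x g i H subset_refl] matrix_action_apply[OF M y g i H subset_refl]
        by (rule R.finsum_addf) (use M x y g i H in \<open>auto simp: subset_iff intro!: R.m_closed\<close>)
      finally show "matrix_action d M (x \<otimes>\<^bsub>?P\<^esub> y) g i
          = (matrix_action d M x \<otimes>\<^bsub>?P\<^esub> matrix_action d M y) g i"
        unfolding sum[OF g i] .
    qed (intro closed cl x y)+
  qed
  show "matrix_action d M (shift G \<gamma> x) = shift G \<gamma> (matrix_action d M x)"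
    if \<gamma>: "\<gamma> \<in> carrier G" and "x \<in> carrier G \<rightarrow>\<^sub>E carrier (vec d)" for \<gamma> x
  proof -
    have x: "x \<in> configs d" using that(2) by simp
    note sx = G.shift_in_config[OF \<gamma> x]
    show ?thesis
    proof (rule config_eqI[OF cl[OF sx] G.shift_in_config[OF \<gamma> cl[OF x]]])
      fix g i assume g: "g \<in> carrier G" and i: "i < d"
      have g': "inv\<^bsub>G\<^esub> \<gamma> \<otimes>\<^bsub>G\<^esub> g \<in> carrier G" using g \<gamma> by simp
      have "matrix_action d M (shift G \<gamma> x) g i = matrix_action d M x (inv\<^bsub>G\<^esub> \<gamma> \<otimes>\<^bsub>G\<^esub> g) i"
        unfolding matrix_action_apply[OF M sx g i H subset_refl] matrix_action_apply[OF M x g' i H subset_refl]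
        using M x g i H \<gamma>
        by (intro R.finsum_cong') (auto simp: shift_def subset_iff G.m_assoc intro!: R.m_closed)
      then show "matrix_action d M (shift G \<gamma> x) g i = shift G \<gamma> (matrix_action d M x) g i"
        using g by (simp add: shift_def)
    qed
  qed
  show "\<exists>W. finite W \<and> W \<subseteq> carrier G \<and> (\<forall>x\<in>carrier G \<rightarrow>\<^sub>E carrier (vec d).
      (\<forall>w\<in>W. x w = \<one>\<^bsub>vec d\<^esub>) \<longrightarrow> matrix_action d M x \<one>\<^bsub>G\<^esub> = \<one>\<^bsub>vec d\<^esub>)"
  proof (intro exI conjI ballI impI)
    fix x assume "x \<in> carrier G \<rightarrow>\<^sub>E carrier (vec d)" and x0: "\<forall>w\<in>?H. x w = \<one>\<^bsub>vec d\<^esub>"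
    then have x: "x \<in> configs d" by simp
    have "matrix_action d M x \<one>\<^bsub>G\<^esub> i = \<zero>\<^bsub>R\<^esub>" if i: "i < d" for i
      unfolding matrix_action_apply[OF M x G.one_closed i H subset_refl]
    proof (rule R.finsum_zero_eqI)
      fix p assume p: "p \<in> {..<d} \<times> ?H"
      then have "snd p \<in> carrier G" "fst p < d" using H by auto
      then show "M (i, fst p) (snd p) \<otimes>\<^bsub>R\<^esub> x (\<one>\<^bsub>G\<^esub> \<otimes>\<^bsub>G\<^esub> snd p) (fst p) = \<zero>\<^bsub>R\<^esub>"
        using x0 p M i by auto
    qed
    then show "matrix_action d M x \<one>\<^bsub>G\<^esub> = \<one>\<^bsub>vec d\<^esub>"
      by (auto simp: matrix_action_def)
  qed (use H in auto)
qed

text \<open>A one-sided inverse of a matrix makes its automaton injective; surjunctivity turns the one-sided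
  inverse map into a two-sided one, and the action is faithful.\<close>

proposition directly_finite_if_surjunctive_alphabet:
  assumes "surjunctive_alphabet G (vec d)"
  shows "directly_finite (matrix_ring d GR)"
  unfolding directly_finite_def
proof (intro ballI impI)
  fix M N assume M: "M \<in> carrier (matrix_ring d GR)" and N: "N \<in> carrier (matrix_ring d GR)"
    and MN: "M \<otimes>\<^bsub>matrix_ring d GR\<^esub> N = \<one>\<^bsub>matrix_ring d GR\<^esub>"
  have left_inv: "matrix_action d M (matrix_action d N x) = x" if "x \<in> configs d" for x
    using matrix_action_mult[OF M N that] matrix_action_one[OF that] MN by simp
  have "inj_on (matrix_action d N) (configs d)"
    by (rule inj_on_inverseI[of _ "matrix_action d M"]) (rule left_inv)
  then have surj: "matrix_action d N ` configs d = configs d"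
    using assms additive_cellular_automaton_matrix_action[OF N]
    unfolding surjunctive_alphabet_def by simp
  show "N \<otimes>\<^bsub>matrix_ring d GR\<^esub> M = \<one>\<^bsub>matrix_ring d GR\<^esub>"
  proof (rule matrix_action_faithful[OF matrix_mult_closed[OF N M] matrix_one_closed])
    fix x assume x: "x \<in> configs d"
    then have "x \<in> matrix_action d N ` configs d" by (simp only: surj)
    then obtain y where y: "y \<in> configs d" "x = matrix_action d N y" by blast
    have "matrix_action d N (matrix_action d M x) = x"
      unfolding y(2) left_inv[OF y(1)] ..
    then show "matrix_action d (N \<otimes>\<^bsub>matrix_ring d GR\<^esub> M) x = matrix_action d \<one>\<^bsub>matrix_ring d GR\<^esub> x"
      using matrix_action_mult[OF N M x] matrix_action_one[OF x] by simp
  qed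
qed

end

section \<open>Change of the coefficient ring\<close>

definition matrix_map ::
    "('g, 'm) monoid_scheme \<Rightarrow> nat \<Rightarrow> ('r \<Rightarrow> 's) \<Rightarrow> (nat \<times> nat \<Rightarrow> 'g \<Rightarrow> 'r) \<Rightarrow> nat \<times> nat \<Rightarrow> 'g \<Rightarrow> 's" where
  "matrix_map G d \<phi> M = (\<lambda>(i, k)\<in>{..<d} \<times> {..<d}. \<lambda>g\<in>carrier G. \<phi> (M (i, k) g))"

locale group_ring_hom = S: group_ring_data G S + R: group_ring_data G R + \<phi>: ring_hom_ring S R \<phi>
  for G :: "('g, 'm) monoid_scheme" and S :: "('s, 'k) ring_scheme" and R :: "('r, 'l) ring_scheme"
    and \<phi>
begin

lemma matrix_map_closed:
  assumes M: "M \<in> carrier (matrix_ring d (group_ring S G))"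
  shows "matrix_map G d \<phi> M \<in> carrier (matrix_ring d (group_ring R G))"
  unfolding matrix_map_def
proof (rule R.matrix_carrierI)
  show "finite (S.matrix_support d M)" by (rule S.finite_matrix_support[OF M])
qed (use M in \<open>auto simp: S.matrix_support_def\<close>)

lemma matrix_map_apply:
  "i < d \<Longrightarrow> k < d \<Longrightarrow> g \<in> carrier G \<Longrightarrow> matrix_map G d \<phi> M (i, k) g = \<phi> (M (i, k) g)"
  by (simp add: matrix_map_def)

lemma matrix_map_one:
  "matrix_map G d \<phi> \<one>\<^bsub>matrix_ring d (group_ring S G)\<^esub> = \<one>\<^bsub>matrix_ring d (group_ring R G)\<^esub>"
  by (rule R.matrix_eqI[OF matrix_map_closed[OF S.matrix_one_closed] R.matrix_one_closed])
    (simp add: matrix_map_apply S.matrix_one_apply R.matrix_one_apply)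

lemma matrix_map_mult:
  assumes M: "M \<in> carrier (matrix_ring d (group_ring S G))"
    and N: "N \<in> carrier (matrix_ring d (group_ring S G))"
  shows "matrix_map G d \<phi> (M \<otimes>\<^bsub>matrix_ring d (group_ring S G)\<^esub> N)
    = matrix_map G d \<phi> M \<otimes>\<^bsub>matrix_ring d (group_ring R G)\<^esub> matrix_map G d \<phi> N"
proof (rule R.matrix_eqI)
  show "matrix_map G d \<phi> (M \<otimes>\<^bsub>matrix_ring d (group_ring S G)\<^esub> N) \<in> carrier (matrix_ring d (group_ring R G))"
    by (intro matrix_map_closed S.matrix_mult_closed M N)
  show "matrix_map G d \<phi> M \<otimes>\<^bsub>matrix_ring d (group_ring R G)\<^esub> matrix_map G d \<phi> N
      \<in> carrier (matrix_ring d (group_ring R G))"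
    by (intro matrix_map_closed R.matrix_mult_closed M N)
  fix i j g assume ij: "i < d" "j < d" and g: "g \<in> carrier G"
  let ?H = "S.matrix_support d M"
  have H: "finite ?H" "?H \<subseteq> carrier G" using S.finite_matrix_support[OF M] S.matrix_support_subset by auto
  have "R.matrix_support d (matrix_map G d \<phi> M) \<subseteq> ?H"
    by (auto simp: S.matrix_support_def R.matrix_support_def matrix_map_apply) (metis \<phi>.hom_zero)
  then have "(matrix_map G d \<phi> M \<otimes>\<^bsub>matrix_ring d (group_ring R G)\<^esub> matrix_map G d \<phi> N) (i, j) g
     = (\<Oplus>\<^bsub>R\<^esub>p\<in>{..<d} \<times> ?H. matrix_map G d \<phi> M (i, fst p) (snd p) \<otimes>\<^bsub>R\<^esub>
          matrix_map G d \<phi> N (fst p, j) (inv\<^bsub>G\<^esub> (snd p) \<otimes>\<^bsub>G\<^esub> g))"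
    using matrix_map_closed[OF M] matrix_map_closed[OF N] ij g H by (intro R.matrix_mult_apply)
  also have "\<dots> = (\<Oplus>\<^bsub>R\<^esub>p\<in>{..<d} \<times> ?H. \<phi> (M (i, fst p) (snd p) \<otimes>\<^bsub>S\<^esub> N (fst p, j) (inv\<^bsub>G\<^esub> (snd p) \<otimes>\<^bsub>G\<^esub> g)))"
    using M N ij g H by (intro R.R.finsum_cong') (auto simp: matrix_map_apply subset_iff)
  also have "\<dots> = \<phi> (\<Oplus>\<^bsub>S\<^esub>p\<in>{..<d} \<times> ?H. M (i, fst p) (snd p) \<otimes>\<^bsub>S\<^esub> N (fst p, j) (inv\<^bsub>G\<^esub> (snd p) \<otimes>\<^bsub>G\<^esub> g))"
  proof -
    have "(\<lambda>p. M (i, fst p) (snd p) \<otimes>\<^bsub>S\<^esub> N (fst p, j) (inv\<^bsub>G\<^esub> (snd p) \<otimes>\<^bsub>G\<^esub> g)) \<in> {..<d} \<times> ?H \<rightarrow> carrier S"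
      using M N ij g H by (auto simp: subset_iff)
    from \<phi>.hom_finsum[OF this] show ?thesis by (simp add: comp_def)
  qed
  also have "\<dots> = \<phi> ((M \<otimes>\<^bsub>matrix_ring d (group_ring S G)\<^esub> N) (i, j) g)"
    using S.matrix_mult_apply[OF M N ij g H subset_refl] by simp
  finally show "matrix_map G d \<phi> (M \<otimes>\<^bsub>matrix_ring d (group_ring S G)\<^esub> N) (i, j) g
    = (matrix_map G d \<phi> M \<otimes>\<^bsub>matrix_ring d (group_ring R G)\<^esub> matrix_map G d \<phi> N) (i, j) g"
    using ij g by (simp add: matrix_map_apply)
qed

lemma matrix_map_eqD:
  assumes "matrix_map G d \<phi> M = matrix_map G d \<phi> N" "i < d" "j < d" "g \<in> carrier G"
  shows "\<phi> (M (i, j) g) = \<phi> (N (i, j) g)"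
  using assms matrix_map_apply by metis

text \<open>Applied to an embedding of the prime field into the type over which
  \<open>Kaplansky_stable_finiteness\<close> quantifies.\<close>

lemma directly_finite_pullback:
  assumes inj: "inj_on \<phi> (carrier S)" and fin: "directly_finite (matrix_ring d (group_ring R G))"
  shows "directly_finite (matrix_ring d (group_ring S G))"
  unfolding directly_finite_def
proof (intro ballI impI)
  let ?M = "matrix_ring d (group_ring S G)" and ?N = "matrix_ring d (group_ring R G)"
  fix M N assume M: "M \<in> carrier ?M" and N: "N \<in> carrier ?M" and MN: "M \<otimes>\<^bsub>?M\<^esub> N = \<one>\<^bsub>?M\<^esub>"
  have "matrix_map G d \<phi> M \<otimes>\<^bsub>?N\<^esub> matrix_map G d \<phi> N = \<one>\<^bsub>?N\<^esub>"
    using matrix_map_mult[OF M N] matrix_map_one MN by simp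
  then have "matrix_map G d \<phi> N \<otimes>\<^bsub>?N\<^esub> matrix_map G d \<phi> M = \<one>\<^bsub>?N\<^esub>"
    using fin matrix_map_closed[OF M] matrix_map_closed[OF N] unfolding directly_finite_def by blast
  then have eq: "matrix_map G d \<phi> (N \<otimes>\<^bsub>?M\<^esub> M) = matrix_map G d \<phi> \<one>\<^bsub>?M\<^esub>"
    using matrix_map_mult[OF N M] matrix_map_one by simp
  note NM = S.matrix_mult_closed[OF N M]
  show "N \<otimes>\<^bsub>?M\<^esub> M = \<one>\<^bsub>?M\<^esub>"
  proof (rule S.matrix_eqI[OF NM S.matrix_one_closed])
    fix i j g assume *: "i < d" "j < d" "g \<in> carrier G"
    show "(N \<otimes>\<^bsub>?M\<^esub> M) (i, j) g = \<one>\<^bsub>?M\<^esub> (i, j) g"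
      using inj_onD[OF inj matrix_map_eqD[OF eq *]] * NM S.matrix_one_closed
        S.matrix_coeff_closed by blast
  qed
qed

end

section \<open>Subrings of a field with a finite quotient\<close>

text \<open>The value at \<open>t\<close> of the polynomial with coefficients \<open>c 0, \<dots>, c (N - 1)\<close>. Coefficient functions
  without normalisation of the leading coefficient keep statements about remainders and about linear
  independence of powers of \<open>t\<close> simple.\<close>

primrec (in ring) poly_val :: "(nat \<Rightarrow> 'a) \<Rightarrow> nat \<Rightarrow> 'a \<Rightarrow> 'a" where
  "poly_val c 0 t = \<zero>"
| "poly_val c (Suc N) t = poly_val c N t \<oplus> c N \<otimes> t [^] N"

context cring
begin

lemma poly_val_closed [simp, intro]:
  assumes "\<And>i. i < N \<Longrightarrow> c i \<in> carrier R" "t \<in> carrier R"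
  shows "poly_val c N t \<in> carrier R"
  using assms by (induction N) auto

lemma poly_val_cong:
  assumes "\<And>i. i < N \<Longrightarrow> c i = d i"
  shows "poly_val c N t = poly_val d N t"
  using assms by (induction N) auto

lemma poly_val_add:
  assumes "\<And>i. i < N \<Longrightarrow> c i \<in> carrier R" "\<And>i. i < N \<Longrightarrow> d i \<in> carrier R" "t \<in> carrier R"
  shows "poly_val (\<lambda>i. c i \<oplus> d i) N t = poly_val c N t \<oplus> poly_val d N t"
  using assms
proof (induction N)
  case (Suc N)
  have cl: "c N \<in> carrier R" "d N \<in> carrier R" "poly_val c N t \<in> carrier R" "poly_val d N t \<in> carrier R"
    "t [^] N \<in> carrier R"
    using Suc.prems by auto
  have IH: "poly_val (\<lambda>i. c i \<oplus> d i) N t = poly_val c N t \<oplus> poly_val d N t"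
    using Suc by auto
  show ?case unfolding poly_val.simps IH using cl by algebra
qed simp

lemma poly_val_smult:
  assumes "\<And>i. i < N \<Longrightarrow> c i \<in> carrier R" "a \<in> carrier R" "t \<in> carrier R"
  shows "poly_val (\<lambda>i. a \<otimes> c i) N t = a \<otimes> poly_val c N t"
  using assms
proof (induction N)
  case (Suc N)
  have cl: "c N \<in> carrier R" "a \<in> carrier R" "poly_val c N t \<in> carrier R" "t [^] N \<in> carrier R"
    using Suc.prems by auto
  have IH: "poly_val (\<lambda>i. a \<otimes> c i) N t = a \<otimes> poly_val c N t"
    using Suc by auto
  show ?case unfolding poly_val.simps IH using cl by algebra
qed simp

lemma poly_val_Horner:
  assumes "\<And>i. i < N \<Longrightarrow> c i \<in> carrier R" "a \<in> carrier R" "t \<in> carrier R"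
  shows "poly_val (case_nat a c) (Suc N) t = poly_val c N t \<otimes> t \<oplus> a"
  using assms
proof (induction N)
  case (Suc N)
  have cl: "c N \<in> carrier R" "a \<in> carrier R" "poly_val c N t \<in> carrier R" "t [^] N \<in> carrier R" "t \<in> carrier R"
    using Suc.prems by auto
  have IH: "poly_val (case_nat a c) (Suc N) t = poly_val c N t \<otimes> t \<oplus> a"
    using Suc by auto
  have "poly_val (case_nat a c) (Suc (Suc N)) t = poly_val c N t \<otimes> t \<oplus> a \<oplus> c N \<otimes> (t [^] N \<otimes> t)"
    unfolding poly_val.simps(2)[of _ "Suc N"] IH by simp
  also have "\<dots> = poly_val c (Suc N) t \<otimes> t \<oplus> a"
    unfolding poly_val.simps using cl by algebra
  finally show ?case .
qed (simp add: l_null)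

lemma poly_val_pad:
  assumes "\<And>i. i < N \<Longrightarrow> c i \<in> carrier R" "t \<in> carrier R" "N \<le> M"
  shows "poly_val (\<lambda>i. if i < N then c i else \<zero>) M t = poly_val c N t"
  using assms(3)
proof (induction M rule: dec_induct)
  case base
  show ?case by (rule poly_val_cong) simp
next
  case (step M)
  then show ?case using assms(1,2) by simp
qed

lemma poly_val_zero: "t \<in> carrier R \<Longrightarrow> (\<And>i. i < N \<Longrightarrow> c i = \<zero>) \<Longrightarrow> poly_val c N t = \<zero>"
  by (induction N) auto

lemma poly_val_top:
  assumes c: "\<And>i. i < N \<Longrightarrow> c i \<in> carrier R" and t: "t \<in> carrier R" and k: "k < N" "c k \<noteq> \<zero>"
  obtains m where "k \<le> m" "m < N" "c m \<noteq> \<zero>" "poly_val c N t = poly_val c (Suc m) t"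
proof -
  define m where "m = Max {i. i < N \<and> c i \<noteq> \<zero>}"
  have fin: "finite {i. i < N \<and> c i \<noteq> \<zero>}" by simp
  have "m \<in> {i. i < N \<and> c i \<noteq> \<zero>}"
    unfolding m_def by (rule Max_in[OF fin]) (use k in auto)
  then have m: "m < N" "c m \<noteq> \<zero>" by auto
  have above: "c i = \<zero>" if "m < i" "i < N" for i
    using Max_ge[OF fin, of i] that unfolding m_def by fastforce
  have "poly_val c N t = poly_val (\<lambda>i. if i < Suc m then c i else \<zero>) N t"
    by (rule poly_val_cong) (use above in \<open>auto simp: less_Suc_eq not_less\<close>)
  also have "\<dots> = poly_val c (Suc m) t"
    by (rule poly_val_pad) (use c t m in auto)
  finally have "poly_val c N t = poly_val c (Suc m) t" .
  moreover have "k \<le> m" unfolding m_def by (rule Max_ge[OF fin]) (use k in auto)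
  ultimately show thesis using m that by blast
qed

text \<open>Links values of polynomials with the Horner-style inductive definition of \<open>A[t]\<close>, which comes with
  the fact that \<open>A[t]\<close> is a subring, and a field if \<open>A\<close> is a field and \<open>t\<close> is algebraic.\<close>

lemma simple_extension_iff_poly_val:
  assumes A: "A \<subseteq> carrier R" and t: "t \<in> carrier R"
  shows "x \<in> simple_extension A t \<longleftrightarrow> (\<exists>N c. (\<forall>i<N. c i \<in> A) \<and> x = poly_val c N t)"
proof
  assume "x \<in> simple_extension A t"
  then show "\<exists>N c. (\<forall>i<N. c i \<in> A) \<and> x = poly_val c N t"
  proof (induction rule: simple_extension.induct)
    case zero
    show ?case by (rule exI[of _ 0]) simp
  next
    case (lin x a)
    then obtain N c where c: "\<forall>i<N. c i \<in> A" "x = poly_val c N t" by blast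
    have "poly_val (case_nat a c) (Suc N) t = x \<otimes> t \<oplus> a"
      unfolding c(2) by (rule poly_val_Horner) (use c lin A t in auto)
    moreover have "\<forall>i<Suc N. case_nat a c i \<in> A" using c lin by (auto split: nat.split)
    ultimately show ?case by metis
  qed
next
  have "poly_val c N t \<in> simple_extension A t" if "\<forall>i<N. c i \<in> A" for N c
    using that
  proof (induction N arbitrary: c)
    case 0
    then show ?case by (simp add: simple_extension.zero)
  next
    case (Suc N)
    have "poly_val c (Suc N) t = poly_val (case_nat (c 0) (c \<circ> Suc)) (Suc N) t"
      by (rule poly_val_cong) (auto split: nat.split)
    also have "\<dots> = poly_val (c \<circ> Suc) N t \<otimes> t \<oplus> c 0"
      by (rule poly_val_Horner) (use Suc.prems A t in auto)
    also have "\<dots> \<in> simple_extension A t"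
      by (rule simple_extension.lin) (use Suc in auto)
    finally show ?case .
  qed
  then show "\<exists>N c. (\<forall>i<N. c i \<in> A) \<and> x = poly_val c N t \<Longrightarrow> x \<in> simple_extension A t" by blast
qed

lemma finitely_many_coefficients:
  assumes A: "A \<subseteq> carrier R" and t: "t \<in> carrier R"
    and T: "finite T" "T \<subseteq> simple_extension A t"
  obtains C where "finite C" "C \<subseteq> A" "\<And>B. C \<subseteq> B \<Longrightarrow> B \<subseteq> carrier R \<Longrightarrow> T \<subseteq> simple_extension B t"
proof -
  have "\<exists>C. finite C \<and> C \<subseteq> A \<and> (\<forall>B. C \<subseteq> B \<longrightarrow> B \<subseteq> carrier R \<longrightarrow> T \<subseteq> simple_extension B t)"
    using T
  proof (induction T)
    case (insert x T)
    obtain C where C: "finite C" "C \<subseteq> A" "\<And>B. C \<subseteq> B \<Longrightarrow> B \<subseteq> carrier R \<Longrightarrow> T \<subseteq> simple_extension B t"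
      using insert by auto
    obtain N c where c: "\<forall>i<N. c i \<in> A" "x = poly_val c N t"
      using insert.prems simple_extension_iff_poly_val[OF A t] by auto
    have "x \<in> simple_extension B t" if "c ` {..<N} \<subseteq> B" "B \<subseteq> carrier R" for B
      using simple_extension_iff_poly_val[OF that(2) t] that(1) c(2) by blast
    then show ?case using C c(1) by (intro exI[of _ "C \<union> c ` {..<N}"]) auto
  qed (auto intro: exI[of _ "{}"])
  then show thesis using that by blast
qed

text \<open>\<open>I\<close> is a proper ideal of finite index in the subring \<open>S\<close>; the set \<open>F\<close> represents all residue
  classes.\<close>

definition finite_residue :: "'a set \<Rightarrow> 'a set \<Rightarrow> bool" where
  "finite_residue S I \<longleftrightarrow> subring S R \<and> I \<subseteq> S \<and> \<zero> \<in> I \<and> (\<forall>x\<in>I. \<forall>y\<in>I. x \<oplus> y \<in> I) \<and>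
     (\<forall>s\<in>S. \<forall>x\<in>I. s \<otimes> x \<in> I) \<and> \<one> \<notin> I \<and>
     (\<exists>F. finite F \<and> F \<subseteq> S \<and> (\<forall>x\<in>S. \<exists>y\<in>F. x \<ominus> y \<in> I))"

lemma finite_residueD:
  assumes "finite_residue S I"
  shows "subring S R" "S \<subseteq> carrier R" "I \<subseteq> S" "I \<subseteq> carrier R" "\<zero> \<in> I" "\<And>x y. x \<in> I \<Longrightarrow> y \<in> I \<Longrightarrow> x \<oplus> y \<in> I"
    "\<And>s x. s \<in> S \<Longrightarrow> x \<in> I \<Longrightarrow> s \<otimes> x \<in> I" "\<And>x. x \<in> I \<Longrightarrow> \<ominus> x \<in> I" "\<one> \<notin> I"
    "\<And>x y. x \<in> I \<Longrightarrow> y \<in> I \<Longrightarrow> x \<ominus> y \<in> I"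
proof -
  show S: "subring S R" and IS: "I \<subseteq> S" and "\<zero> \<in> I" and add: "\<And>x y. x \<in> I \<Longrightarrow> y \<in> I \<Longrightarrow> x \<oplus> y \<in> I"
    and mult: "\<And>s x. s \<in> S \<Longrightarrow> x \<in> I \<Longrightarrow> s \<otimes> x \<in> I" and "\<one> \<notin> I"
    using assms unfolding finite_residue_def by auto
  show Sc: "S \<subseteq> carrier R" and Ic: "I \<subseteq> carrier R" using subringE(1)[OF S] IS by auto
  show neg: "\<ominus> x \<in> I" if "x \<in> I" for x
  proof -
    have "\<ominus> x = (\<ominus> \<one>) \<otimes> x" using that Ic by (auto simp: l_minus)
    then show ?thesis using mult[OF subringE(5)[OF S subringE(3)[OF S]] that] by simp
  qed
  show "x \<ominus> y \<in> I" if "x \<in> I" "y \<in> I" for x y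
    unfolding a_minus_def by (rule add[OF that(1) neg[OF that(2)]])
qed

lemma finite_residue_representatives:
  assumes "finite_residue S I"
  obtains F where "finite F" "F \<subseteq> S" "\<And>x. x \<in> S \<Longrightarrow> \<exists>y\<in>F. x \<ominus> y \<in> I"
proof -
  have "\<exists>F. finite F \<and> F \<subseteq> S \<and> (\<forall>x\<in>S. \<exists>y\<in>F. x \<ominus> y \<in> I)"
    using assms unfolding finite_residue_def by (elim conjE)
  then show thesis by (elim exE conjE) (rule that, auto)
qed

text \<open>Let \<open>h\<^sub>0\<close> be the value at \<open>t\<close> of a monic polynomial of degree \<open>n\<close> over \<open>S\<close>. Division with remainder
  writes each element of \<open>S[t]\<close> as a polynomial value of degree below \<open>n\<close> plus a multiple of
  \<open>h\<^sub>0\<close>, so the elements whose remainder can be chosen with coefficients in \<open>I\<close> form an ideal of finite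
  index. The hypothesis \<open>uniq\<close> says that the constant coefficient of a remainder is determined; hence
  \<open>1\<close> is not in the ideal. It holds both if \<open>h\<^sub>0 = 0\<close> comes from the minimal polynomial of \<open>t\<close>, and
  if \<open>t\<close> is transcendental.\<close>

lemma finite_residue_adjoin:
  assumes SI: "finite_residue S I" and t: "t \<in> carrier R" and n: "n > 0"
    and h: "\<And>i. i < n \<Longrightarrow> h i \<in> S"
    and uniq: "\<And>r q. (\<And>i. i < n \<Longrightarrow> r i \<in> S) \<Longrightarrow> q \<in> simple_extension S t \<Longrightarrow>
       poly_val r n t \<oplus> (t [^] n \<oplus> poly_val h n t) \<otimes> q = \<zero> \<Longrightarrow> r 0 = \<zero>"
    and S't: "subring (simple_extension S t) R"
  shows "finite_residue (simple_extension S t)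
     {poly_val r n t \<oplus> (t [^] n \<oplus> poly_val h n t) \<otimes> q |r q. (\<forall>i<n. r i \<in> I) \<and> q \<in> simple_extension S t}"
proof -
  note S = finite_residueD[OF SI]
  let ?T = "simple_extension S t" and ?h = "t [^] n \<oplus> poly_val h n t"
  define J where "J A = {poly_val r n t \<oplus> ?h \<otimes> q |r q. (\<forall>i<n. r i \<in> A) \<and> q \<in> ?T}" for A
  note Tr = subringE[OF S't]
  have tT: "t \<in> ?T" by (rule simple_extension_mem[OF S(1) t])
  have ST: "S \<subseteq> ?T" by (rule simple_extension_incl[OF S(2) t])
  have pvT: "poly_val r N t \<in> ?T" if "\<And>i. i < N \<Longrightarrow> r i \<in> S" for r N
    using simple_extension_iff_poly_val[OF S(2) t] that by blast
  have tnT: "t [^] k \<in> ?T" for k :: nat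
    by (induction k) (use Tr(3) Tr(6) tT in auto)
  have hT: "?h \<in> ?T" using Tr(7)[OF tnT[of n] pvT[of n h]] h by simp
  have hc: "?h \<in> carrier R" using hT Tr(1) by auto
  have JI: "poly_val r n t \<oplus> ?h \<otimes> q \<in> J A" if "\<And>i. i < n \<Longrightarrow> r i \<in> A" "q \<in> ?T" for r q A
    using that unfolding J_def by blast
  have JE: "\<exists>r q. x = poly_val r n t \<oplus> ?h \<otimes> q \<and> (\<forall>i<n. r i \<in> A) \<and> q \<in> ?T" if "x \<in> J A" for x A
    using that unfolding J_def by blast
  \<comment> \<open>One Horner step: the overflowing top coefficient \<open>b\<close> is removed by subtracting \<open>b\<close> times the monic
     polynomial. For \<open>A = S\<close> this shows that division with remainder is possible, for \<open>A = I\<close> that \<open>J I\<close> is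
     closed under multiplication by \<open>t\<close>.\<close>
  have horner: "x \<otimes> t \<oplus> a \<in> J A"
    if A: "A \<subseteq> S" "\<And>x y. x \<in> A \<Longrightarrow> y \<in> A \<Longrightarrow> x \<ominus> y \<in> A" "\<And>s x. s \<in> S \<Longrightarrow> x \<in> A \<Longrightarrow> s \<otimes> x \<in> A"
      and x: "x \<in> J A" and a: "a \<in> A" for A x a
  proof -
    obtain r q where r: "\<And>i. i < n \<Longrightarrow> r i \<in> A" and q: "q \<in> ?T" and xe: "x = poly_val r n t \<oplus> ?h \<otimes> q"
      using JE[OF x] by blast
    have Ac: "A \<subseteq> carrier R" using A(1) S(2) by auto
    obtain m where m: "n = Suc m" using n gr0_conv_Suc by auto
    define b where "b = r m"
    have b: "b \<in> A" using r m by (simp add: b_def)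
    have bc: "b \<in> carrier R" using b Ac by auto
    have hic: "h i \<in> carrier R" if "i < n" for i using h[OF that] S(2) by auto
    have ric: "r i \<in> carrier R" if "i < n" for i using r[OF that] Ac by auto
    define s where "s i = case_nat a r i \<ominus> b \<otimes> h i" for i
    have cn: "case_nat a r i \<in> A" if "i < n" for i using a r that by (auto split: nat.split)
    have cnc: "case_nat a r i \<in> carrier R" if "i < n" for i using cn[OF that] Ac by auto
    have sA: "s i \<in> A" if "i < n" for i
    proof -
      have "b \<otimes> h i = h i \<otimes> b" using bc hic[OF that] by (rule m_comm)
      then show ?thesis unfolding s_def using A(2)[OF cn[OF that] A(3)[OF h[OF that] b]] by simp
    qed
    have sc: "s i \<in> carrier R" if "i < n" for i using sA[OF that] Ac by auto
    have e1: "poly_val r n t \<otimes> t \<oplus> a = poly_val (case_nat a r) n t \<oplus> b \<otimes> t [^] n"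
    proof -
      have "poly_val r n t \<otimes> t \<oplus> a = poly_val (case_nat a r) (Suc n) t"
        by (rule poly_val_Horner[symmetric]) (use ric a Ac t in auto)
      then show ?thesis by (simp add: m b_def)
    qed
    have "poly_val (case_nat a r) n t = poly_val (\<lambda>i. s i \<oplus> b \<otimes> h i) n t"
    proof (rule poly_val_cong)
      fix i assume i: "i < n"
      show "case_nat a r i = s i \<oplus> b \<otimes> h i"
        unfolding s_def using cnc[OF i] bc hic[OF i] by algebra
    qed
    also have "\<dots> = poly_val s n t \<oplus> b \<otimes> poly_val h n t"
      using poly_val_add[of n s "\<lambda>i. b \<otimes> h i" t] poly_val_smult[of n h b t] sA Ac bc hic t
      by (auto simp: subset_iff)
    finally have e2: "poly_val (case_nat a r) n t = poly_val s n t \<oplus> b \<otimes> poly_val h n t" .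
    have cl: "poly_val r n t \<in> carrier R" "poly_val s n t \<in> carrier R" "poly_val h n t \<in> carrier R"
      "q \<in> carrier R" "a \<in> carrier R" "t [^] n \<in> carrier R"
      using ric sc hic t q a Ac Tr(1) by auto
    have "x \<otimes> t \<oplus> a = (poly_val r n t \<otimes> t \<oplus> a) \<oplus> ?h \<otimes> (q \<otimes> t)"
      unfolding xe using cl t by algebra
    also have "\<dots> = poly_val s n t \<oplus> ?h \<otimes> (q \<otimes> t \<oplus> b)"
      unfolding e1 e2 using cl t bc by algebra
    also have "\<dots> \<in> J A"
      by (rule JI) (use sA Tr(6)[OF q tT] Tr(7) b A(1) ST in auto)
    finally show ?thesis .
  qed
  have sub: "J A \<subseteq> ?T" if "A \<subseteq> S" for A
  proof
    fix x assume "x \<in> J A"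
    then obtain r q where r: "\<And>i. i < n \<Longrightarrow> r i \<in> A" and q: "q \<in> ?T" and xe: "x = poly_val r n t \<oplus> ?h \<otimes> q"
      using JE by blast
    show "x \<in> ?T" unfolding xe by (rule Tr(7)[OF pvT Tr(6)[OF hT q]]) (use r that in auto)
  qed
  have J_zero: "\<zero> \<in> J A" if "\<zero> \<in> A" for A
  proof -
    have "poly_val (\<lambda>_. \<zero>) n t \<oplus> ?h \<otimes> \<zero> = \<zero>" using poly_val_zero[OF t, of n "\<lambda>_. \<zero>"] hc by simp
    then show ?thesis using JI[of "\<lambda>_. \<zero>" A \<zero>] that Tr(2) by simp
  qed
  have all: "x \<in> J S" if "x \<in> ?T" for x
    using that
  proof (induction rule: simple_extension.induct)
    case zero
    show ?case by (rule J_zero[OF subringE(2)[OF S(1)]])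
  next
    case (lin x a)
    show ?case
      by (rule horner[OF subset_refl _ _ lin(3,2)])
        (use subringE[OF S(1)] in \<open>auto simp: a_minus_def\<close>)
  qed
  have add: "x \<oplus> y \<in> J I" if x: "x \<in> J I" and y: "y \<in> J I" for x y
  proof -
    obtain r q where r: "\<And>i. i < n \<Longrightarrow> r i \<in> I" and q: "q \<in> ?T" and xe: "x = poly_val r n t \<oplus> ?h \<otimes> q"
      using JE[OF x] by blast
    obtain r' q' where r': "\<And>i. i < n \<Longrightarrow> r' i \<in> I" and q': "q' \<in> ?T" and ye: "y = poly_val r' n t \<oplus> ?h \<otimes> q'"
      using JE[OF y] by blast
    have cl: "poly_val r n t \<in> carrier R" "poly_val r' n t \<in> carrier R" "q \<in> carrier R" "q' \<in> carrier R"
      using r r' S(4) t q q' Tr(1) by auto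
    have "x \<oplus> y = (poly_val r n t \<oplus> poly_val r' n t) \<oplus> ?h \<otimes> (q \<oplus> q')"
      unfolding xe ye using cl hc by algebra
    also have "poly_val r n t \<oplus> poly_val r' n t = poly_val (\<lambda>i. r i \<oplus> r' i) n t"
      by (rule poly_val_add[symmetric]) (use r r' S(4) t in auto)
    finally show ?thesis using JI[of "\<lambda>i. r i \<oplus> r' i" I "q \<oplus> q'"] r r' S(6) Tr(7)[OF q q'] by simp
  qed
  have smult: "s \<otimes> x \<in> J I" if s: "s \<in> S" and x: "x \<in> J I" for s x
  proof -
    obtain r q where r: "\<And>i. i < n \<Longrightarrow> r i \<in> I" and q: "q \<in> ?T" and xe: "x = poly_val r n t \<oplus> ?h \<otimes> q"
      using JE[OF x] by blast
    have cl: "poly_val r n t \<in> carrier R" "q \<in> carrier R" "s \<in> carrier R"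
      using r S(2,4) t q s Tr(1) by auto
    have "s \<otimes> x = s \<otimes> poly_val r n t \<oplus> ?h \<otimes> (s \<otimes> q)"
      unfolding xe using cl hc by algebra
    also have "s \<otimes> poly_val r n t = poly_val (\<lambda>i. s \<otimes> r i) n t"
      by (rule poly_val_smult[symmetric]) (use r S(4) t cl in auto)
    finally show ?thesis using JI[of "\<lambda>i. s \<otimes> r i" I "s \<otimes> q"] r S(7)[OF s] Tr(6)[OF _ q] s ST by auto
  qed
  have JIc: "J I \<subseteq> carrier R" using sub[OF S(3)] Tr(1) by auto
  have mult: "z \<otimes> x \<in> J I" if z: "z \<in> ?T" and x: "x \<in> J I" for z x
    using z
  proof (induction rule: simple_extension.induct)
    case zero
    show ?case using x JIc J_zero[OF S(5)] by auto
  next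
    case (lin k a)
    have cl: "k \<in> carrier R" "a \<in> carrier R" "x \<in> carrier R"
      using lin Tr(1) S(2) x JIc by auto
    have "(k \<otimes> t \<oplus> a) \<otimes> x = ((k \<otimes> x) \<otimes> t \<oplus> \<zero>) \<oplus> a \<otimes> x"
      using cl t by algebra
    also have "\<dots> \<in> J I"
      by (rule add[OF horner[OF S(3) _ _ lin(3) S(5)] smult[OF lin(2) x]]) (use S(10) S(7) in auto)
    finally show ?case .
  qed
  have one: "\<one> \<notin> J I"
  proof
    assume "\<one> \<in> J I"
    then obtain r q where r: "\<And>i. i < n \<Longrightarrow> r i \<in> I" and q: "q \<in> ?T" and xe: "\<one> = poly_val r n t \<oplus> ?h \<otimes> q"
      using JE by blast
    obtain m where m: "n = Suc m" using n gr0_conv_Suc by auto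
    define e where "e i = (if i = 0 then \<ominus> \<one> else \<zero>)" for i :: nat
    have ric: "r i \<in> carrier R" if "i < n" for i using r[OF that] S(4) by auto
    have ec: "e i \<in> carrier R" for i by (simp add: e_def)
    have e1: "poly_val e n t = \<ominus> \<one>"
    proof -
      have "poly_val e n t = poly_val (case_nat (\<ominus> \<one>) (\<lambda>_. \<zero>)) (Suc m) t"
        unfolding m by (rule poly_val_cong) (auto simp: e_def split: nat.split)
      also have "\<dots> = poly_val (\<lambda>_. \<zero>) m t \<otimes> t \<oplus> \<ominus> \<one>" by (rule poly_val_Horner) (use t in auto)
      finally show ?thesis using poly_val_zero[OF t, of m "\<lambda>_. \<zero>"] t by simp
    qed
    have "poly_val (\<lambda>i. r i \<oplus> e i) n t \<oplus> ?h \<otimes> q = poly_val r n t \<oplus> poly_val e n t \<oplus> ?h \<otimes> q"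
      using poly_val_add[of n r e t] ric ec t by simp
    also have "\<dots> = (poly_val r n t \<oplus> ?h \<otimes> q) \<oplus> \<ominus> \<one>"
      unfolding e1 using poly_val_closed[of n r t] ric t hc q Tr(1) by (auto simp: a_ac)
    also have "\<dots> = \<zero>" unfolding xe[symmetric] by (simp add: r_neg)
    finally have "r 0 \<oplus> e 0 = \<zero>"
    proof (rule uniq[rotated 2])
      show "r i \<oplus> e i \<in> S" if "i < n" for i
        using r[OF that] S(3) subringE[OF S(1)] by (auto simp: e_def)
    qed (rule q)
    then have "r 0 = \<one>" using ric[OF n] by (simp add: e_def) (metis add.inv_closed minus_equality minus_minus one_closed a_comm)
    then show False using r[OF n] S(9) by simp
  qed
  have fin: "\<exists>F. finite F \<and> F \<subseteq> ?T \<and> (\<forall>x\<in>?T. \<exists>y\<in>F. x \<ominus> y \<in> J I)"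
  proof -
    obtain F where F: "finite F" "F \<subseteq> S" "\<And>x. x \<in> S \<Longrightarrow> \<exists>y\<in>F. x \<ominus> y \<in> I"
      by (rule finite_residue_representatives[OF SI]) (rule that)
    define F' where "F' = (\<lambda>c. poly_val c n t) ` ({..<n} \<rightarrow>\<^sub>E F)"
    have "finite F'" unfolding F'_def using F(1) by (simp add: finite_PiE)
    moreover have "F' \<subseteq> ?T" unfolding F'_def using F(2) by (auto intro!: pvT)
    moreover have "\<exists>y\<in>F'. x \<ominus> y \<in> J I" if xT: "x \<in> ?T" for x
    proof -
      obtain r q where r: "\<And>i. i < n \<Longrightarrow> r i \<in> S" and q: "q \<in> ?T" and xe: "x = poly_val r n t \<oplus> ?h \<otimes> q"
        using JE[OF all[OF xT]] by blast
      have "\<exists>y. y \<in> F \<and> r i \<ominus> y \<in> I" if "i < n" for i using F(3)[OF r[OF that]] by blast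
      then obtain f where f: "\<And>i. i < n \<Longrightarrow> f i \<in> F \<and> r i \<ominus> f i \<in> I" by metis
      have fin: "f i \<in> F" and rf: "r i \<ominus> f i \<in> I" if "i < n" for i using f[OF that] by auto
      have fc: "f i \<in> carrier R" and ric: "r i \<in> carrier R" and rfc: "r i \<ominus> f i \<in> carrier R" if "i < n" for i
        using fin[OF that] r[OF that] F(2) S(2) by auto
      have yF: "poly_val (restrict f {..<n}) n t \<in> F'" unfolding F'_def using fin by auto
      have y: "poly_val (restrict f {..<n}) n t = poly_val f n t" by (rule poly_val_cong) simp
      have "poly_val r n t = poly_val (\<lambda>i. (r i \<ominus> f i) \<oplus> f i) n t"
        by (rule poly_val_cong) (use ric fc in \<open>auto simp: minus_eq a_assoc l_neg\<close>)
      also have "\<dots> = poly_val (\<lambda>i. r i \<ominus> f i) n t \<oplus> poly_val f n t"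
        by (rule poly_val_add) (use rfc fc t in auto)
      finally have "x = poly_val (\<lambda>i. r i \<ominus> f i) n t \<oplus> poly_val f n t \<oplus> ?h \<otimes> q" using xe by simp
      moreover have "(a \<oplus> b \<oplus> c) \<ominus> b = a \<oplus> c"
        if "a \<in> carrier R" "b \<in> carrier R" "c \<in> carrier R" for a b c
        using that by algebra
      moreover have "poly_val (\<lambda>i. r i \<ominus> f i) n t \<in> carrier R" "poly_val f n t \<in> carrier R" "?h \<otimes> q \<in> carrier R"
        using rfc fc t hc q Tr(1) by auto
      ultimately have "x \<ominus> poly_val f n t = poly_val (\<lambda>i. r i \<ominus> f i) n t \<oplus> ?h \<otimes> q" by simp
      also have "\<dots> \<in> J I" by (rule JI) (use rf q in auto)
      finally show ?thesis using yF unfolding y by blast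
    qed
    ultimately show ?thesis by blast
  qed
  have "finite_residue ?T (J I)"
    unfolding finite_residue_def using S't sub[OF S(3)] J_zero[OF S(5)] add mult one fin by blast
  then show ?thesis unfolding J_def .
qed

end

context field
begin

text \<open>All elements of \<open>S\<close> that are invertible modulo \<open>I\<close> can be made invertible without changing the
  quotient: a fraction \<open>x / y\<close> with \<open>y y' \<equiv> 1\<close> is congruent to \<open>x y'\<close>.\<close>

lemma finite_residue_localize:
  assumes SI: "finite_residue S I"
  defines "S' \<equiv> {z \<in> carrier R. \<exists>x\<in>S. \<exists>y\<in>S. \<exists>y'\<in>S. y \<otimes> y' \<ominus> \<one> \<in> I \<and> z \<otimes> y = x}"
  shows "S \<subseteq> S'" and "\<exists>I'. finite_residue S' I'"
proof -
  note S = finite_residueD[OF SI]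
  note Sr = subringE[OF S(1)]
  define D where "D y \<longleftrightarrow> y \<in> S \<and> (\<exists>y'\<in>S. y \<otimes> y' \<ominus> \<one> \<in> I)" for y
  define L where "L A = {z \<in> carrier R. \<exists>y. D y \<and> z \<otimes> y \<in> A}" for A
  have LI: "z \<in> L A" if "z \<in> carrier R" "D y" "z \<otimes> y \<in> A" for z y A using that unfolding L_def by blast
  have LE: "\<exists>y. z \<in> carrier R \<and> D y \<and> z \<otimes> y \<in> A" if "z \<in> L A" for z A using that unfolding L_def by blast
  have S': "S' = L S" unfolding S'_def L_def D_def by blast
  have DS: "y \<in> S" "y \<in> carrier R" if "D y" for y using that S(2) unfolding D_def by auto
  have D1: "D \<one>" unfolding D_def using Sr(3) S(5) by (intro conjI bexI[of _ \<one>]) (auto simp: minus_eq r_neg)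
  have Dm: "D (y \<otimes> z)" if y: "D y" and z: "D z" for y z
  proof -
    obtain y' where y': "y' \<in> S" "y \<otimes> y' \<ominus> \<one> \<in> I" using y unfolding D_def by blast
    obtain z' where z': "z' \<in> S" "z \<otimes> z' \<ominus> \<one> \<in> I" using z unfolding D_def by blast
    have cl: "y \<in> carrier R" "z \<in> carrier R" "y' \<in> carrier R" "z' \<in> carrier R"
      using DS[OF y] DS[OF z] y' z' S(2) by auto
    have "(y \<otimes> z) \<otimes> (y' \<otimes> z') \<ominus> \<one> = (z \<otimes> z') \<otimes> (y \<otimes> y' \<ominus> \<one>) \<oplus> (z \<otimes> z' \<ominus> \<one>)"
      using cl by algebra
    also have "\<dots> \<in> I" using S(6)[OF S(7)[OF _ y'(2)] z'(2)] Sr(6) DS[OF z] z' by auto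
    finally show ?thesis unfolding D_def using Sr(6) DS(1)[OF y] DS(1)[OF z] y' z' by blast
  qed
  have Ladd: "a \<oplus> b \<in> L A" if a: "a \<in> L A" and b: "b \<in> L A"
    and A: "A \<subseteq> carrier R" "\<And>s x. s \<in> S \<Longrightarrow> x \<in> A \<Longrightarrow> s \<otimes> x \<in> A" "\<And>x y. x \<in> A \<Longrightarrow> y \<in> A \<Longrightarrow> x \<oplus> y \<in> A" for a b A
  proof -
    obtain y where y: "a \<in> carrier R" "D y" "a \<otimes> y \<in> A" using LE[OF a] by blast
    obtain z where z: "b \<in> carrier R" "D z" "b \<otimes> z \<in> A" using LE[OF b] by blast
    have "(a \<oplus> b) \<otimes> (y \<otimes> z) = z \<otimes> (a \<otimes> y) \<oplus> y \<otimes> (b \<otimes> z)"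
      using y z DS by algebra
    also have "\<dots> \<in> A" by (intro A y z DS)
    finally show ?thesis using y z by (intro LI[OF _ Dm[OF y(2) z(2)]]) auto
  qed
  have Lmult: "a \<otimes> b \<in> L A" if a: "a \<in> L S" and b: "b \<in> L A"
    and A: "\<And>s x. s \<in> S \<Longrightarrow> x \<in> A \<Longrightarrow> s \<otimes> x \<in> A" for a b A
  proof -
    obtain y where y: "a \<in> carrier R" "D y" "a \<otimes> y \<in> S" using LE[OF a] by blast
    obtain z where z: "b \<in> carrier R" "D z" "b \<otimes> z \<in> A" using LE[OF b] by blast
    have "(a \<otimes> b) \<otimes> (y \<otimes> z) = (a \<otimes> y) \<otimes> (b \<otimes> z)"
      using y z DS by algebra
    also have "\<dots> \<in> A" by (intro A y z)
    finally show ?thesis using y z by (intro LI[OF _ Dm[OF y(2) z(2)]]) auto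
  qed
  have incl: "A \<subseteq> L A" if "A \<subseteq> carrier R" for A
    using that by (auto intro!: LI[OF _ D1])
  show SS': "S \<subseteq> S'" unfolding S' by (rule incl[OF S(2)])
  have ring: "subring (L S) R"
  proof (rule subringI)
    show "L S \<subseteq> carrier R" unfolding L_def by auto
    show "\<one> \<in> L S" using SS' S' Sr(3) by auto
    show "\<ominus> h \<in> L S" if h: "h \<in> L S" for h
    proof -
      obtain y where y: "h \<in> carrier R" "D y" "h \<otimes> y \<in> S" using LE[OF h] by blast
      then show ?thesis using DS[OF y(2)] Sr(5) by (intro LI[OF _ y(2)]) (auto simp: l_minus)
    qed
    show "h1 \<otimes> h2 \<in> L S" if "h1 \<in> L S" "h2 \<in> L S" for h1 h2 using Lmult[OF that] Sr(6) by blast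
    show "h1 \<oplus> h2 \<in> L S" if "h1 \<in> L S" "h2 \<in> L S" for h1 h2 using Ladd[OF that S(2)] Sr(6,7) by blast
  qed
  have LSI: "L I \<subseteq> L S" unfolding L_def using S(3) by auto
  have one: "\<one> \<notin> L I"
  proof
    assume "\<one> \<in> L I"
    then obtain y where y: "D y" "y \<in> I" using LE[of \<one> I] DS by auto
    then obtain y' where y': "y' \<in> S" "y \<otimes> y' \<ominus> \<one> \<in> I" unfolding D_def by blast
    have cl: "y \<in> carrier R" "y' \<in> carrier R" using DS[OF y(1)] y' S(2) by auto
    have "\<one> = y' \<otimes> y \<ominus> (y \<otimes> y' \<ominus> \<one>)" using cl by algebra
    also have "\<dots> \<in> I" by (rule S(10)[OF S(7)[OF y'(1) y(2)] y'(2)])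
    finally show False using S(9) by simp
  qed
  obtain F where F: "finite F" "F \<subseteq> S" "\<And>x. x \<in> S \<Longrightarrow> \<exists>y\<in>F. x \<ominus> y \<in> I"
    by (rule finite_residue_representatives[OF SI]) (rule that)
  have "\<exists>f\<in>F. z \<ominus> f \<in> L I" if "z \<in> L S" for z
  proof -
    obtain y where y: "z \<in> carrier R" "D y" "z \<otimes> y \<in> S" using LE[OF \<open>z \<in> L S\<close>] by blast
    then obtain y' where y': "y' \<in> S" "y \<otimes> y' \<ominus> \<one> \<in> I" unfolding D_def by blast
    have cl: "z \<in> carrier R" "y \<in> carrier R" "y' \<in> carrier R" using DS[OF y(2)] y y' S(2) by auto
    obtain f where f: "f \<in> F" "z \<otimes> y \<otimes> y' \<ominus> f \<in> I" using F(3)[OF Sr(6)[OF y(3) y'(1)]] by blast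
    have fc: "f \<in> carrier R" using f F(2) S(2) by auto
    have "(z \<otimes> (y \<otimes> y' \<ominus> \<one>)) \<otimes> y = (z \<otimes> y) \<otimes> (y \<otimes> y' \<ominus> \<one>)" using cl by algebra
    also have "\<dots> \<in> I" by (rule S(7)[OF y(3) y'(2)])
    finally have "z \<otimes> (y \<otimes> y' \<ominus> \<one>) \<in> L I" using cl by (intro LI[OF _ y(2)]) auto
    then have "(\<ominus> \<one>) \<otimes> (z \<otimes> (y \<otimes> y' \<ominus> \<one>)) \<in> L I"
      using Lmult[of "\<ominus> \<one>"] subringE(5)[OF ring subringE(3)[OF ring]] S(7) by blast
    then have "(\<ominus> \<one>) \<otimes> (z \<otimes> (y \<otimes> y' \<ominus> \<one>)) \<oplus> (z \<otimes> y \<otimes> y' \<ominus> f) \<in> L I"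
      using Ladd[OF _ _ S(4) S(7) S(6)] incl[OF S(4)] f(2) by blast
    also have "(\<ominus> \<one>) \<otimes> (z \<otimes> (y \<otimes> y' \<ominus> \<one>)) \<oplus> (z \<otimes> y \<otimes> y' \<ominus> f) = z \<ominus> f"
      using cl fc by algebra
    finally show ?thesis using f(1) by blast
  qed
  moreover have "F \<subseteq> L S" using F(2) SS' unfolding S' by auto
  moreover have "\<zero> \<in> L I" using incl[OF S(4)] S(5) by auto
  moreover have "\<And>x y. x \<in> L I \<Longrightarrow> y \<in> L I \<Longrightarrow> x \<oplus> y \<in> L I" using Ladd[OF _ _ S(4) S(7) S(6)] by blast
  moreover have "\<And>s x. s \<in> L S \<Longrightarrow> x \<in> L I \<Longrightarrow> s \<otimes> x \<in> L I" using Lmult[OF _ _ S(7)] by blast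
  ultimately have "finite_residue (L S) (L I)"
    unfolding finite_residue_def using ring LSI one F(1) by blast
  then show "\<exists>I'. finite_residue S' I'" unfolding S' by blast
qed

definition fractions :: "'a set \<Rightarrow> 'a set" where
  "fractions A = {x \<in> carrier R. \<exists>b\<in>A. b \<noteq> \<zero> \<and> x \<otimes> b \<in> A}"

lemma fractions_incl: "subring A R \<Longrightarrow> A \<subseteq> fractions A"
  unfolding fractions_def using subringE[of A R] by force

lemma subfield_fractions:
  assumes A: "subring A R"
  shows "subfield (fractions A) R"
proof (rule subfieldI')
  note Ar = subringE[OF A]
  have E: "\<exists>b. x \<in> carrier R \<and> b \<in> A \<and> b \<in> carrier R \<and> b \<noteq> \<zero> \<and> x \<otimes> b \<in> A" if "x \<in> fractions A" for x
    using that Ar(1) unfolding fractions_def by blast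
  have I: "x \<in> fractions A" if "x \<in> carrier R" "b \<in> A" "b \<noteq> \<zero>" "x \<otimes> b \<in> A" for x b
    using that unfolding fractions_def by blast
  show "subring (fractions A) R"
  proof (rule subringI)
    show "fractions A \<subseteq> carrier R" unfolding fractions_def by auto
    show "\<one> \<in> fractions A" using fractions_incl[OF A] Ar(3) by auto
    show "\<ominus> x \<in> fractions A" if x: "x \<in> fractions A" for x
    proof -
      obtain b where b: "x \<in> carrier R" "b \<in> A" "b \<in> carrier R" "b \<noteq> \<zero>" "x \<otimes> b \<in> A" using E[OF x] by blast
      then show ?thesis using Ar(5) by (intro I[OF _ b(2,4)]) (auto simp: l_minus)
    qed
    fix x y assume x: "x \<in> fractions A" and y: "y \<in> fractions A"
    obtain b where b: "x \<in> carrier R" "b \<in> A" "b \<in> carrier R" "b \<noteq> \<zero>" "x \<otimes> b \<in> A" using E[OF x] by blast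
    obtain c where c: "y \<in> carrier R" "c \<in> A" "c \<in> carrier R" "c \<noteq> \<zero>" "y \<otimes> c \<in> A" using E[OF y] by blast
    have bc: "b \<otimes> c \<noteq> \<zero>" using b c integral by blast
    have "(x \<otimes> y) \<otimes> (b \<otimes> c) = (x \<otimes> b) \<otimes> (y \<otimes> c)" using b c by algebra
    also have "\<dots> \<in> A" by (rule Ar(6)[OF b(5) c(5)])
    finally show "x \<otimes> y \<in> fractions A" using b c bc Ar(6) by (intro I[of _ "b \<otimes> c"]) auto
    have "(x \<oplus> y) \<otimes> (b \<otimes> c) = (x \<otimes> b) \<otimes> c \<oplus> (y \<otimes> c) \<otimes> b" using b c by algebra
    also have "\<dots> \<in> A" by (intro Ar(7) Ar(6) b c)
    finally show "x \<oplus> y \<in> fractions A" using b c bc Ar(6) by (intro I[of _ "b \<otimes> c"]) auto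
  qed
  show "inv x \<in> fractions A" if xF: "x \<in> fractions A - {\<zero>}" for x
  proof -
    obtain b where b: "x \<in> carrier R" "b \<in> A" "b \<in> carrier R" "b \<noteq> \<zero>" "x \<otimes> b \<in> A" using E[of x] xF by blast
    have x: "x \<in> Units R" using xF b(1) by (simp add: field_Units)
    have "inv x \<otimes> (x \<otimes> b) = b" using x b by (simp add: m_assoc[symmetric])
    then show ?thesis using b x xF integral[of x b] by (intro I[of _ "x \<otimes> b"]) auto
  qed
qed

lemma common_denominator:
  assumes A: "subring A R" and T: "finite T" "T \<subseteq> fractions A"
  obtains b where "b \<in> A" "b \<noteq> \<zero>" "\<And>x. x \<in> T \<Longrightarrow> x \<otimes> b \<in> A"
proof -
  note Ar = subringE[OF A]
  have "\<exists>b\<in>A. b \<noteq> \<zero> \<and> (\<forall>x\<in>T. x \<otimes> b \<in> A)"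
    using T
  proof (induction T)
    case empty
    show ?case using Ar(3) by (intro bexI[of _ \<one>]) auto
  next
    case (insert x T)
    obtain b where b: "b \<in> A" "b \<noteq> \<zero>" "\<And>z. z \<in> T \<Longrightarrow> z \<otimes> b \<in> A" using insert by auto
    obtain c where c: "x \<in> carrier R" "c \<in> A" "c \<noteq> \<zero>" "x \<otimes> c \<in> A"
      using insert.prems unfolding fractions_def by auto
    have bc: "b \<in> carrier R" "c \<in> carrier R" using b c Ar(1) by auto
    have "z \<otimes> (b \<otimes> c) \<in> A" if "z \<in> insert x T" for z
    proof (cases "z = x")
      case True
      have "x \<otimes> (b \<otimes> c) = b \<otimes> (x \<otimes> c)" using bc c by algebra
      then show ?thesis using True Ar(6)[OF b(1) c(4)] by simp
    next
      case False
      then have z: "z \<in> T" "z \<in> carrier R" using that insert.prems unfolding fractions_def by auto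
      have "z \<otimes> (b \<otimes> c) = (z \<otimes> b) \<otimes> c" using bc z by algebra
      then show ?thesis using Ar(6)[OF b(3)[OF z(1)] c(2)] by simp
    qed
    moreover have "b \<otimes> c \<noteq> \<zero>" using integral[of b c] bc b c by blast
    ultimately show ?case using Ar(6)[OF b(1) c(2)] by blast
  qed
  then show thesis using that by blast
qed

text \<open>The condition that passes from a field to each extension by one element. Putting the inverses of
  chosen nonzero elements into \<open>T\<close> makes these elements survive in the quotient.\<close>

definition locally_finite_residue :: "'a set \<Rightarrow> bool" where
  "locally_finite_residue L \<longleftrightarrow> subfield L R \<and>
     (\<forall>T. finite T \<and> T \<subseteq> L \<longrightarrow> (\<exists>S I. T \<subseteq> S \<and> S \<subseteq> L \<and> finite_residue S I))"

lemma locally_finite_residueD: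
  assumes "locally_finite_residue L" "finite T" "T \<subseteq> L"
  obtains S I where "T \<subseteq> S" "S \<subseteq> L" "finite_residue S I"
  using assms unfolding locally_finite_residue_def by blast

text \<open>A nontrivial relation of least degree, made monic, is the minimal polynomial. Its coefficients are put into
  \<open>S\<close>, so that division by it is possible in \<open>S[t]\<close>, and minimality makes the
  powers of \<open>t\<close> below its degree linearly independent. Since \<open>L[t]\<close> is a field, every
  element of the extension is a polynomial value at \<open>t\<close>.\<close>

lemma locally_finite_residue_algebraic:
  assumes L: "locally_finite_residue L" and t: "t \<in> carrier R"
    and alg: "\<forall>i<N. a i \<in> L" "poly_val a N t = \<zero>" "k < N" "a k \<noteq> \<zero>"
  shows "locally_finite_residue (simple_extension L t)"
proof -
  have Lf: "subfield L R" using L unfolding locally_finite_residue_def by blast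
  note Lr = subringE[OF subfieldE(1)[OF Lf]]
  have Lc: "L \<subseteq> carrier R" by (rule Lr(1))
  define P where "P n \<longleftrightarrow> (\<exists>c. (\<forall>i\<le>n. c i \<in> L) \<and> c n \<noteq> \<zero> \<and> poly_val c (Suc n) t = \<zero>)" for n
  have a_car: "\<And>i. i < N \<Longrightarrow> a i \<in> carrier R" using alg Lc by auto
  obtain m where m: "m < N" "a m \<noteq> \<zero>" "poly_val a N t = poly_val a (Suc m) t"
    using poly_val_top[where c = a and N = N, OF a_car t alg(3,4)] by blast
  have exP: "P m" unfolding P_def using m alg by (intro exI[of _ a]) auto
  define n where "n = (LEAST n. P n)"
  have "P n" unfolding n_def by (rule LeastI[of P, OF exP])
  then obtain c where c: "\<And>i. i \<le> n \<Longrightarrow> c i \<in> L" "c n \<noteq> \<zero>" "poly_val c (Suc n) t = \<zero>"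
    unfolding P_def by blast
  have least: "\<not> P k" if "k < n" for k using not_less_Least[of k P] that unfolding n_def by blast
  have cc: "c i \<in> carrier R" if "i \<le> n" for i using c(1)[OF that] Lc by auto
  have n0: "n > 0"
  proof (rule ccontr)
    assume "\<not> n > 0"
    then show False using c(2,3) cc[of 0] by simp
  qed
  have indep: "r i = \<zero>" if r: "\<And>i. i < n \<Longrightarrow> r i \<in> L" and z: "poly_val r n t = \<zero>" and i: "i < n" for r i
  proof (rule ccontr)
    assume nz: "r i \<noteq> \<zero>"
    have rc: "\<And>i. i < n \<Longrightarrow> r i \<in> carrier R" using r Lc by auto
    obtain k where k: "k < n" "r k \<noteq> \<zero>" "poly_val r n t = poly_val r (Suc k) t"
      using poly_val_top[where c = r and N = n, OF rc t i nz] by blast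
    then have "P k" unfolding P_def using r z by (intro exI[of _ r]) auto
    then show False using least[OF k(1)] by blast
  qed
  have uc: "c n \<in> Units R" using c(2) cc by (simp add: field_Units)
  define u where "u = inv (c n)"
  have uL: "u \<in> L" unfolding u_def using subfield_m_inv(1)[OF Lf, of "c n"] c by auto
  have uu: "u \<otimes> c n = \<one>" unfolding u_def using uc by simp
  have ucar: "u \<in> carrier R" using uL Lc by auto
  define h where "h i = u \<otimes> c i" for i
  have hL: "h i \<in> L" if "i < n" for i unfolding h_def using Lr(6)[OF uL] c(1) that by simp
  have monic: "t [^] n \<oplus> poly_val h n t = \<zero>"
  proof -
    have "\<zero> = poly_val (\<lambda>i. u \<otimes> c i) (Suc n) t"
      using poly_val_smult[of "Suc n" c u t] c(3) cc ucar t by simp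
    also have "\<dots> = poly_val h n t \<oplus> t [^] n"
      using uu t unfolding h_def by simp
    finally show ?thesis using hL Lc t by (subst a_comm) (auto simp: subset_iff)
  qed
  have "(algebraic over L) t"
  proof (rule algebraicI)
    define p where "p N = rev (map c [0..<N])" for N
    have pS: "p (Suc N) = c N # p N" for N by (simp add: p_def)
    have "eval (p N) t = poly_val c N t" if "N \<le> Suc n" for N
      using that
    proof (induction N)
      case (Suc N)
      have "eval (p (Suc N)) t = c N \<otimes> t [^] (length (p N)) \<oplus> eval (p N) t" by (simp add: pS)
      moreover have "length (p N) = N" by (simp add: p_def)
      ultimately have "eval (p (Suc N)) t = c N \<otimes> t [^] N \<oplus> poly_val c N t" using Suc by simp
      moreover have "c N \<in> carrier R" "poly_val c N t \<in> carrier R" using cc Suc.prems t by auto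
      ultimately show ?case using t by (simp add: a_comm)
    qed (simp add: p_def)
    then show "eval (p (Suc n)) t = \<zero>" using c by simp
    show "p (Suc n) \<noteq> []" by (simp add: p_def)
    have "polynomial L (p (Suc n))"
      by (rule polynomialI) (use c in \<open>auto simp: pS, auto simp: p_def\<close>)
    then show "p (Suc n) \<in> carrier (L[X])" by (simp add: univ_poly_carrier)
  qed
  then have L'f: "subfield (simple_extension L t) R"
    using simple_extension_is_subfield[OF Lf t] by blast
  show ?thesis
    unfolding locally_finite_residue_def
  proof (intro conjI allI impI L'f)
    fix T assume T: "finite T \<and> T \<subseteq> simple_extension L t"
    obtain C where C: "finite C" "C \<subseteq> L" "\<And>B. C \<subseteq> B \<Longrightarrow> B \<subseteq> carrier R \<Longrightarrow> T \<subseteq> simple_extension B t"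
      using finitely_many_coefficients[OF Lc t, of T] T by blast
    obtain S I where S: "C \<union> h ` {..<n} \<subseteq> S" "S \<subseteq> L" "finite_residue S I"
      by (rule locally_finite_residueD[OF L, of "C \<union> h ` {..<n}"]) (use C hL in auto)
    have Sr: "subring S R" "S \<subseteq> carrier R" using finite_residueD[OF S(3)] by auto
    have "finite_residue (simple_extension S t)
      {poly_val r n t \<oplus> (t [^] n \<oplus> poly_val h n t) \<otimes> q |r q. (\<forall>i<n. r i \<in> I) \<and> q \<in> simple_extension S t}"
    proof (rule finite_residue_adjoin[OF S(3) t n0])
      show "h i \<in> S" if "i < n" for i using S(1) that by auto
      show "subring (simple_extension S t) R" by (rule simple_extension_is_subring[OF Sr(1) t])
      fix r q assume r: "\<And>i. i < n \<Longrightarrow> r i \<in> S" and q: "q \<in> simple_extension S t"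
        and z: "poly_val r n t \<oplus> (t [^] n \<oplus> poly_val h n t) \<otimes> q = \<zero>"
      have "q \<in> carrier R" using q simple_extension_in_carrier[OF Sr(2) t] by auto
      then have "poly_val r n t = \<zero>" using z r Sr(2) t unfolding monic by (auto simp: subset_iff)
      then show "r 0 = \<zero>" using indep[of r 0] r S(2) n0 by auto
    qed
    moreover have "T \<subseteq> simple_extension S t" using C(3)[of S] S(1) Sr(2) by auto
    moreover have "simple_extension S t \<subseteq> simple_extension L t" by (rule mono_simple_extension[OF S(2)])
    ultimately show "\<exists>S I. T \<subseteq> S \<and> S \<subseteq> simple_extension L t \<and> finite_residue S I" by blast
  qed
qed

text \<open>The point is the equation \<open>d (n + j) = c j\<close> for the leading coefficients: a multiple of the monic
  polynomial by a nonzero polynomial has degree at least \<open>n\<close>, so no remainder can cancel it.\<close>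

lemma monic_times_poly_val:
  assumes Lr: "subring L R" and t: "t \<in> carrier R" and h: "\<And>i. i < n \<Longrightarrow> h i \<in> L"
    and c: "\<And>i. i \<le> j \<Longrightarrow> c i \<in> L"
  shows "\<exists>d. (\<forall>i\<le>n + j. d i \<in> L) \<and> d (n + j) = c j \<and>
    (t [^] n \<oplus> poly_val h n t) \<otimes> poly_val c (Suc j) t = poly_val d (Suc (n + j)) t"
  using c
proof (induction j arbitrary: c)
  note LE = subringE[OF Lr]
  have hc: "\<And>i. i < n \<Longrightarrow> h i \<in> carrier R" using h LE(1) by auto
  define e where "e a i = (if i < n then a \<otimes> h i else if i = n then a else \<zero>)" for a i
  have eL: "e a i \<in> L" if "a \<in> L" for a i using that h LE(2,6) by (auto simp: e_def)
  have e_val: "poly_val (e a) (Suc n) t = a \<otimes> (t [^] n \<oplus> poly_val h n t)" if "a \<in> L" for a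
  proof -
    have ac: "a \<in> carrier R" using that LE(1) by auto
    have "poly_val (e a) n t = poly_val (\<lambda>i. a \<otimes> h i) n t" by (rule poly_val_cong) (simp add: e_def)
    also have "\<dots> = a \<otimes> poly_val h n t" by (rule poly_val_smult) (use hc ac t in auto)
    finally have "poly_val (e a) (Suc n) t = a \<otimes> poly_val h n t \<oplus> a \<otimes> t [^] n" by (simp add: e_def)
    then show ?thesis using ac t hc by (simp add: r_distr a_comm)
  qed
  {
    case 0
    have c0: "c 0 \<in> L" "c 0 \<in> carrier R" using 0 LE(1) by auto
    have "(t [^] n \<oplus> poly_val h n t) \<otimes> poly_val c (Suc 0) t = poly_val (e (c 0)) (Suc (n + 0)) t"
      using e_val[OF c0(1)] c0 t hc by (simp add: m_comm)
    moreover have "e (c 0) (n + 0) = c 0" by (simp add: e_def)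
    ultimately show ?case using eL[OF c0(1)] by blast
  next
    case (Suc j)
    have c0: "c 0 \<in> L" "c 0 \<in> carrier R" using Suc.prems LE(1) by auto
    have "\<exists>d. (\<forall>i\<le>n + j. d i \<in> L) \<and> d (n + j) = (c \<circ> Suc) j \<and>
        (t [^] n \<oplus> poly_val h n t) \<otimes> poly_val (c \<circ> Suc) (Suc j) t = poly_val d (Suc (n + j)) t"
      by (rule Suc.IH) (use Suc.prems in auto)
    then obtain d where d: "\<forall>i\<le>n + j. d i \<in> L" "d (n + j) = (c \<circ> Suc) j"
        "(t [^] n \<oplus> poly_val h n t) \<otimes> poly_val (c \<circ> Suc) (Suc j) t = poly_val d (Suc (n + j)) t"
      by blast
    have csc: "\<And>i. i < Suc j \<Longrightarrow> (c \<circ> Suc) i \<in> carrier R" using Suc.prems LE(1) by auto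
    have dc: "\<And>i. i < Suc (n + j) \<Longrightarrow> d i \<in> carrier R" using d LE(1) by auto
    define d' where "d' i = case_nat \<zero> d i \<oplus> e (c 0) i" for i
    have cd: "case_nat \<zero> d i \<in> L" if "i \<le> n + Suc j" for i using d(1) LE(2) that by (auto split: nat.split)
    have "d' i \<in> L" if "i \<le> n + Suc j" for i
      unfolding d'_def by (rule LE(7)[OF cd[OF that] eL[OF c0(1)]])
    moreover have "d' (n + Suc j) = c (Suc j)"
      using d(2) dc[of "n + j"] by (simp add: d'_def e_def)
    moreover have "(t [^] n \<oplus> poly_val h n t) \<otimes> poly_val c (Suc (Suc j)) t = poly_val d' (Suc (n + Suc j)) t"
    proof -
      let ?h = "t [^] n \<oplus> poly_val h n t"
      have "poly_val d' (Suc (n + Suc j)) t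
          = poly_val (case_nat \<zero> d) (Suc (n + Suc j)) t \<oplus> poly_val (e (c 0)) (Suc (n + Suc j)) t"
        unfolding d'_def by (rule poly_val_add) (use cd eL[OF c0(1)] LE(1) t in auto)
      also have "poly_val (case_nat \<zero> d) (Suc (n + Suc j)) t = poly_val d (Suc (n + j)) t \<otimes> t"
        using poly_val_Horner[of "Suc (n + j)" d \<zero> t] dc t by simp
      also have "poly_val (e (c 0)) (Suc (n + Suc j)) t
          = poly_val (\<lambda>i. if i < Suc n then e (c 0) i else \<zero>) (Suc (n + Suc j)) t"
        by (rule poly_val_cong) (simp add: e_def)
      also have "\<dots> = poly_val (e (c 0)) (Suc n) t"
        by (rule poly_val_pad) (use eL[OF c0(1)] LE(1) t in auto)
      also have "\<dots> = c 0 \<otimes> ?h" by (rule e_val[OF c0(1)])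
      also have "poly_val d (Suc (n + j)) t \<otimes> t \<oplus> c 0 \<otimes> ?h
          = ?h \<otimes> (poly_val (c \<circ> Suc) (Suc j) t \<otimes> t \<oplus> c 0)"
      proof -
        have cl: "?h \<in> carrier R" "poly_val (c \<circ> Suc) (Suc j) t \<in> carrier R"
          using hc t csc by blast+
        show ?thesis unfolding d(3)[symmetric] using cl t c0 by algebra
      qed
      also have "poly_val (c \<circ> Suc) (Suc j) t \<otimes> t \<oplus> c 0 = poly_val (case_nat (c 0) (c \<circ> Suc)) (Suc (Suc j)) t"
        by (rule poly_val_Horner[symmetric]) (use csc c0 t in auto)
      also have "\<dots> = poly_val c (Suc (Suc j)) t"
        by (rule poly_val_cong) (auto split: nat.split)
      finally show ?thesis by simp
    qed
    ultimately show ?case by blast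
  }
qed

text \<open>Let \<open>b\<close> be a common denominator of \<open>T\<close>, with leading coefficient \<open>1\<close>. Then \<open>1 + t b\<close> is monic of
  positive degree, so \<open>S[t]/(I, 1 + t b)\<close> is finite and nonzero. In it \<open>b\<close> is invertible with inverse \<open>-t\<close>,
  and localizing at the elements invertible in the quotient accommodates \<open>T\<close>.\<close>

lemma locally_finite_residue_transcendental:
  assumes L: "locally_finite_residue L" and t: "t \<in> carrier R"
    and indep: "\<And>N c i. (\<forall>i<N. c i \<in> L) \<Longrightarrow> poly_val c N t = \<zero> \<Longrightarrow> i < N \<Longrightarrow> c i = \<zero>"
  shows "locally_finite_residue (fractions (simple_extension L t))"
  unfolding locally_finite_residue_def
proof (intro conjI allI impI)
  have Lf: "subfield L R" using L unfolding locally_finite_residue_def by blast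
  have Ls: "subring L R" by (rule subfieldE(1)[OF Lf])
  note Lr = subringE[OF Ls]
  define A where "A = simple_extension L t"
  have A: "subring A R" unfolding A_def by (rule simple_extension_is_subring[OF Ls t])
  note Ar = subringE[OF A]
  have LA: "L \<subseteq> A" unfolding A_def by (rule simple_extension_incl[OF Lr(1) t])
  show "subfield (fractions (simple_extension L t)) R"
    using subfield_fractions[OF A] unfolding A_def .
  fix T assume T: "finite T \<and> T \<subseteq> fractions (simple_extension L t)"
  obtain b0 where b0: "b0 \<in> A" "b0 \<noteq> \<zero>" "\<And>x. x \<in> T \<Longrightarrow> x \<otimes> b0 \<in> A"
    by (rule common_denominator[OF A, of T]) (use T in \<open>auto simp: A_def\<close>)
  obtain N a where a: "\<forall>i<N. a i \<in> L" "b0 = poly_val a N t"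
    using b0(1) unfolding A_def simple_extension_iff_poly_val[OF Lr(1) t] by blast
  have ac: "\<And>i. i < N \<Longrightarrow> a i \<in> carrier R" using a Lr(1) by auto
  have "\<exists>k<N. a k \<noteq> \<zero>" using poly_val_zero[OF t, of N a] a(2) b0(2) by blast
  then obtain k where k: "k < N" "a k \<noteq> \<zero>" by blast
  obtain m where m: "m < N" "a m \<noteq> \<zero>" "poly_val a N t = poly_val a (Suc m) t"
    using poly_val_top[where c = a and N = N, OF ac t k] by blast
  have um: "a m \<in> Units R" using m ac by (simp add: field_Units)
  define u where "u = inv (a m)"
  have uL: "u \<in> L" unfolding u_def using subfield_m_inv(1)[OF Lf, of "a m"] a(1) m by auto
  have ucar: "u \<in> carrier R" using uL Lr(1) by auto
  have uu: "u \<otimes> a m = \<one>" unfolding u_def using um by simp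
  define g where "g i = u \<otimes> a i" for i
  have gL: "g i \<in> L" if "i \<le> m" for i unfolding g_def using Lr(6)[OF uL] a(1) m(1) that by simp
  have gc: "g i \<in> carrier R" if "i \<le> m" for i using gL[OF that] Lr(1) by auto
  have gm: "g m = \<one>" unfolding g_def by (rule uu)
  define b where "b = poly_val g (Suc m) t"
  have b: "b = u \<otimes> b0"
    unfolding b_def g_def a(2) m(3) by (rule poly_val_smult) (use ac m ucar t in auto)
  have bc: "b \<in> carrier R" unfolding b_def by (rule poly_val_closed) (use gc t in auto)
  have Tb: "x \<otimes> b \<in> A" if "x \<in> T" for x
  proof -
    have xc: "x \<in> carrier R" using T that unfolding fractions_def by auto
    have "x \<otimes> b = u \<otimes> (x \<otimes> b0)" unfolding b using xc ucar b0(1) Ar(1) by (auto simp: m_lcomm)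
    then show ?thesis using Ar(6)[of u] b0(3)[OF that] uL LA by auto
  qed
  define n where "n = Suc m"
  define h where "h = case_nat \<one> g"
  have hL: "h i \<in> L" if "i \<le> n" for i using gL Lr(3) that unfolding h_def n_def by (auto split: nat.split)
  have hn: "h n = \<one>" by (simp add: h_def n_def gm)
  have h_val: "t [^] n \<oplus> poly_val h n t = \<one> \<oplus> t \<otimes> b"
  proof -
    have "t [^] n \<oplus> poly_val h n t = poly_val h (Suc n) t"
      using hn hL Lr(1) t by (simp add: subset_iff a_comm)
    also have "\<dots> = b \<otimes> t \<oplus> \<one>"
      unfolding h_def n_def b_def by (rule poly_val_Horner) (use gc t in auto)
    finally show ?thesis using bc t by (simp add: a_comm m_comm)
  qed
  obtain C where C: "finite C" "C \<subseteq> L"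
      "\<And>B. C \<subseteq> B \<Longrightarrow> B \<subseteq> carrier R \<Longrightarrow> (\<lambda>x. x \<otimes> b) ` T \<subseteq> simple_extension B t"
    using finitely_many_coefficients[OF Lr(1) t, of "(\<lambda>x. x \<otimes> b) ` T"] T Tb unfolding A_def by blast
  obtain S I where S: "C \<union> h ` {..n} \<subseteq> S" "S \<subseteq> L" "finite_residue S I"
    by (rule locally_finite_residueD[OF L, of "C \<union> h ` {..n}"]) (use C hL in auto)
  have Sr: "subring S R" "S \<subseteq> carrier R" using finite_residueD[OF S(3)] by auto
  let ?St = "simple_extension S t"
  have St: "subring ?St R" by (rule simple_extension_is_subring[OF Sr(1) t])
  note Str = subringE[OF St]
  have StA: "?St \<subseteq> A" unfolding A_def by (rule mono_simple_extension[OF S(2)])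
  define J where "J = {poly_val r n t \<oplus> (t [^] n \<oplus> poly_val h n t) \<otimes> q |r q. (\<forall>i<n. r i \<in> I) \<and> q \<in> ?St}"
  have J: "finite_residue ?St J"
    unfolding J_def
  proof (rule finite_residue_adjoin[OF S(3) t _ _ _ St])
    show "n > 0" by (simp add: n_def)
    show "h i \<in> S" if "i < n" for i using S(1) that by auto
    fix r q assume r: "\<And>i. i < n \<Longrightarrow> r i \<in> S" and q: "q \<in> ?St"
      and z: "poly_val r n t \<oplus> (t [^] n \<oplus> poly_val h n t) \<otimes> q = \<zero>"
    have rL: "r i \<in> L" if "i < n" for i using r[OF that] S(2) by auto
    have rc: "r i \<in> carrier R" if "i < n" for i using rL[OF that] Lr(1) by auto
    have n0: "0 < n" by (simp add: n_def)
    have hc: "t [^] n \<oplus> poly_val h n t \<in> carrier R" unfolding h_val using t bc by simp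
    obtain M c where c: "\<forall>i<M. c i \<in> S" "q = poly_val c M t"
      using q unfolding simple_extension_iff_poly_val[OF Sr(2) t] by blast
    have cc: "\<And>i. i < M \<Longrightarrow> c i \<in> carrier R" using c(1) Sr(2) by auto
    \<comment> \<open>Otherwise the leading term of \<open>(1 + t b) q\<close> has degree at least \<open>n\<close> and cannot be cancelled by \<open>r\<close>.\<close>
    have "\<forall>i<M. c i = \<zero>"
    proof (rule ccontr)
      assume "\<not> (\<forall>i<M. c i = \<zero>)"
      then obtain k where k: "k < M" "c k \<noteq> \<zero>" by blast
      obtain j where j: "j < M" "c j \<noteq> \<zero>" "poly_val c M t = poly_val c (Suc j) t"
        using poly_val_top[where c = c and N = M, OF cc t k] by blast
      obtain d where d: "\<forall>i\<le>n + j. d i \<in> L" "d (n + j) = c j"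
          "(t [^] n \<oplus> poly_val h n t) \<otimes> poly_val c (Suc j) t = poly_val d (Suc (n + j)) t"
        using monic_times_poly_val[OF Ls t, of n h j c] hL c(1) S(2) j(1) by (auto simp: subset_iff)
      define e where "e i = (if i < n then r i else \<zero>) \<oplus> d i" for i
      have pad: "poly_val (\<lambda>i. if i < n then r i else \<zero>) (Suc (n + j)) t = poly_val r n t"
        by (rule poly_val_pad) (use rc t in auto)
      have "poly_val e (Suc (n + j)) t = poly_val r n t \<oplus> poly_val d (Suc (n + j)) t"
        unfolding e_def pad[symmetric]
        by (rule poly_val_add) (use rc d(1) Lr(1) t in auto)
      also have "\<dots> = \<zero>" using z unfolding c(2) j(3) d(3) .
      finally have e0: "poly_val e (Suc (n + j)) t = \<zero>" .
      have "\<forall>i<Suc (n + j). e i \<in> L" using rL d(1) Lr(2,7) by (auto simp: e_def less_Suc_eq_le)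
      then have "e (n + j) = \<zero>" using indep[OF _ e0, of "n + j"] by simp
      moreover have "e (n + j) = c j" using d cc[OF j(1)] by (simp add: e_def)
      ultimately show False using j(2) by simp
    qed
    then have "q = \<zero>" unfolding c(2) by (intro poly_val_zero[OF t]) auto
    then have "poly_val r n t = \<zero>" using z hc rc t by simp
    then show "r 0 = \<zero>" using indep[of n r 0] rL n0 by blast
  qed
  define S' where "S' = {z \<in> carrier R. \<exists>x\<in>?St. \<exists>y\<in>?St. \<exists>y'\<in>?St. y \<otimes> y' \<ominus> \<one> \<in> J \<and> z \<otimes> y = x}"
  obtain I' where I': "finite_residue S' I'"
    using finite_residue_localize(2)[OF J] unfolding S'_def by blast
  have tSt: "t \<in> ?St" by (rule simple_extension_mem[OF Sr(1) t])
  have bSt: "b \<in> ?St"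
  proof -
    have "g i \<in> S" if "i \<le> m" for i
    proof -
      have "h (Suc i) \<in> S" using S(1) that by (auto simp: n_def image_subset_iff)
      then show ?thesis by (simp add: h_def)
    qed
    then show ?thesis unfolding b_def simple_extension_iff_poly_val[OF Sr(2) t] by (metis less_Suc_eq_le)
  qed
  have binv: "b \<otimes> (\<ominus> t) \<ominus> \<one> \<in> J"
  proof -
    have "poly_val (\<lambda>_. \<zero>) n t \<oplus> (t [^] n \<oplus> poly_val h n t) \<otimes> (\<ominus> \<one>) \<in> J"
      unfolding J_def using finite_residueD(5)[OF S(3)] Str(5)[OF Str(3)] by blast
    also have "poly_val (\<lambda>_. \<zero>) n t = \<zero>" by (rule poly_val_zero[OF t]) simp
    also have "\<zero> \<oplus> (t [^] n \<oplus> poly_val h n t) \<otimes> (\<ominus> \<one>) = b \<otimes> (\<ominus> t) \<ominus> \<one>"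
      unfolding h_val using bc t by algebra
    finally show ?thesis .
  qed
  have "T \<subseteq> S'"
  proof
    fix x assume x: "x \<in> T"
    have "x \<otimes> b \<in> ?St" using C(3)[of S] S(1) Sr(2) x by auto
    moreover have "x \<in> carrier R" using T x unfolding fractions_def by auto
    ultimately show "x \<in> S'" unfolding S'_def using bSt Str(5)[OF tSt] binv by blast
  qed
  moreover have "S' \<subseteq> fractions (simple_extension L t)"
  proof
    fix z assume "z \<in> S'"
    then obtain y y' where y: "z \<in> carrier R" "y \<in> ?St" "y' \<in> ?St" "y \<otimes> y' \<ominus> \<one> \<in> J" "z \<otimes> y \<in> ?St"
      unfolding S'_def by blast
    have "y \<noteq> \<zero>"
    proof
      assume "y = \<zero>"
      then have "\<ominus> \<one> \<in> J" using y(3,4) Str(1) by (auto simp: minus_eq)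
      then show False using finite_residueD(8)[OF J, of "\<ominus> \<one>"] finite_residueD(9)[OF J] by simp
    qed
    then show "z \<in> fractions (simple_extension L t)"
      using y StA unfolding fractions_def A_def by blast
  qed
  ultimately show "\<exists>S I. T \<subseteq> S \<and> S \<subseteq> fractions (simple_extension L t) \<and> finite_residue S I"
    using I' by blast
qed

lemma locally_finite_residue_adjoin:
  assumes L: "locally_finite_residue L" and t: "t \<in> carrier R"
  obtains L' where "locally_finite_residue L'" "insert t L \<subseteq> L'"
proof (cases "\<exists>N a k. (\<forall>i<N. a i \<in> L) \<and> poly_val a N t = \<zero> \<and> k < N \<and> a k \<noteq> \<zero>")
  have Ls: "subring L R" using L subfieldE(1) unfolding locally_finite_residue_def by blast
  have sub: "insert t L \<subseteq> simple_extension L t"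
    using simple_extension_mem[OF Ls t] simple_extension_incl[OF subringE(1)[OF Ls] t] by blast
  {
    case True
    then show thesis using locally_finite_residue_algebraic[OF L t] sub that by blast
  next
    case False
    have "locally_finite_residue (fractions (simple_extension L t))"
      by (rule locally_finite_residue_transcendental[OF L t]) (use False in blast)
    then show thesis
      using that sub fractions_incl[OF simple_extension_is_subring[OF Ls t]] by blast
  }
qed

text \<open>In characteristic zero any prime that does not divide \<open>m\<close> will do; in positive characteristic it has
  to be the characteristic itself.\<close>

lemma prime_avoiding_characteristic:
  fixes m :: int
  assumes m: "add_pow R m \<one> \<noteq> \<zero>"
  obtains p :: int where "Factorial_Ring.prime p" "\<not> p dvd m" "\<And>z :: int. add_pow R z \<one> = \<zero> \<Longrightarrow> p dvd z"
proof (cases "\<exists>z :: int. z \<noteq> 0 \<and> add_pow R z \<one> = \<zero>")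
  case False
  obtain p :: nat where p: "Factorial_Ring.prime p" "p > nat \<bar>m\<bar>" using bigger_prime by blast
  have "m \<noteq> 0" using m by (auto simp: add_pow_def)
  then have "\<not> int p dvd m" using p(2) zdvd_not_zless[of "\<bar>m\<bar>" "int p"] by auto
  moreover have "int p dvd z" if "add_pow R z \<one> = \<zero>" for z :: int
  proof -
    have "z = 0" using False that by blast
    then show ?thesis by simp
  qed
  ultimately show thesis using that[of "int p"] p(1) by simp
next
  case True
  have mult: "add_pow R (a * b) \<one> = add_pow R a \<one> \<otimes> add_pow R b \<one>" for a b :: int
    using add_pow_ldistr_int[of \<one> "add_pow R b \<one>" a] add.int_pow_pow[of \<one> a b] by (simp add: mult.commute)
  have plus: "add_pow R (a + b) \<one> = add_pow R a \<one> \<oplus> add_pow R b \<one>" for a b :: int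
    by (rule add.int_pow_mult) simp
  have cl: "add_pow R a \<one> \<in> carrier R" for a :: int by simp
  define P where "P n \<longleftrightarrow> n > 0 \<and> add_pow R (int n) \<one> = \<zero>" for n :: nat
  obtain z :: int where z: "z \<noteq> 0" "add_pow R z \<one> = \<zero>" using True by blast
  have "add_pow R (z * sgn z) \<one> = \<zero>" unfolding mult z(2) using cl by simp
  then have "add_pow R \<bar>z\<bar> \<one> = \<zero>" unfolding abs_sgn[of z] .
  then have "P (nat \<bar>z\<bar>)" using z(1) by (simp add: P_def)
  define p where "p = (LEAST n. P n)"
  have p: "P p" unfolding p_def by (rule LeastI[of P, OF \<open>P (nat \<bar>z\<bar>)\<close>])
  have least: "\<not> P k" if "k < p" for k using not_less_Least[of k P] that unfolding p_def by blast
  have dvd: "int p dvd z" if "add_pow R z \<one> = \<zero>" for z :: int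
  proof -
    have pz: "add_pow R (int p) \<one> = \<zero>" using p by (simp add: P_def)
    have "add_pow R z \<one> = add_pow R (z div int p) \<one> \<otimes> add_pow R (int p) \<one> \<oplus> add_pow R (z mod int p) \<one>"
      unfolding mult[symmetric] plus[symmetric] by simp
    also have "\<dots> = add_pow R (z mod int p) \<one>" unfolding pz using cl by simp
    finally have "add_pow R (z mod int p) \<one> = \<zero>" using that by simp
    moreover have "z mod int p \<ge> 0" "z mod int p < int p" using p by (auto simp: P_def)
    ultimately have "z mod int p = 0" using least[of "nat (z mod int p)"] by (auto simp: P_def)
    then show ?thesis by auto
  qed
  have "Factorial_Ring.prime p"
  proof (rule prime_natI)
    show "p \<ge> 2"
    proof (rule ccontr)
      assume "\<not> p \<ge> 2"
      then have "p = 1" using p by (auto simp: P_def)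
      then have "\<one> = \<zero>" using p by (simp add: P_def)
      then show False by simp
    qed
    fix a b assume "p dvd a * b"
    then obtain k where "a * b = p * k" by (auto elim: dvdE)
    then have "add_pow R (int a) \<one> \<otimes> add_pow R (int b) \<one> = add_pow R (int p) \<one> \<otimes> add_pow R (int k) \<one>"
      unfolding mult[symmetric] by (metis of_nat_mult)
    also have "\<dots> = \<zero>" using p cl by (simp add: P_def)
    finally have "add_pow R (int a) \<one> = \<zero> \<or> add_pow R (int b) \<one> = \<zero>" using integral cl by blast
    then show "p dvd a \<or> p dvd b" using dvd[of "int a"] dvd[of "int b"] by auto
  qed
  moreover have "\<not> int p dvd m"
  proof
    assume "int p dvd m"
    then obtain k where k: "m = int p * k" by (auto elim: dvdE)
    have "add_pow R m \<one> = \<zero>" unfolding k mult using p cl by (simp add: P_def)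
    then show False using m by simp
  qed
  ultimately show thesis using that[of "int p"] dvd by simp
qed

text \<open>The ideal \<open>p\<int>\<close>, for a prime \<open>p\<close> that divides no common denominator of \<open>T\<close>, localized at the elements
  invertible modulo \<open>p\<close>.\<close>

lemma locally_finite_residue_prime_field:
  "locally_finite_residue (fractions (range (\<lambda>k::int. add_pow R k \<one>)))"
  unfolding locally_finite_residue_def
proof (intro conjI allI impI)
  define e where "e k = add_pow R k \<one>" for k :: int
  have mult: "e (a * b) = e a \<otimes> e b" for a b
    unfolding e_def using add_pow_ldistr_int[of \<one> "add_pow R b \<one>" a] add.int_pow_pow[of \<one> a b] by (simp add: mult.commute)
  have plus: "e (a + b) = e a \<oplus> e b" for a b unfolding e_def by (rule add.int_pow_mult) simp
  have cl: "e a \<in> carrier R" for a by (simp add: e_def)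
  have neg: "e (- a) = \<ominus> e a" for a unfolding e_def by (rule add.int_pow_neg) simp
  have one: "e 1 = \<one>" by (simp add: e_def)
  have zero: "e 0 = \<zero>" by (simp add: e_def add_pow_def)
  have minus: "e a \<ominus> e b = e (a - b)" for a b unfolding minus_eq neg[symmetric] plus[symmetric] by simp
  let ?Z = "range e"
  have Z: "range (\<lambda>k::int. add_pow R k \<one>) = ?Z" by (simp add: e_def[abs_def])
  have Zr: "subring ?Z R"
  proof (rule subringI)
    show "\<one> \<in> ?Z" using one[symmetric] by (rule range_eqI)
    show "\<ominus> x \<in> ?Z" if "x \<in> ?Z" for x using that neg[symmetric] by auto
    show "x \<otimes> y \<in> ?Z" if "x \<in> ?Z" "y \<in> ?Z" for x y using that mult[symmetric] by auto
    show "x \<oplus> y \<in> ?Z" if "x \<in> ?Z" "y \<in> ?Z" for x y using that plus[symmetric] by auto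
  qed (use cl in auto)
  show "subfield (fractions (range (\<lambda>k::int. add_pow R k \<one>))) R"
    unfolding Z by (rule subfield_fractions[OF Zr])
  fix T assume T: "finite T \<and> T \<subseteq> fractions (range (\<lambda>k::int. add_pow R k \<one>))"
  then have TZ: "finite T" "T \<subseteq> fractions ?Z" unfolding Z by auto
  obtain b where b: "b \<in> ?Z" "b \<noteq> \<zero>" "\<And>x. x \<in> T \<Longrightarrow> x \<otimes> b \<in> ?Z"
    using common_denominator[OF Zr TZ] by blast
  then obtain m where m: "b = e m" by blast
  have "add_pow R m \<one> \<noteq> \<zero>" using b(2) unfolding m e_def .
  then obtain p where p: "Factorial_Ring.prime p" "\<not> p dvd m" "\<And>z. e z = \<zero> \<Longrightarrow> p dvd z"
    using prime_avoiding_characteristic[of m] unfolding e_def by blast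
  define I where "I = e ` {k. p dvd k}"
  have eI: "e k \<in> I \<longleftrightarrow> p dvd k" for k
  proof
    assume "e k \<in> I"
    then obtain l where l: "p dvd l" "e k = e l" unfolding I_def by auto
    have "e (k - l) = \<zero>" using minus[of k l] l(2) cl by (simp add: minus_eq r_neg)
    then have "p dvd (k - l) + l" using p(3) l(1) by (intro dvd_add)
    then show "p dvd k" by simp
  qed (auto simp: I_def)
  have I: "finite_residue ?Z I"
    unfolding finite_residue_def
  proof (intro conjI Zr)
    show "\<zero> \<in> I" using eI[of 0] zero by simp
    show "\<forall>x\<in>I. \<forall>y\<in>I. x \<oplus> y \<in> I" unfolding I_def using plus[symmetric] by auto
    show "\<forall>s\<in>?Z. \<forall>x\<in>I. s \<otimes> x \<in> I" unfolding I_def using mult[symmetric] by auto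
    show "\<one> \<notin> I" using eI[of 1] one p(1) by (auto simp: not_prime_unit)
    show "\<exists>F. finite F \<and> F \<subseteq> ?Z \<and> (\<forall>x\<in>?Z. \<exists>y\<in>F. x \<ominus> y \<in> I)"
    proof (intro exI conjI ballI)
      show "finite (e ` {0..<p})" by simp
      fix x assume "x \<in> ?Z"
      then obtain k where k: "x = e k" by auto
      have "e k \<ominus> e (k mod p) \<in> I" unfolding minus eI by (simp add: minus_mod_eq_mult_div)
      moreover have "e (k mod p) \<in> e ` {0..<p}" using prime_gt_0_int[OF p(1)] by (intro imageI) simp
      ultimately show "\<exists>y\<in>e ` {0..<p}. x \<ominus> y \<in> I" unfolding k by blast
    qed auto
  qed (auto simp: I_def)
  define S' where "S' = {z \<in> carrier R. \<exists>x\<in>?Z. \<exists>y\<in>?Z. \<exists>y'\<in>?Z. y \<otimes> y' \<ominus> \<one> \<in> I \<and> z \<otimes> y = x}"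
  obtain I' where I': "finite_residue S' I'"
    using finite_residue_localize(2)[OF I] unfolding S'_def by blast
  have "coprime m p" using p(1,2) by (meson coprime_commute prime_imp_coprime)
  then obtain u v where uv: "u * m + v * p = 1" using bezout_int[of m p] by auto
  have binv: "b \<otimes> e u \<ominus> \<one> \<in> I"
  proof -
    have "m * u - 1 = - v * p" using uv by (simp add: algebra_simps)
    then have "p dvd m * u - 1" by simp
    then show ?thesis unfolding m mult[symmetric] one[symmetric] minus eI .
  qed
  have "T \<subseteq> S'"
  proof
    fix x assume x: "x \<in> T"
    have "x \<in> carrier R" using TZ x unfolding fractions_def by auto
    then show "x \<in> S'" unfolding S'_def using b(1) b(3)[OF x] binv by blast
  qed
  moreover have "S' \<subseteq> fractions ?Z"
  proof
    fix z assume "z \<in> S'"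
    then obtain y y' where y: "z \<in> carrier R" "y \<in> ?Z" "y' \<in> ?Z" "y \<otimes> y' \<ominus> \<one> \<in> I" "z \<otimes> y \<in> ?Z"
      unfolding S'_def by blast
    have "y \<noteq> \<zero>"
    proof
      assume "y = \<zero>"
      then have "\<ominus> \<one> \<in> I" using y(3,4) cl by (auto simp: minus_eq)
      then show False using finite_residueD(8)[OF I, of "\<ominus> \<one>"] finite_residueD(9)[OF I] by simp
    qed
    then show "z \<in> fractions ?Z" using y unfolding fractions_def by blast
  qed
  ultimately show "\<exists>S I. T \<subseteq> S \<and> S \<subseteq> fractions (range (\<lambda>k::int. add_pow R k \<one>)) \<and> finite_residue S I"
    unfolding Z using I' by blast
qed

text \<open>This is the form of the Nullstellensatz over \<open>\<int>\<close> that is needed: a finitely generated domain, in which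
  finitely many nonzero elements may be inverted in advance, maps to a nonzero finite ring.\<close>

theorem finite_subset_finite_residue:
  assumes "finite T" "T \<subseteq> carrier R"
  obtains S I where "T \<subseteq> S" "finite_residue S I"
proof -
  have "\<exists>L. locally_finite_residue L \<and> T \<subseteq> L"
    using assms
  proof (induction T)
    case empty
    show ?case using locally_finite_residue_prime_field by blast
  next
    case (insert t T)
    then obtain L where L: "locally_finite_residue L" "T \<subseteq> L" by auto
    have "t \<in> carrier R" using insert.prems by simp
    then obtain L' where "locally_finite_residue L'" "insert t L \<subseteq> L'"
      using locally_finite_residue_adjoin[OF L(1)] by blast
    then show ?case using L(2) by blast
  qed
  then show thesis using that locally_finite_residueD assms(1) by metis
qed

lemma finite_residue_quotient:
  assumes SI: "finite_residue S I"
  shows "ring ((R\<lparr>carrier := S\<rparr>) Quot I)" "finite (carrier ((R\<lparr>carrier := S\<rparr>) Quot I))"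
    and "ring_hom_ring (R\<lparr>carrier := S\<rparr>) ((R\<lparr>carrier := S\<rparr>) Quot I) ((+>\<^bsub>R\<lparr>carrier := S\<rparr>\<^esub>) I)"
    and "\<And>x. x \<in> S \<Longrightarrow> I +>\<^bsub>R\<lparr>carrier := S\<rparr>\<^esub> x = \<zero>\<^bsub>(R\<lparr>carrier := S\<rparr>) Quot I\<^esub> \<Longrightarrow> x \<in> I"
proof -
  note S = finite_residueD[OF SI]
  let ?S = "R\<lparr>carrier := S\<rparr>"
  interpret S: ring ?S by (rule subring_is_ring[OF S(1)])
  have minv: "a_inv ?S x = \<ominus> x" if "x \<in> S" for x
  proof (rule S.minus_equality)
    show "\<ominus> x \<oplus>\<^bsub>?S\<^esub> x = \<zero>\<^bsub>?S\<^esub>" using that S(2) l_neg[of x] by auto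
  qed (use that subringE(5)[OF S(1) that] in auto)
  have sub: "additive_subgroup I ?S"
  proof (rule additive_subgroupI)
    show "subgroup I (add_monoid ?S)"
    proof (rule group.subgroupI)
      show "group (add_monoid ?S)" by (rule S.a_group)
      show "inv\<^bsub>add_monoid ?S\<^esub> a \<in> I" if "a \<in> I" for a
        using S(8)[OF that] minv[of a] subsetD[OF S(3) that] unfolding a_inv_def by simp
    qed (use S in auto)
  qed
  interpret I: ideal I ?S
  proof (rule idealI[OF S.ring_axioms])
    show "subgroup I (add_monoid ?S)" using additive_subgroup.a_subgroup[OF sub] .
    show "x \<otimes>\<^bsub>?S\<^esub> a \<in> I" if "a \<in> I" "x \<in> carrier ?S" for a x using that S(7) by simp
    show "a \<otimes>\<^bsub>?S\<^esub> x \<in> I" if "a \<in> I" "x \<in> carrier ?S" for a x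
    proof -
      have "a \<in> carrier R" "x \<in> carrier R" using that S(2,4) by auto
      then show ?thesis using that S(7)[of x a] m_comm by simp
    qed
  qed
  show Q: "ring (?S Quot I)" by (rule I.quotient_is_ring)
  show "ring_hom_ring ?S (?S Quot I) ((+>\<^bsub>?S\<^esub>) I)" by (rule I.rcos_ring_hom_ring)
  show "x \<in> I" if "x \<in> S" "I +>\<^bsub>?S\<^esub> x = \<zero>\<^bsub>?S Quot I\<^esub>" for x
    using that I.a_rcos_self[of x] by (simp add: FactRing_def)
  obtain F where F: "finite F" "F \<subseteq> S" "\<And>x. x \<in> S \<Longrightarrow> \<exists>y\<in>F. x \<ominus> y \<in> I"
    by (rule finite_residue_representatives[OF SI]) (rule that)
  have "carrier (?S Quot I) \<subseteq> (\<lambda>y. I +>\<^bsub>?S\<^esub> y) ` F"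
  proof
    fix c assume "c \<in> carrier (?S Quot I)"
    then obtain x where x: "x \<in> S" "c = I +>\<^bsub>?S\<^esub> x" by (auto simp: FactRing_def A_RCOSETS_def')
    obtain y where y: "y \<in> F" "x \<ominus> y \<in> I" using F(3)[OF x(1)] by blast
    have yS: "y \<in> S" using y F by auto
    have "x \<oplus>\<^bsub>?S\<^esub> \<ominus>\<^bsub>?S\<^esub> y \<in> I" using y(2) minv[OF yS] by (simp add: minus_eq)
    then have "x \<in> I +>\<^bsub>?S\<^esub> y"
      using I.a_rcos_module_rev[of y x] x yS by simp
    then have "I +>\<^bsub>?S\<^esub> x = I +>\<^bsub>?S\<^esub> y"
      using S.a_repr_independence[of x I y] yS I.a_subgroup by simp
    then show "c \<in> (\<lambda>y. I +>\<^bsub>?S\<^esub> y) ` F" using x y by simp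
  qed
  then show "finite (carrier (?S Quot I))" using F(1) finite_subset by blast
qed

end

section \<open>From \<open>A\<close>-surjunctivity to stable finiteness\<close>

text \<open>The subring \<open>S\<close> contains the inverse of the offending coefficient \<open>c\<close>, so that \<open>c\<close> cannot vanish in
  the finite quotient, whereas direct finiteness over the quotient forces it to vanish.\<close>

theorem stably_finite_if_A_surjunctive:
  fixes G :: "('g, 'm) monoid_scheme" and K :: "('k, 'l) ring_scheme"
  assumes G: "group G" and inf: "infinite (UNIV :: 'b set)"
    and surj: "A_surjunctive TYPE('b) G" and K: "field K"
  shows "stably_finite (group_ring K G)"
  unfolding stably_finite_def directly_finite_def
proof (intro allI impI ballI)
  interpret K: field K by (rule K)
  interpret KG: group_ring_data G K by (intro group_ring_data.intro G K.ring_axioms)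
  fix d :: nat and M N
  let ?M = "matrix_ring d (group_ring K G)"
  assume M: "M \<in> carrier ?M" and N: "N \<in> carrier ?M" and MN: "M \<otimes>\<^bsub>?M\<^esub> N = \<one>\<^bsub>?M\<^esub>"
  note NM = KG.matrix_mult_closed[OF N M]
  show "N \<otimes>\<^bsub>?M\<^esub> M = \<one>\<^bsub>?M\<^esub>"
  proof (rule KG.matrix_eqI[OF NM KG.matrix_one_closed], rule ccontr)
    fix i j g assume ij: "i < d" "j < d" and g: "g \<in> carrier G"
    define a where "a = (N \<otimes>\<^bsub>?M\<^esub> M) (i, j) g"
    define b where "b = \<one>\<^bsub>?M\<^esub> (i, j) g"
    assume "(N \<otimes>\<^bsub>?M\<^esub> M) (i, j) g \<noteq> \<one>\<^bsub>?M\<^esub> (i, j) g"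
    then have ab: "a \<noteq> b" by (simp add: a_def b_def)
    have ac: "a \<in> carrier K" unfolding a_def using NM ij g by blast
    have bc: "b \<in> carrier K" unfolding b_def using KG.matrix_one_closed ij g by blast
    define c where "c = a \<ominus>\<^bsub>K\<^esub> b"
    have c: "c \<in> carrier K" "c \<noteq> \<zero>\<^bsub>K\<^esub>" using ab ac bc by (auto simp: c_def)
    then have cU: "c \<in> Units K" by (simp add: K.field_Units)
    define T where "T = insert (inv\<^bsub>K\<^esub> c) (\<Union>Z\<in>{M, N}. (\<lambda>((i, k), g). Z (i, k) g) `
        (({..<d} \<times> {..<d}) \<times> KG.matrix_support d Z))"
    have "finite T" unfolding T_def using KG.finite_matrix_support M N by auto
    moreover have "T \<subseteq> carrier K"
      unfolding T_def using M N KG.matrix_support_subset cU by (fastforce simp: subset_iff)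
    ultimately obtain S I where TS: "T \<subseteq> S" and SI: "K.finite_residue S I"
      using K.finite_subset_finite_residue by blast
    note S = K.finite_residueD[OF SI]
    let ?S = "K\<lparr>carrier := S\<rparr>"
    interpret S: ring ?S by (rule K.subring_is_ring[OF S(1)])
    interpret SG: group_ring_data G ?S by (intro group_ring_data.intro G S.ring_axioms)
    have id: "ring_hom_ring ?S K id"
      by (rule ring_hom_ringI2[OF S.ring_axioms K.ring_axioms]) (use S(2) in \<open>auto simp: ring_hom_def\<close>)
    interpret id: group_ring_hom G ?S K id
      by (intro group_ring_hom.intro SG.group_ring_data_axioms KG.group_ring_data_axioms id)
    let ?MS = "matrix_ring d (group_ring ?S G)"
    have mem: "Z \<in> carrier ?MS" if Z: "Z \<in> {M, N}" for Z
    proof -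
      have ZM: "Z \<in> carrier ?M" using M N Z by auto
      have coeff: "Z (i, k) g \<in> S" if "i < d" "k < d" "g \<in> carrier G" for i k g
      proof (cases "g \<in> KG.matrix_support d Z")
        case True
        then have "Z (i, k) g \<in> T" unfolding T_def using that Z by force
        then show ?thesis using TS by auto
      next
        case False
        then have "Z (i, k) g = \<zero>\<^bsub>K\<^esub>" using that by (auto simp: KG.matrix_support_def)
        then show ?thesis using S(3,5) by auto
      qed
      have "Z (i, k) \<in> carrier (group_ring ?S G)" if "i < d" "k < d" for i k
      proof -
        have "Z (i, k) \<in> carrier (group_ring K G)" using ZM that by blast
        then show ?thesis using coeff[OF that]
          unfolding KG.carrier_group_ring SG.carrier_group_ring by (auto simp: PiE_iff)
      qed
      then show ?thesis using ZM by (auto simp: matrix_ring_def PiE_iff)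
    qed
    have idmap: "matrix_map G d id Z = Z" if Z: "Z \<in> carrier ?MS" for Z
    proof (rule PiE_ext)
      show "matrix_map G d id Z \<in> {..<d} \<times> {..<d} \<rightarrow>\<^sub>E UNIV" by (simp add: matrix_map_def)
      show "Z \<in> {..<d} \<times> {..<d} \<rightarrow>\<^sub>E UNIV" using Z by (auto simp: matrix_ring_def PiE_iff)
      fix q assume q: "q \<in> {..<d} \<times> {..<d}"
      obtain i k where ik: "q = (i, k)" "i < d" "k < d" using q by auto
      have "Z (i, k) \<in> carrier (group_ring ?S G)" using Z ik by blast
      then have "Z (i, k) \<in> extensional (carrier G)" by (auto simp: SG.carrier_group_ring PiE_iff)
      then show "matrix_map G d id Z q = Z q"
        using ik by (auto simp: matrix_map_def extensional_def fun_eq_iff)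
    qed
    have MS: "M \<in> carrier ?MS" and NS: "N \<in> carrier ?MS" using mem by auto
    have prod: "U \<otimes>\<^bsub>?MS\<^esub> V = U \<otimes>\<^bsub>?M\<^esub> V" if U: "U \<in> carrier ?MS" and V: "V \<in> carrier ?MS" for U V
      using id.matrix_map_mult[OF U V] idmap[OF U] idmap[OF V] idmap[OF SG.matrix_mult_closed[OF U V]] by simp
    have one: "\<one>\<^bsub>?MS\<^esub> = \<one>\<^bsub>?M\<^esub>"
      using id.matrix_map_one idmap[OF SG.matrix_one_closed] by metis
    let ?Q = "?S Quot I"
    define \<phi> where "\<phi> = (+>\<^bsub>?S\<^esub>) I"
    note quot = K.finite_residue_quotient[OF SI, folded \<phi>_def]
    interpret Q: ring ?Q by (rule quot(1))
    interpret QG: group_ring_data G ?Q by (intro group_ring_data.intro G Q.ring_axioms)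
    interpret \<phi>: group_ring_hom G ?S ?Q \<phi>
      by (intro group_ring_hom.intro SG.group_ring_data_axioms QG.group_ring_data_axioms quot(3))
    let ?MQ = "matrix_ring d (group_ring ?Q G)"
    have "finite (carrier (QG.vec d))" using quot(2) by (simp add: finite_PiE)
    then have "surjunctive_alphabet G (QG.vec d)"
      using group.A_surjunctive_imp_surjunctive_alphabet[OF G inf surj QG.comm_group_vec] by blast
    then have fin: "directly_finite ?MQ" by (rule QG.directly_finite_if_surjunctive_alphabet)
    have "matrix_map G d \<phi> M \<otimes>\<^bsub>?MQ\<^esub> matrix_map G d \<phi> N = \<one>\<^bsub>?MQ\<^esub>"
    proof -
      have "M \<otimes>\<^bsub>?MS\<^esub> N = \<one>\<^bsub>?MS\<^esub>" unfolding prod[OF MS NS] MN one ..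
      then show ?thesis
        unfolding \<phi>.matrix_map_mult[OF MS NS, symmetric] using \<phi>.matrix_map_one by simp
    qed
    then have "matrix_map G d \<phi> N \<otimes>\<^bsub>?MQ\<^esub> matrix_map G d \<phi> M = \<one>\<^bsub>?MQ\<^esub>"
      using fin \<phi>.matrix_map_closed[OF MS] \<phi>.matrix_map_closed[OF NS]
      unfolding directly_finite_def by blast
    then have "matrix_map G d \<phi> (N \<otimes>\<^bsub>?MS\<^esub> M) = matrix_map G d \<phi> \<one>\<^bsub>?MS\<^esub>"
      using \<phi>.matrix_map_mult[OF NS MS] \<phi>.matrix_map_one by simp
    from \<phi>.matrix_map_eqD[OF this ij g] have \<phi>ab: "\<phi> a = \<phi> b"
      unfolding a_def b_def prod[OF NS MS] one .
    have aS: "a \<in> carrier ?S" unfolding a_def prod[OF NS MS, symmetric]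
      by (rule SG.matrix_coeff_closed[OF SG.matrix_mult_closed[OF NS MS] ij g])
    have bS: "b \<in> carrier ?S" unfolding b_def one[symmetric]
      by (rule SG.matrix_coeff_closed[OF SG.matrix_one_closed ij g])
    have aSb: "c = a \<ominus>\<^bsub>?S\<^esub> b"
    proof -
      have nb: "\<ominus>\<^bsub>?S\<^esub> b \<in> carrier K" using S.a_inv_closed[OF bS] S(2) by auto
      have "\<ominus>\<^bsub>?S\<^esub> b \<oplus>\<^bsub>K\<^esub> b = \<zero>\<^bsub>K\<^esub>" using S.l_neg[OF bS] by simp
      then have "\<ominus>\<^bsub>K\<^esub> b = \<ominus>\<^bsub>?S\<^esub> b" using nb bc by (intro K.minus_equality)
      then show ?thesis unfolding c_def K.minus_eq S.minus_eq by simp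
    qed
    have cS: "c \<in> S" using S.minus_closed[OF aS bS] unfolding aSb by simp
    have "\<phi> c = \<phi> a \<oplus>\<^bsub>?Q\<^esub> \<ominus>\<^bsub>?Q\<^esub> \<phi> b"
      unfolding aSb S.minus_eq
      using \<phi>.\<phi>.hom_add[OF aS S.a_inv_closed[OF bS]] \<phi>.\<phi>.hom_a_inv[OF bS] by (simp only:)
    also have "\<dots> = \<zero>\<^bsub>?Q\<^esub>" unfolding \<phi>ab by (rule Q.r_neg[OF \<phi>.\<phi>.hom_closed[OF bS]])
    finally have "\<phi> c = \<zero>\<^bsub>?Q\<^esub>" .
    then have "c \<in> I" using quot(4)[OF cS] by simp
    moreover have "inv\<^bsub>K\<^esub> c \<in> S" using TS unfolding T_def by auto
    ultimately have "inv\<^bsub>K\<^esub> c \<otimes>\<^bsub>K\<^esub> c \<in> I" using S(7) by blast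
    then show False using cU S(9) by simp
  qed
qed

section \<open>Characters of groups of prime exponent\<close>

lemma (in comm_group) subgroup_adjoin:
  assumes M: "subgroup M G" and w: "w \<in> carrier G"
  shows "subgroup {m \<otimes> w [^] j |m j. m \<in> M \<and> j \<in> (UNIV :: int set)} G" (is "subgroup ?M' G")
proof (rule subgroupI)
  note Mc = subgroup.mem_carrier[OF M]
  show "?M' \<subseteq> carrier G" using Mc w by auto
  show "?M' \<noteq> {}" using subgroup.one_closed[OF M] by blast
  fix a assume "a \<in> ?M'"
  then obtain m j where a: "a = m \<otimes> w [^] (j::int)" "m \<in> M" by blast
  have "inv a = inv m \<otimes> w [^] (- j)"
    unfolding a(1) using a(2) w by (simp add: inv_mult Mc int_pow_neg)
  then show "inv a \<in> ?M'" using subgroup.m_inv_closed[OF M a(2)] by blast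
  fix b assume "b \<in> ?M'"
  then obtain n k where b: "b = n \<otimes> w [^] (k::int)" "n \<in> M" by blast
  have "a \<otimes> b = (m \<otimes> n) \<otimes> w [^] (j + k)"
    unfolding a(1) b(1) using a(2) b(2) w by (simp add: Mc int_pow_mult m_ac)
  then show "a \<otimes> b \<in> ?M'" using subgroup.m_closed[OF M a(2) b(2)] by blast
qed

lemma (in group) bezout_pow:
  assumes a: "a \<in> carrier G" and p: "Factorial_Ring.prime p" "a [^] p = \<one>" and j: "\<not> int p dvd j"
  obtains u :: int where "a = (a [^] j) [^] u"
proof -
  have "coprime j (int p)" using p(1) j by (metis coprime_commute prime_imp_coprime prime_nat_int_transfer)
  then obtain u v where uv: "u * j + v * int p = 1" using bezout_int[of j "int p"] by auto
  have ap: "a [^] (int p) = \<one>" using p(2) by (simp add: int_pow_int)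
  have "a = a [^] (u * j + v * int p)" unfolding uv using a by simp
  also have "\<dots> = a [^] (j * u) \<otimes> (a [^] (int p)) [^] v"
    using a by (simp add: int_pow_mult int_pow_pow mult.commute)
  also have "\<dots> = (a [^] j) [^] u" unfolding ap using a by (simp add: int_pow_pow)
  finally show thesis by (rule that)
qed

text \<open>By Zorn's lemma there is a maximal subgroup \<open>M\<close> among those that contain \<open>N\<close> and avoid \<open>e\<close>. Adjoining any
  further element produces \<open>e\<close>, so every element of the group is congruent to a power of \<open>e\<close> modulo \<open>M\<close>. The
  exponent of this power, modulo \<open>p\<close>, is the character. Zorn's lemma is used because the lemma is applied
  not only to finite alphabets but also to the rows over a group ring.\<close>

lemma (in comm_group) separating_character:
  assumes p: "Factorial_Ring.prime (p::nat)" and exp: "\<And>w. w \<in> carrier G \<Longrightarrow> w [^] p = \<one>"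
    and N: "subgroup N G" and e: "e \<in> carrier G" "e \<notin> N"
  obtains \<chi> where "\<chi> \<in> hom G (add_monoid (residue_ring (int p)))"
    "\<And>n. n \<in> N \<Longrightarrow> \<chi> n = 0" "\<chi> e = 1"
proof -
  define \<A> where "\<A> = {M. subgroup M G \<and> N \<subseteq> M \<and> e \<notin> M}"
  have "\<exists>M\<in>\<A>. \<forall>M'\<in>\<A>. M \<subseteq> M' \<longrightarrow> M' = M"
  proof (rule subset_Zorn_nonempty)
    show "\<A> \<noteq> {}" using N e by (auto simp: \<A>_def)
    fix C assume C: "C \<noteq> {}" "subset.chain \<A> C"
    have CA: "\<And>M. M \<in> C \<Longrightarrow> M \<in> \<A>" using C(2) by (auto simp: subset.chain_def)
    have "subgroup (\<Union>C) G"
    proof (rule subgroupI)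
      show "\<Union>C \<subseteq> carrier G" using CA subgroup.subset unfolding \<A>_def by blast
      show "\<Union>C \<noteq> {}" using C(1) CA subgroup.one_closed unfolding \<A>_def by blast
      show "inv a \<in> \<Union>C" if a: "a \<in> \<Union>C" for a
      proof -
        obtain M where M: "M \<in> C" "a \<in> M" using a by blast
        then have "subgroup M G" using CA by (simp add: \<A>_def)
        from subgroup.m_inv_closed[OF this M(2)] show ?thesis by (rule UnionI[OF M(1)])
      qed
      fix a b assume "a \<in> \<Union>C" "b \<in> \<Union>C"
      then obtain M M' where M: "M \<in> C" "a \<in> M" "M' \<in> C" "b \<in> M'" by blast
      then have "M \<subseteq> M' \<or> M' \<subseteq> M" using C(2) by (auto simp: subset.chain_def)
      then obtain L where "L \<in> C" "a \<in> L" "b \<in> L" using M by blast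
      moreover from this have "subgroup L G" using CA by (simp add: \<A>_def)
      ultimately show "a \<otimes> b \<in> \<Union>C" by (intro UnionI[of L] subgroup.m_closed)
    qed
    then show "\<Union>C \<in> \<A>" using C(1) CA unfolding \<A>_def by blast
  qed
  then obtain M where M: "M \<in> \<A>" and max: "\<And>M'. M' \<in> \<A> \<Longrightarrow> M \<subseteq> M' \<Longrightarrow> M' = M" by blast
  have Ms: "subgroup M G" and NM: "N \<subseteq> M" and eM: "e \<notin> M" using M by (auto simp: \<A>_def)
  note Mc = subgroup.mem_carrier[OF Ms]
  have Mpow: "m [^] (k::int) \<in> M" if "m \<in> M" for m k
    by (rule subgroup_int_pow_closed[OF Ms that])
  have epow: "e [^] k \<in> M \<longleftrightarrow> int p dvd k" for k :: int
  proof
    assume k: "e [^] k \<in> M"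
    show "int p dvd k"
    proof (rule ccontr)
      assume "\<not> int p dvd k"
      then obtain u :: int where "e = (e [^] k) [^] u" using bezout_pow[OF e(1) p exp[OF e(1)]] by blast
      then show False using Mpow[OF k, of u] eM by simp
    qed
  next
    assume "int p dvd k"
    then obtain l where "k = int p * l" by (auto elim: dvdE)
    then have "e [^] k = (e [^] p) [^] l" using e(1) by (simp add: int_pow_pow int_pow_int[symmetric])
    then show "e [^] k \<in> M" using exp[OF e(1)] subgroup.one_closed[OF Ms] by simp
  qed
  have decomp: "\<exists>k::int. w \<otimes> e [^] (- k) \<in> M" if w: "w \<in> carrier G" for w
  proof (cases "w \<in> M")
    case True
    then have "w \<otimes> e [^] (- (0::int)) \<in> M" using w by simp
    then show ?thesis by blast
  next
    case False
    let ?M' = "{m \<otimes> w [^] j |m j. m \<in> M \<and> j \<in> (UNIV :: int set)}"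
    have "m \<in> ?M'" if "m \<in> M" for m
      using that Mc[OF that] by (intro CollectI exI[of _ m] exI[of _ "0::int"]) simp
    moreover have "w \<in> ?M'"
      using w subgroup.one_closed[OF Ms] by (intro CollectI exI[of _ \<one>] exI[of _ "1::int"]) simp
    ultimately have "?M' \<notin> \<A>" using max[of ?M'] False by blast
    then have "e \<in> ?M'" using subgroup_adjoin[OF Ms w] \<open>\<And>m. m \<in> M \<Longrightarrow> m \<in> ?M'\<close> NM
      unfolding \<A>_def by blast
    then obtain m j where mj: "e = m \<otimes> w [^] (j::int)" "m \<in> M" by blast
    have "\<not> int p dvd j"
    proof
      assume "int p dvd j"
      then obtain l where "j = int p * l" by (auto elim: dvdE)
      then have "w [^] j = (w [^] p) [^] l" using w by (simp add: int_pow_pow int_pow_int[symmetric])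
      then have "e = m" using mj Mc exp[OF w] by simp
      then show False using mj eM by simp
    qed
    then obtain u :: int where u: "w = (w [^] j) [^] u" using bezout_pow[OF w p exp[OF w]] by blast
    have "w [^] j = inv m \<otimes> e" using mj w Mc[OF mj(2)] by (simp add: m_assoc[symmetric])
    then have "w = (inv m) [^] u \<otimes> e [^] u"
      using u Mc[OF mj(2)] e(1) by (simp add: int_pow_distrib)
    then have "w \<otimes> e [^] (- u) = (inv m) [^] u"
      using Mc[OF mj(2)] e(1) by (simp add: m_assoc int_pow_mult[symmetric])
    then show ?thesis using Mpow[OF subgroup.m_inv_closed[OF Ms mj(2)], of u] by (intro exI[of _ u]) simp
  qed
  define \<chi> where "\<chi> w = (SOME k::int. w \<otimes> e [^] (- k) \<in> M) mod int p" for w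
  have \<chi>I: "\<chi> w = k mod int p" if w: "w \<in> carrier G" and k: "w \<otimes> e [^] (- k) \<in> M" for w k
  proof -
    define l where "l = (SOME k::int. w \<otimes> e [^] (- k) \<in> M)"
    have l: "w \<otimes> e [^] (- l) \<in> M" unfolding l_def by (rule someI_ex[OF decomp[OF w]])
    have "inv (w \<otimes> e [^] (- k)) \<otimes> (w \<otimes> e [^] (- l)) = e [^] (k - l)"
    proof -
      have cancel: "(inv w \<otimes> a) \<otimes> (w \<otimes> b) = a \<otimes> b" if "a \<in> carrier G" "b \<in> carrier G" for a b
        using that w by (simp add: m_comm[of "inv w" a] m_assoc m_assoc[of "inv w" w b, symmetric])
      have "inv (w \<otimes> e [^] (- k)) = inv w \<otimes> e [^] k"
        using w e(1) by (simp add: inv_mult int_pow_neg)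
      then have "inv (w \<otimes> e [^] (- k)) \<otimes> (w \<otimes> e [^] (- l)) = e [^] k \<otimes> e [^] (- l)"
        using cancel e(1) by simp
      also have "\<dots> = e [^] (k + - l)" by (rule int_pow_mult[symmetric, OF e(1)])
      finally show ?thesis by simp
    qed
    then have "e [^] (k - l) \<in> M"
      using subgroup.m_closed[OF Ms subgroup.m_inv_closed[OF Ms k] l] by simp
    then have "int p dvd k - l" unfolding epow .
    then have "k mod int p = l mod int p" by (simp add: mod_eq_dvd_iff)
    then show ?thesis by (simp add: \<chi>_def l_def)
  qed
  have \<chi>E: "\<exists>k. w \<otimes> e [^] (- k) \<in> M \<and> \<chi> w = k mod int p" if w: "w \<in> carrier G" for w
    using decomp[OF w] \<chi>I[OF w] by blast
  have p1: "p > 1" using p by (rule prime_gt_1_nat)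
  have "\<chi> \<in> hom G (add_monoid (residue_ring (int p)))"
  proof (rule homI)
    show "\<chi> w \<in> carrier (add_monoid (residue_ring (int p)))" for w
      using p1 by (simp add: \<chi>_def residue_ring_def)
    fix v w assume v: "v \<in> carrier G" and w: "w \<in> carrier G"
    obtain j where j: "v \<otimes> e [^] (- j) \<in> M" "\<chi> v = j mod int p" using \<chi>E[OF v] by blast
    obtain k where k: "w \<otimes> e [^] (- k) \<in> M" "\<chi> w = k mod int p" using \<chi>E[OF w] by blast
    have "(v \<otimes> w) \<otimes> e [^] (- (j + k)) = (v \<otimes> e [^] (- j)) \<otimes> (w \<otimes> e [^] (- k))"
    proof -
      have "e [^] (- (j + k)) = e [^] (- j) \<otimes> e [^] (- k)"
        using e(1) by (simp add: int_pow_mult[symmetric])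
      then show ?thesis using v w e(1) by (simp add: m_ac)
    qed
    then have "(v \<otimes> w) \<otimes> e [^] (- (j + k)) \<in> M" using subgroup.m_closed[OF Ms j(1) k(1)] by simp
    then have "\<chi> (v \<otimes> w) = (j + k) mod int p" using v w by (intro \<chi>I) auto
    then show "\<chi> (v \<otimes> w) = \<chi> v \<otimes>\<^bsub>add_monoid (residue_ring (int p))\<^esub> \<chi> w"
      using j k by (simp add: residue_ring_def mod_simps)
  qed
  moreover have "\<chi> n = 0" if "n \<in> N" for n
  proof -
    have "n \<in> M" "n \<in> carrier G" using that NM Mc by auto
    then show ?thesis using \<chi>I[of n 0] by simp
  qed
  moreover have "\<chi> e = 1"
  proof -
    have "e \<otimes> e [^] (- (1::int)) = e [^] ((1::int) + - 1)" using e(1) by (subst int_pow_mult) simp_all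
    also have "\<dots> = \<one>" using e(1) by (simp only: add.right_inverse int_pow_0)
    finally have "e \<otimes> e [^] (- (1::int)) \<in> M" using subgroup.one_closed[OF Ms] by simp
    then show ?thesis using \<chi>I[OF e(1), of 1] p1 by simp
  qed
  ultimately show thesis using that by blast
qed

lemma residue_ring_simps:
  "carrier (residue_ring m) = {0..m - 1}" "\<zero>\<^bsub>residue_ring m\<^esub> = 0" "\<one>\<^bsub>residue_ring m\<^esub> = 1"
  "x \<oplus>\<^bsub>residue_ring m\<^esub> y = (x + y) mod m" "x \<otimes>\<^bsub>residue_ring m\<^esub> y = (x * y) mod m"
  by (simp_all add: residue_ring_def)

lemma prime_residue_ring:
  assumes "Factorial_Ring.prime (p::nat)"
  shows "field (residue_ring (int p))" "group (add_monoid (residue_ring (int p)))"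
proof -
  interpret residues_prime p "residue_ring (int p)"
    using assms by (intro residues_prime.intro) simp_all
  show "field (residue_ring (int p))" by (rule is_field)
  show "group (add_monoid (residue_ring (int p)))" by (rule a_group)
qed

text \<open>A character that takes the value \<open>1\<close> at an element \<open>e\<close> splits the group into its kernel and the
  powers of \<open>e\<close>; induction on the order applies to the kernel.\<close>

lemma elementary_abelian_iso_vector_group:
  assumes p: "Factorial_Ring.prime (p::nat)"
  shows "comm_group E \<Longrightarrow> finite (carrier E) \<Longrightarrow> (\<And>w. w \<in> carrier E \<Longrightarrow> w [^]\<^bsub>E\<^esub> p = \<one>\<^bsub>E\<^esub>) \<Longrightarrow>
    \<exists>d::nat. E \<cong> product_group {..<d} (\<lambda>_. add_monoid (residue_ring (int p)))"
proof (induction "card (carrier E)" arbitrary: E rule: less_induct)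
  case less
  interpret E: comm_group E by (rule less.prems(1))
  let ?K = "residue_ring (int p)" and ?A = "add_monoid (residue_ring (int p))"
  interpret K: field ?K by (rule prime_residue_ring(1)[OF p])
  let ?V = "\<lambda>d. product_group {..<d} (\<lambda>_::nat. ?A)"
  have V: "group (?V d)" for d by (rule product_group) (rule K.a_group)
  show ?case
  proof (cases "carrier E = {\<one>\<^bsub>E\<^esub>}")
    case True
    have "(\<lambda>_. \<one>\<^bsub>?V 0\<^esub>) \<in> iso E (?V 0)"
    proof (rule isoI)
      show "(\<lambda>_. \<one>\<^bsub>?V 0\<^esub>) \<in> hom E (?V 0)" by (rule trivial_hom[OF V])
      show "bij_betw (\<lambda>_. \<one>\<^bsub>?V 0\<^esub>) (carrier E) (carrier (?V 0))"
        unfolding True by (simp add: bij_betw_def restrict_def)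
    qed
    from is_isoI[OF this] show ?thesis by (rule exI[of _ 0])
  next
    case False
    then obtain e where e: "e \<in> carrier E" "e \<noteq> \<one>\<^bsub>E\<^esub>" using E.one_closed by blast
    obtain \<chi> where \<chi>: "\<chi> \<in> hom E ?A" "\<chi> e = 1"
      using E.separating_character[OF p less.prems(3) E.triv_subgroup e(1)] e(2) by blast
    have \<chi>c: "\<chi> w \<in> {0..int p - 1}" if "w \<in> carrier E" for w
      using hom_in_carrier[OF \<chi>(1) that] by (simp add: residue_ring_simps)
    have \<chi>m: "\<chi> (v \<otimes>\<^bsub>E\<^esub> w) = (\<chi> v + \<chi> w) mod int p" if "v \<in> carrier E" "w \<in> carrier E" for v w
      using hom_mult[OF \<chi>(1) that] by (simp add: residue_ring_simps)
    have p1: "p > 1" using p by (rule prime_gt_1_nat)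
    have \<chi>1: "\<chi> \<one>\<^bsub>E\<^esub> = 0" using hom_one[OF \<chi>(1) E.is_group K.a_group] by (simp add: residue_ring_simps)
    have \<chi>h: "group_hom E ?A \<chi>"
      using \<chi>(1) E.is_group K.a_group by (simp add: group_hom_def group_hom_axioms_def)
    have \<chi>n: "\<chi> (e [^]\<^bsub>E\<^esub> (n::nat)) = int n mod int p" for n
    proof (induction n)
      case 0
      show ?case by (simp add: \<chi>1)
    next
      case (Suc n)
      have "\<chi> (e [^]\<^bsub>E\<^esub> Suc n) = (\<chi> (e [^]\<^bsub>E\<^esub> n) + \<chi> e) mod int p"
        using \<chi>m[of "e [^]\<^bsub>E\<^esub> n" e] e(1) by simp
      then show ?case using Suc \<chi>(2) by (simp add: mod_simps add.commute)
    qed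
    define M where "M = kernel E ?A \<chi>"
    have Ms: "subgroup M E" unfolding M_def by (rule group_hom.subgroup_kernel[OF \<chi>h])
    have Mker: "w \<in> M \<longleftrightarrow> w \<in> carrier E \<and> \<chi> w = 0" for w
      by (auto simp: M_def kernel_def residue_ring_simps)
    let ?M = "E\<lparr>carrier := M\<rparr>"
    have "M \<subset> carrier E" using subgroup.subset[OF Ms] e(1) \<chi>(2) Mker[of e] by auto
    then have "card (carrier ?M) < card (carrier E)" using less.prems(2) by (simp add: psubset_card_mono)
    moreover have "comm_group ?M"
      by (rule group.group_comm_groupI[OF subgroup.subgroup_is_group[OF Ms E.is_group]])
        (use Mker in \<open>auto simp: E.m_comm\<close>)
    moreover have "finite (carrier ?M)" using subgroup.subset[OF Ms] less.prems(2) finite_subset by auto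
    moreover have "w [^]\<^bsub>?M\<^esub> p = \<one>\<^bsub>?M\<^esub>" if "w \<in> carrier ?M" for w
      using that less.prems(3)[of w] Mker by (simp add: nat_pow_def)
    ultimately obtain d where "?M \<cong> ?V d" using less.hyps by blast
    then obtain f where f: "f \<in> iso ?M (?V d)" unfolding is_iso_def by (auto simp del: carrier_product_group)
    have f_hom: "f (v \<otimes>\<^bsub>E\<^esub> w) = f v \<otimes>\<^bsub>?V d\<^esub> f w" if "v \<in> M" "w \<in> M" for v w
      using f that by (auto simp: iso_def hom_def)
    have f_bij: "bij_betw f M (carrier (?V d))" using f by (simp add: iso_def)
    have fc: "f w \<in> carrier (?V d)" if "w \<in> M" for w using f_bij that by (auto simp: bij_betw_def)
    \<comment> \<open>The component of an element in the kernel of the character.\<close>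
    define \<pi> where "\<pi> w = w \<otimes>\<^bsub>E\<^esub> e [^]\<^bsub>E\<^esub> (- \<chi> w)" for w
    have e_inv: "e [^]\<^bsub>E\<^esub> (k::int) = e [^]\<^bsub>E\<^esub> (l::int)" if "k mod int p = l mod int p" for k l
    proof -
      have "int p dvd k - l" using that by (simp add: mod_eq_dvd_iff)
      then obtain u where "k - l = int p * u" by (auto elim: dvdE)
      then have k: "k = int p * u + l" by simp
      show ?thesis
        unfolding k using e(1) less.prems(3)[OF e(1)]
        by (simp add: E.int_pow_mult E.int_pow_pow[symmetric] int_pow_int)
    qed
    have \<chi>i: "\<chi> (e [^]\<^bsub>E\<^esub> (k::int)) = k mod int p" for k
    proof -
      have "e [^]\<^bsub>E\<^esub> k = e [^]\<^bsub>E\<^esub> (int (nat (k mod int p)))" using p1 by (intro e_inv) simp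
      then show ?thesis using \<chi>n[of "nat (k mod int p)"] p1 by (simp add: int_pow_int)
    qed
    have \<pi>M: "\<pi> w \<in> M" if "w \<in> carrier E" for w
      unfolding Mker \<pi>_def using that e(1) by (simp add: \<chi>m \<chi>i mod_simps)
    have \<pi>m: "\<pi> (v \<otimes>\<^bsub>E\<^esub> w) = \<pi> v \<otimes>\<^bsub>E\<^esub> \<pi> w" if vw: "v \<in> carrier E" "w \<in> carrier E" for v w
    proof -
      have "e [^]\<^bsub>E\<^esub> (- \<chi> (v \<otimes>\<^bsub>E\<^esub> w)) = e [^]\<^bsub>E\<^esub> (- \<chi> v + - \<chi> w)"
        by (rule e_inv) (simp add: \<chi>m[OF vw] mod_simps)
      also have "\<dots> = e [^]\<^bsub>E\<^esub> (- \<chi> v) \<otimes>\<^bsub>E\<^esub> e [^]\<^bsub>E\<^esub> (- \<chi> w)" by (rule E.int_pow_mult[OF e(1)])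
      finally show ?thesis unfolding \<pi>_def using vw e(1) by (simp add: E.m_ac)
    qed
    define F where "F w = (\<lambda>i\<in>{..<Suc d}. if i < d then f (\<pi> w) i else \<chi> w)" for w
    have Fc: "F w \<in> carrier (?V (Suc d))" if "w \<in> carrier E" for w
      using fc[OF \<pi>M[OF that]] \<chi>c[OF that] by (auto simp: F_def residue_ring_simps PiE_iff)
    have F_eq: "f (\<pi> w) = restrict (F w) {..<d}" "\<chi> w = F w d" if "w \<in> carrier E" for w
      using fc[OF \<pi>M[OF that]] by (auto simp: F_def PiE_iff extensional_def fun_eq_iff)
    have "F \<in> iso E (?V (Suc d))"
    proof (rule isoI)
      show "F \<in> hom E (?V (Suc d))"
      proof (rule homI[OF Fc])
        fix v w assume vw: "v \<in> carrier E" "w \<in> carrier E"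
        show "F (v \<otimes>\<^bsub>E\<^esub> w) = F v \<otimes>\<^bsub>?V (Suc d)\<^esub> F w"
          using f_hom[OF \<pi>M[OF vw(1)] \<pi>M[OF vw(2)]] \<pi>m[OF vw] hom_mult[OF \<chi>(1) vw]
          by (auto simp: F_def fun_eq_iff)
      qed
      show "bij_betw F (carrier E) (carrier (?V (Suc d)))"
      proof (rule bij_betw_imageI)
        show "inj_on F (carrier E)"
        proof (rule inj_onI)
          fix v w assume vw: "v \<in> carrier E" "w \<in> carrier E" and eq: "F v = F w"
          have "f (\<pi> v) = f (\<pi> w)" unfolding F_eq(1)[OF vw(1)] F_eq(1)[OF vw(2)] eq ..
          then have "\<pi> v = \<pi> w" using f_bij \<pi>M vw by (auto simp: bij_betw_def dest: inj_onD)
          moreover have "\<chi> v = \<chi> w" unfolding F_eq(2)[OF vw(1)] F_eq(2)[OF vw(2)] eq ..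
          ultimately show "v = w" unfolding \<pi>_def using vw e(1) by simp
        qed
        show "F ` carrier E = carrier (?V (Suc d))"
        proof (intro subset_antisym subsetI)
          fix v assume v: "v \<in> carrier (?V (Suc d))"
          have "restrict v {..<d} \<in> carrier (?V d)" using v by (auto simp: PiE_iff)
          then have "restrict v {..<d} \<in> f ` M" unfolding bij_betw_imp_surj_on[OF f_bij] .
          then obtain m where m: "m \<in> M" "f m = restrict v {..<d}" by force
          have mc: "m \<in> carrier E" "\<chi> m = 0" using m Mker by auto
          have vd: "v d \<in> {0..int p - 1}" using v by (auto simp: PiE_iff residue_ring_simps)
          define w where "w = m \<otimes>\<^bsub>E\<^esub> e [^]\<^bsub>E\<^esub> (v d)"
          have wc: "w \<in> carrier E" using mc e(1) by (simp add: w_def)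
          have \<chi>w: "\<chi> w = v d" unfolding w_def using mc e(1) vd by (simp add: \<chi>m \<chi>i)
          have "\<pi> w = m" unfolding \<pi>_def \<chi>w unfolding w_def
            using mc e(1) by (simp add: E.m_assoc E.int_pow_mult[symmetric])
          then have "F w = v"
            using m(2) \<chi>w v by (auto simp: F_def fun_eq_iff PiE_iff extensional_def restrict_def less_Suc_eq)
          then show "v \<in> F ` carrier E" using wc by blast
        qed (use Fc in auto)
      qed
    qed
    from is_isoI[OF this] show ?thesis by (rule exI[of _ "Suc d"])
  qed
qed

section \<open>Additive automata over a prime field\<close>

locale prime_group_ring = group_ring_data G "residue_ring (int p)"
  for G :: "('g, 'm) monoid_scheme" and p :: nat +
  assumes p: "Factorial_Ring.prime p"
begin

abbreviation "K \<equiv> residue_ring (int p)"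

sublocale K: field K
  by (rule prime_residue_ring(1)[OF p])

lemma p1: "int p > 1"
  using prime_gt_1_nat[OF p] by simp

text \<open>Row vectors over the group ring. They are dual to configurations: a configuration is an arbitrary
  function and a row a finitely supported one.\<close>

abbreviation rows :: "nat \<Rightarrow> (nat \<Rightarrow> 'g \<Rightarrow> int) monoid" where
  "rows d \<equiv> product_group {..<d} (\<lambda>_. add_monoid GR)"

lemma comm_group_rows: "comm_group (rows d)"
proof -
  interpret GR: abelian_group GR by (rule abelian_group_group_ring)
  have "group (rows d)" by (rule product_group) (rule GR.a_group)
  then show ?thesis
    by (rule group.group_comm_groupI) (auto simp: PiE_iff GR.a_comm)
qed

lemma row_coeff_closed: "r \<in> carrier (rows d) \<Longrightarrow> k < d \<Longrightarrow> g \<in> carrier G \<Longrightarrow> r k g \<in> carrier K"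
  by (auto simp: PiE_iff)

lemma row_mult_apply:
  "k < d \<Longrightarrow> g \<in> carrier G \<Longrightarrow> (r \<otimes>\<^bsub>rows d\<^esub> s) k g = (r k g + s k g) mod int p"
  by (simp add: group_ring_add_apply residue_ring_simps)

lemma row_one_apply: "k < d \<Longrightarrow> g \<in> carrier G \<Longrightarrow> \<one>\<^bsub>rows d\<^esub> k g = 0"
  by (simp add: group_ring_zero_apply residue_ring_simps)

lemma row_eqI:
  assumes "r \<in> carrier (rows d)" "s \<in> carrier (rows d)"
    and eq: "\<And>k g. k < d \<Longrightarrow> g \<in> carrier G \<Longrightarrow> r k g = s k g"
  shows "r = s"
proof (rule PiE_ext[of r "{..<d}" "\<lambda>_. carrier GR" s])
  fix k assume k: "k \<in> {..<d}"
  show "r k = s k"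
    by (rule group_ring_eqI) (use assms k in \<open>auto simp: PiE_iff\<close>)
qed (use assms in auto)

lemma row_carrierI:
  assumes "finite W" "\<And>k g. k < d \<Longrightarrow> g \<in> carrier G \<Longrightarrow> F k g \<in> carrier K"
    and "\<And>k g. k < d \<Longrightarrow> g \<in> carrier G \<Longrightarrow> g \<notin> W \<Longrightarrow> F k g = 0"
  shows "(\<lambda>k\<in>{..<d}. \<lambda>g\<in>carrier G. F k g) \<in> carrier (rows d)"
proof -
  have "(\<lambda>g\<in>carrier G. F k g) \<in> carrier GR" if "k < d" for k
  proof -
    have "{g \<in> carrier G. (\<lambda>g\<in>carrier G. F k g) g \<noteq> \<zero>\<^bsub>K\<^esub>} \<subseteq> W"
      using assms(3)[OF that] by (auto simp: residue_ring_simps)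
    then have "finite {g \<in> carrier G. (\<lambda>g\<in>carrier G. F k g) g \<noteq> \<zero>\<^bsub>K\<^esub>}"
      using assms(1) finite_subset by blast
    moreover have "(\<lambda>g\<in>carrier G. F k g) \<in> carrier G \<rightarrow>\<^sub>E carrier K"
      using assms(2)[OF that] by auto
    ultimately show ?thesis unfolding carrier_group_ring by (rule conjI[rotated])
  qed
  then show ?thesis by auto
qed

lemma row_exponent:
  assumes "r \<in> carrier (rows d)"
  shows "r [^]\<^bsub>rows d\<^esub> p = \<one>\<^bsub>rows d\<^esub>"
proof -
  interpret rows: comm_group "rows d" by (rule comm_group_rows)
  have pow: "(r [^]\<^bsub>rows d\<^esub> n) k g = (int n * r k g) mod int p" if "k < d" "g \<in> carrier G" for n k g
  proof (induction n)
    case 0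
    show ?case using row_one_apply[OF that] by simp
  next
    case (Suc n)
    then show ?case using row_mult_apply[OF that, of "r [^]\<^bsub>rows d\<^esub> n" r]
      by (simp add: mod_simps algebra_simps del: mult_product_group)
  qed
  show ?thesis
  proof (rule row_eqI[OF rows.nat_pow_closed[OF assms] rows.one_closed])
    show "(r [^]\<^bsub>rows d\<^esub> p) k g = \<one>\<^bsub>rows d\<^esub> k g" if "k < d" "g \<in> carrier G" for k g
      unfolding pow[OF that] row_one_apply[OF that] by simp
  qed
qed

definition unit_row :: "nat \<Rightarrow> nat \<Rightarrow> 'g \<Rightarrow> nat \<Rightarrow> 'g \<Rightarrow> int" where
  "unit_row d k h = (\<lambda>j\<in>{..<d}. \<lambda>g\<in>carrier G. if j = k \<and> g = h then 1 else 0)"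

lemma unit_row_closed: "unit_row d k h \<in> carrier (rows d)"
  unfolding unit_row_def by (rule row_carrierI[of "{h}"]) (use p1 in \<open>auto simp: residue_ring_simps\<close>)

text \<open>An additive map on rows is automatically linear over the prime field. Induction on the
  sum of all entries, taken as natural numbers below \<open>p\<close>, peels off one unit row at a time.\<close>

lemma row_functional_expansion:
  assumes \<chi>: "\<chi> \<in> hom (rows d) (add_monoid K)" and r: "r \<in> carrier (rows d)"
    and H: "finite H" "H \<subseteq> carrier G" "\<And>k g. k < d \<Longrightarrow> g \<in> carrier G \<Longrightarrow> g \<notin> H \<Longrightarrow> r k g = 0"
  shows "\<chi> r = (\<Oplus>\<^bsub>K\<^esub>q\<in>{..<d} \<times> H. r (fst q) (snd q) \<otimes>\<^bsub>K\<^esub> \<chi> (unit_row d (fst q) (snd q)))"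
  using r H(3)
proof (induction "\<Sum>q\<in>{..<d} \<times> H. nat (r (fst q) (snd q))" arbitrary: r)
  interpret rows: comm_group "rows d" by (rule comm_group_rows)
  have \<chi>u: "\<chi> (unit_row d k h) \<in> carrier K" for k h
    using hom_in_carrier[OF \<chi> unit_row_closed] by simp
  have fin: "finite ({..<d} \<times> H)" using H by simp
  {
    case 0
    have "r k g = 0" if "k < d" "g \<in> carrier G" for k g
    proof (cases "g \<in> H")
      case True
      then have "nat (r k g) = 0" using 0(1)[symmetric] fin that by (auto simp: sum_eq_0_iff)
      then show ?thesis using row_coeff_closed[OF 0(2) that] by (auto simp: residue_ring_simps)
    qed (use 0 that in auto)
    note zero = this
    have "r = \<one>\<^bsub>rows d\<^esub>"
      by (rule row_eqI[OF 0(2) rows.one_closed]) (simp only: zero row_one_apply)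
    then have "\<chi> r = \<zero>\<^bsub>K\<^esub>" using hom_one[OF \<chi> rows.is_group R.a_group] by simp
    moreover have "(\<Oplus>\<^bsub>K\<^esub>q\<in>{..<d} \<times> H. r (fst q) (snd q) \<otimes>\<^bsub>K\<^esub> \<chi> (unit_row d (fst q) (snd q))) = \<zero>\<^bsub>K\<^esub>"
    proof (rule R.finsum_zero_eqI)
      fix q assume q: "q \<in> {..<d} \<times> H"
      then have "r (fst q) (snd q) = \<zero>\<^bsub>K\<^esub>" using zero[of "fst q" "snd q"] H(2) by (auto simp: residue_ring_simps)
      then show "r (fst q) (snd q) \<otimes>\<^bsub>K\<^esub> \<chi> (unit_row d (fst q) (snd q)) = \<zero>\<^bsub>K\<^esub>" using \<chi>u by simp
    qed
    ultimately show ?case by simp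
  next
    case (Suc n)
    have rc: "r k g \<in> {0..int p - 1}" if "k < d" "g \<in> carrier G" for k g
      using row_coeff_closed[OF Suc(3) that] by (simp add: residue_ring_simps)
    have "\<exists>q\<in>{..<d} \<times> H. nat (r (fst q) (snd q)) \<noteq> 0"
      using Suc(2) by (metis (no_types, lifting) Zero_not_Suc sum.neutral)
    then obtain k h where kh: "k < d" "h \<in> H" "r k h > 0" by auto
    have hc: "h \<in> carrier G" using kh H by auto
    define s where "s = (\<lambda>j\<in>{..<d}. \<lambda>g\<in>carrier G. if j = k \<and> g = h then r k h - 1 else r j g)"
    have s: "s \<in> carrier (rows d)"
      unfolding s_def
      by (rule row_carrierI[OF H(1)]) (use rc kh hc Suc(4) in \<open>fastforce simp: residue_ring_simps\<close>)+
    have s_apply: "s j g = (if j = k \<and> g = h then r k h - 1 else r j g)" if "j < d" "g \<in> carrier G" for j g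
      using that by (simp add: s_def)
    have rs: "r = s \<otimes>\<^bsub>rows d\<^esub> unit_row d k h"
    proof (rule row_eqI[OF Suc(3) rows.m_closed[OF s unit_row_closed]])
      fix j g assume *: "j < d" "g \<in> carrier G"
      show "r j g = (s \<otimes>\<^bsub>rows d\<^esub> unit_row d k h) j g"
        unfolding row_mult_apply[OF *] s_apply[OF *] using * rc[OF *] by (auto simp: unit_row_def)
    qed
    have "(\<Sum>q\<in>{..<d} \<times> H. nat (r (fst q) (snd q)))
        = nat (r k h) + (\<Sum>q\<in>{..<d} \<times> H - {(k, h)}. nat (r (fst q) (snd q)))"
      using kh fin by (subst sum.remove[of _ "(k, h)"]) auto
    moreover have "(\<Sum>q\<in>{..<d} \<times> H. nat (s (fst q) (snd q)))
        = nat (s k h) + (\<Sum>q\<in>{..<d} \<times> H - {(k, h)}. nat (s (fst q) (snd q)))"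
      using kh fin by (subst sum.remove[of _ "(k, h)"]) auto
    moreover have "(\<Sum>q\<in>{..<d} \<times> H - {(k, h)}. nat (s (fst q) (snd q)))
        = (\<Sum>q\<in>{..<d} \<times> H - {(k, h)}. nat (r (fst q) (snd q)))"
    proof (rule sum.cong)
      fix q assume "q \<in> {..<d} \<times> H - {(k, h)}"
      then show "nat (s (fst q) (snd q)) = nat (r (fst q) (snd q))"
        using s_apply[of "fst q" "snd q"] H(2) by (cases q) auto
    qed simp
    ultimately have "n = (\<Sum>q\<in>{..<d} \<times> H. nat (s (fst q) (snd q)))"
      using Suc(2) kh s_apply[OF kh(1) hc] by simp
    moreover have "s j g = 0" if "j < d" "g \<in> carrier G" "g \<notin> H" for j g
      using that s_apply[OF that(1,2)] Suc(4)[OF that] kh by auto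
    ultimately have IH: "\<chi> s = (\<Oplus>\<^bsub>K\<^esub>q\<in>{..<d} \<times> H. s (fst q) (snd q) \<otimes>\<^bsub>K\<^esub> \<chi> (unit_row d (fst q) (snd q)))"
      using Suc(1) s by blast
    let ?u = "\<lambda>q. \<chi> (unit_row d (fst q) (snd q))"
    have sc: "s (fst q) (snd q) \<in> carrier K" if "q \<in> {..<d} \<times> H" for q
      using row_coeff_closed[OF s, of "fst q" "snd q"] that H(2) by auto
    have "\<chi> r = \<chi> s \<oplus>\<^bsub>K\<^esub> \<chi> (unit_row d k h)"
      unfolding rs using hom_mult[OF \<chi> s unit_row_closed] by simp
    also have "\<chi> (unit_row d k h) = (\<Oplus>\<^bsub>K\<^esub>q\<in>{..<d} \<times> H. if (k, h) = q then ?u q else \<zero>\<^bsub>K\<^esub>)"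
    proof -
      have "?u \<in> {..<d} \<times> H \<rightarrow> carrier K" using \<chi>u by blast
      then show ?thesis using R.finsum_singleton[of "(k, h)" "{..<d} \<times> H" ?u] kh fin by simp
    qed
    also have "\<chi> s \<oplus>\<^bsub>K\<^esub> \<dots> = (\<Oplus>\<^bsub>K\<^esub>q\<in>{..<d} \<times> H. s (fst q) (snd q) \<otimes>\<^bsub>K\<^esub> ?u q \<oplus>\<^bsub>K\<^esub>
        (if (k, h) = q then ?u q else \<zero>\<^bsub>K\<^esub>))"
      unfolding IH by (rule R.finsum_addf[symmetric]) (use sc \<chi>u in \<open>auto intro!: R.m_closed\<close>)
    also have "\<dots> = (\<Oplus>\<^bsub>K\<^esub>q\<in>{..<d} \<times> H. r (fst q) (snd q) \<otimes>\<^bsub>K\<^esub> ?u q)"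
    proof (rule R.finsum_cong')
      fix q assume q: "q \<in> {..<d} \<times> H"
      then have q': "fst q < d" "snd q \<in> carrier G" using H(2) by auto
      have "r (fst q) (snd q) = s (fst q) (snd q) \<oplus>\<^bsub>K\<^esub> (if (k, h) = q then \<one>\<^bsub>K\<^esub> else \<zero>\<^bsub>K\<^esub>)"
        using s_apply[OF q'] rc[OF q'] kh by (cases q) (auto simp: residue_ring_simps)
      then show "s (fst q) (snd q) \<otimes>\<^bsub>K\<^esub> ?u q \<oplus>\<^bsub>K\<^esub> (if (k, h) = q then ?u q else \<zero>\<^bsub>K\<^esub>)
          = r (fst q) (snd q) \<otimes>\<^bsub>K\<^esub> ?u q"
        using sc[OF q] \<chi>u[of "fst q" "snd q"] by (auto simp: R.l_distr)
    qed (use \<chi>u row_coeff_closed[OF Suc(3)] H(2) in \<open>auto intro!: R.m_closed\<close>)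
    finally show ?case .
  }
qed

text \<open>The value of \<open>f x\<close> at the identity depends only on \<open>x\<close> inside a finite window, where \<open>x\<close> can be
  replaced by a row; the entries of the matrix are the values of this functional at the unit rows.
  Equivariance takes care of the other places.\<close>

lemma additive_cellular_automaton_is_matrix_action:
  assumes f: "additive_cellular_automaton G (vec d) f"
  obtains M where "M \<in> carrier (matrix_ring d GR)" "\<And>x. x \<in> configs d \<Longrightarrow> f x = matrix_action d M x"
proof -
  let ?P = "product_group (carrier G) (\<lambda>_. vec d)"
  interpret V: comm_group "vec d" by (rule comm_group_vec)
  interpret P: group ?P by (rule product_group) (rule V.is_group)
  have Pc: "carrier ?P = configs d" by simp
  have hom: "f \<in> hom ?P ?P"
    and equi: "\<And>\<gamma> x. \<gamma> \<in> carrier G \<Longrightarrow> x \<in> configs d \<Longrightarrow> f (shift G \<gamma> x) = shift G \<gamma> (f x)"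
    using f unfolding G.additive_cellular_automaton_iff[OF comm_group_vec] by auto
  have "\<exists>W. finite W \<and> W \<subseteq> carrier G \<and> (\<forall>x\<in>carrier G \<rightarrow>\<^sub>E carrier (vec d).
      (\<forall>w\<in>W. x w = \<one>\<^bsub>vec d\<^esub>) \<longrightarrow> f x \<one>\<^bsub>G\<^esub> = \<one>\<^bsub>vec d\<^esub>)"
    using f unfolding G.additive_cellular_automaton_iff[OF comm_group_vec] by (elim conjE)
  then obtain W where W: "finite W" "W \<subseteq> carrier G" and
      W0: "\<And>x. x \<in> configs d \<Longrightarrow> \<forall>w\<in>W. x w = \<one>\<^bsub>vec d\<^esub> \<Longrightarrow> f x \<one>\<^bsub>G\<^esub> = \<one>\<^bsub>vec d\<^esub>"
    unfolding carrier_product_group by (elim exE conjE) (rule that, auto)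
  have fc: "f x \<in> configs d" if "x \<in> configs d" for x
    using hom_in_carrier[OF hom] that unfolding Pc by blast
  have sum: "(x \<otimes>\<^bsub>?P\<^esub> y) g k = x g k \<oplus>\<^bsub>K\<^esub> y g k" if "g \<in> carrier G" "k < d" for x y g k
    using that by simp
  define flip where "flip r = (\<lambda>g\<in>carrier G. \<lambda>k\<in>{..<d}. r k g)" for r :: "nat \<Rightarrow> 'g \<Rightarrow> int"
  have flip_apply: "flip r g k = r k g" if "g \<in> carrier G" "k < d" for r g k
    using that by (simp add: flip_def)
  have flipc: "flip r \<in> configs d" if "r \<in> carrier (rows d)" for r
    using row_coeff_closed[OF that] by (auto simp: flip_def)
  define \<psi> where "\<psi> i r = f (flip r) \<one>\<^bsub>G\<^esub> i" for i r
  have \<psi>: "\<psi> i \<in> hom (rows d) (add_monoid K)" if i: "i < d" for i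
  proof (rule homI)
    show "\<psi> i r \<in> carrier (add_monoid K)" if "r \<in> carrier (rows d)" for r
      using config_coeff_closed[OF fc[OF flipc[OF that]] G.one_closed i] by (simp add: \<psi>_def)
    fix r s assume r: "r \<in> carrier (rows d)" and s: "s \<in> carrier (rows d)"
    have "flip (r \<otimes>\<^bsub>rows d\<^esub> s) = flip r \<otimes>\<^bsub>?P\<^esub> flip s"
    proof (rule config_eqI)
      show "flip (r \<otimes>\<^bsub>rows d\<^esub> s) \<in> configs d"
        by (rule flipc) (rule monoid.m_closed[OF group.is_monoid[OF comm_group.axioms(2)[OF comm_group_rows]] r s])
      show "flip r \<otimes>\<^bsub>?P\<^esub> flip s \<in> configs d"
        using P.m_closed[of "flip r" "flip s"] flipc[OF r] flipc[OF s] unfolding Pc by blast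
      show "flip (r \<otimes>\<^bsub>rows d\<^esub> s) g k = (flip r \<otimes>\<^bsub>?P\<^esub> flip s) g k" if "g \<in> carrier G" "k < d" for g k
        unfolding sum[OF that] flip_apply[OF that] row_mult_apply[OF that(2,1)] residue_ring_simps(4) ..
    qed
    then have "f (flip (r \<otimes>\<^bsub>rows d\<^esub> s)) = f (flip r) \<otimes>\<^bsub>?P\<^esub> f (flip s)"
      using hom_mult[OF hom] flipc[OF r] flipc[OF s] unfolding Pc by simp
    then show "\<psi> i (r \<otimes>\<^bsub>rows d\<^esub> s) = \<psi> i r \<otimes>\<^bsub>add_monoid K\<^esub> \<psi> i s"
      unfolding \<psi>_def using sum[OF G.one_closed i] by simp
  qed
  define M where "M = (\<lambda>(i, k)\<in>{..<d} \<times> {..<d}. \<lambda>h\<in>carrier G. \<psi> i (unit_row d k h))"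
  have M_apply: "M (i, k) h = \<psi> i (unit_row d k h)" if "i < d" "k < d" "h \<in> carrier G" for i k h
    using that by (simp add: M_def)
  have M: "M \<in> carrier (matrix_ring d GR)"
    unfolding M_def
  proof (rule matrix_carrierI[OF W(1)])
    show "\<psi> i (unit_row d k g) \<in> carrier K" if "i < d" for i k g
      using hom_in_carrier[OF \<psi>[OF that] unit_row_closed] by simp
    fix i k g assume *: "i < d" "k < d" "g \<in> carrier G" "g \<notin> W"
    have "flip (unit_row d k g) w = \<one>\<^bsub>vec d\<^esub>" if "w \<in> W" for w
      using that W(2) *(4) by (auto simp: flip_def unit_row_def residue_ring_simps)
    then have "f (flip (unit_row d k g)) \<one>\<^bsub>G\<^esub> = \<one>\<^bsub>vec d\<^esub>"
      by (intro W0[OF flipc[OF unit_row_closed]]) blast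
    then show "\<psi> i (unit_row d k g) = \<zero>\<^bsub>K\<^esub>" using *(1) by (simp add: \<psi>_def)
  qed
  have at_one: "f x \<one>\<^bsub>G\<^esub> i = matrix_action d M x \<one>\<^bsub>G\<^esub> i" if x: "x \<in> configs d" and i: "i < d" for x i
  proof -
    define H where "H = W \<union> matrix_support d M"
    have H: "finite H" "H \<subseteq> carrier G" "matrix_support d M \<subseteq> H"
      using W finite_matrix_support[OF M] matrix_support_subset by (auto simp: H_def)
    define r where "r = (\<lambda>k\<in>{..<d}. \<lambda>g\<in>carrier G. if g \<in> H then x g k else 0)"
    have r_apply: "r k g = (if g \<in> H then x g k else 0)" if "k < d" "g \<in> carrier G" for k g
      using that by (simp add: r_def)
    have r: "r \<in> carrier (rows d)"
      unfolding r_def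
    proof (rule row_carrierI[OF H(1)])
      show "(if g \<in> H then x g k else 0) \<in> carrier K" if "k < d" "g \<in> carrier G" for k g
        using config_coeff_closed[OF x that(2,1)] p1 by (auto simp: residue_ring_simps)
    qed auto
    have xP: "x \<in> carrier ?P" and rP: "flip r \<in> carrier ?P" using x flipc[OF r] unfolding Pc by auto
    define y where "y = inv\<^bsub>?P\<^esub> (flip r) \<otimes>\<^bsub>?P\<^esub> x"
    have y: "y \<in> carrier ?P" unfolding y_def using xP rP by blast
    have xy: "x = flip r \<otimes>\<^bsub>?P\<^esub> y"
      unfolding y_def using xP rP P.m_assoc[of "flip r" "inv\<^bsub>?P\<^esub> (flip r)" x] P.r_inv[OF rP] P.l_one[OF xP]
        P.inv_closed[OF rP] by metis
    have "y w = \<one>\<^bsub>vec d\<^esub>" if w: "w \<in> W" for w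
    proof -
      have wc: "w \<in> carrier G" "w \<in> H" using w W(2) by (auto simp: H_def)
      have flip_w: "flip r w = x w"
      proof (rule PiE_ext[of _ "{..<d}" "\<lambda>_. carrier K"])
        show "flip r w \<in> {..<d} \<rightarrow>\<^sub>E carrier K" "x w \<in> {..<d} \<rightarrow>\<^sub>E carrier K"
          using flipc[OF r] x wc(1) by (auto simp: PiE_iff)
        show "flip r w k = x w k" if "k \<in> {..<d}" for k
          using flip_apply[of w k r] r_apply[of k w] wc that by simp
      qed
      have "x w = flip r w \<otimes>\<^bsub>vec d\<^esub> y w"
        using arg_cong[OF xy, of "\<lambda>z. z w"] wc(1) by (simp add: mult_product_group[of "carrier G"] del: mult_product_group)
      then have "x w = x w \<otimes>\<^bsub>vec d\<^esub> y w" unfolding flip_w .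
      moreover have "x w \<in> carrier (vec d)" "y w \<in> carrier (vec d)"
        using PiE_mem[OF x wc(1)] PiE_mem[OF y[unfolded Pc] wc(1)] unfolding carrier_product_group by simp_all
      ultimately show ?thesis using V.l_cancel_one' by blast
    qed
    then have y0: "f y \<one>\<^bsub>G\<^esub> = \<one>\<^bsub>vec d\<^esub>" using W0[of y] y unfolding Pc by blast
    have "f x = f (flip r) \<otimes>\<^bsub>?P\<^esub> f y" using hom_mult[OF hom rP y] xy by simp
    then have "f x \<one>\<^bsub>G\<^esub> i = f (flip r) \<one>\<^bsub>G\<^esub> i \<oplus>\<^bsub>K\<^esub> f y \<one>\<^bsub>G\<^esub> i" using sum[OF G.one_closed i] by simp
    also have "f y \<one>\<^bsub>G\<^esub> i = \<zero>\<^bsub>K\<^esub>" unfolding y0 using i by simp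
    also have "f (flip r) \<one>\<^bsub>G\<^esub> i \<oplus>\<^bsub>K\<^esub> \<zero>\<^bsub>K\<^esub> = \<psi> i r"
      using config_coeff_closed[OF fc[OF flipc[OF r]] G.one_closed i] by (simp add: \<psi>_def)
    also have "\<psi> i r = (\<Oplus>\<^bsub>K\<^esub>q\<in>{..<d} \<times> H. r (fst q) (snd q) \<otimes>\<^bsub>K\<^esub> \<psi> i (unit_row d (fst q) (snd q)))"
      by (rule row_functional_expansion[OF \<psi>[OF i] r H(1,2)]) (simp add: r_apply)
    also have "\<dots> = (\<Oplus>\<^bsub>K\<^esub>q\<in>{..<d} \<times> H. M (i, fst q) (snd q) \<otimes>\<^bsub>K\<^esub> x (\<one>\<^bsub>G\<^esub> \<otimes>\<^bsub>G\<^esub> snd q) (fst q))"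
    proof (rule R.finsum_cong')
      fix q assume "q \<in> {..<d} \<times> H"
      then have q: "fst q < d" "snd q \<in> H" "snd q \<in> carrier G" using H(2) by auto
      show "r (fst q) (snd q) \<otimes>\<^bsub>K\<^esub> \<psi> i (unit_row d (fst q) (snd q))
          = M (i, fst q) (snd q) \<otimes>\<^bsub>K\<^esub> x (\<one>\<^bsub>G\<^esub> \<otimes>\<^bsub>G\<^esub> snd q) (fst q)"
        unfolding r_apply[OF q(1,3)] M_apply[OF i q(1,3), symmetric]
        using q K.m_comm[OF config_coeff_closed[OF x q(3,1)] matrix_coeff_closed[OF M i q(1,3)]] by simp
    qed (use H(2) M i x in \<open>auto intro!: R.m_closed\<close>)
    also have "\<dots> = matrix_action d M x \<one>\<^bsub>G\<^esub> i"
      by (rule matrix_action_apply[symmetric]) (use M x i H in auto)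
    finally show ?thesis .
  qed
  have "f x = matrix_action d M x" if x: "x \<in> configs d" for x
  proof (rule config_eqI[OF fc[OF x] matrix_action_closed[OF M x]])
    fix g i assume g: "g \<in> carrier G" and i: "i < d"
    let ?y = "shift G (inv\<^bsub>G\<^esub> g) x"
    have gi: "inv\<^bsub>G\<^esub> g \<in> carrier G" using g by simp
    have y: "?y \<in> configs d" by (rule G.shift_in_config[OF gi x])
    have "\<forall>\<gamma>\<in>carrier G. \<forall>x\<in>carrier G \<rightarrow>\<^sub>E carrier (vec d).
        matrix_action d M (shift G \<gamma> x) = shift G \<gamma> (matrix_action d M x)"
      using additive_cellular_automaton_matrix_action[OF M]
      unfolding G.additive_cellular_automaton_iff[OF comm_group_vec] by (elim conjE)
    moreover have "x \<in> carrier G \<rightarrow>\<^sub>E carrier (vec d)" using x by simp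
    ultimately have "matrix_action d M ?y = shift G (inv\<^bsub>G\<^esub> g) (matrix_action d M x)"
      using gi by (blast dest: bspec)
    moreover have "f ?y = shift G (inv\<^bsub>G\<^esub> g) (f x)" by (rule equi[OF gi x])
    moreover have "shift G (inv\<^bsub>G\<^esub> g) z \<one>\<^bsub>G\<^esub> = z g" for z :: "'g \<Rightarrow> nat \<Rightarrow> int"
      using g by (simp add: shift_def)
    ultimately show "f x g i = matrix_action d M x g i" using at_one[OF y i] by simp
  qed
  then show thesis by (rule that[OF M])
qed

text \<open>The row space of \<open>M\<close> consists of the products of rows with \<open>M\<close>. Writing a row as the first row of a
  square matrix gives access to the multiplication of the matrix ring.\<close>

definition first_row :: "nat \<Rightarrow> (nat \<times> nat \<Rightarrow> 'g \<Rightarrow> int) \<Rightarrow> nat \<Rightarrow> 'g \<Rightarrow> int" where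
  "first_row d Z = (\<lambda>k\<in>{..<d}. Z (0, k))"

lemma first_row_apply: "k < d \<Longrightarrow> first_row d Z k = Z (0, k)"
  by (simp add: first_row_def)

lemma row_space_subgroup:
  assumes d: "d > 0" and M: "M \<in> carrier (matrix_ring d GR)"
  shows "subgroup ((\<lambda>Z. first_row d (Z \<otimes>\<^bsub>matrix_ring d GR\<^esub> M)) ` carrier (matrix_ring d GR)) (rows d)"
    (is "subgroup ?N _")
proof (rule group.subgroupI)
  interpret rows: comm_group "rows d" by (rule comm_group_rows)
  show "group (rows d)" by (rule rows.is_group)
  let ?R = "matrix_ring d GR"
  have mem: "first_row d Z \<in> carrier (rows d)" if "Z \<in> carrier ?R" for Z
    using matrix_entry_closed[OF that] d by (auto simp: first_row_def)
  show sub: "?N \<subseteq> carrier (rows d)" using mem matrix_mult_closed[OF _ M] by blast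
  show "?N \<noteq> {}" using matrix_one_closed by blast
  show closed: "r \<otimes>\<^bsub>rows d\<^esub> s \<in> ?N" if r: "r \<in> ?N" and s: "s \<in> ?N" for r s
  proof -
    obtain Z where Z: "Z \<in> carrier ?R" "r = first_row d (Z \<otimes>\<^bsub>?R\<^esub> M)" using r by blast
    obtain Y where Y: "Y \<in> carrier ?R" "s = first_row d (Y \<otimes>\<^bsub>?R\<^esub> M)" using s by blast
    define H where "H = matrix_support d Z \<union> matrix_support d Y"
    have H: "finite H" "H \<subseteq> carrier G"
      using finite_matrix_support[OF Z(1)] finite_matrix_support[OF Y(1)] matrix_support_subset by (auto simp: H_def)
    have supp: "matrix_support d Z \<subseteq> H" "matrix_support d Y \<subseteq> H" by (auto simp: H_def)
    define V where "V = (\<lambda>(i, k)\<in>{..<d} \<times> {..<d}. \<lambda>g\<in>carrier G. Z (i, k) g \<oplus>\<^bsub>K\<^esub> Y (i, k) g)"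
    have V_apply: "V (i, k) g = Z (i, k) g \<oplus>\<^bsub>K\<^esub> Y (i, k) g" if "i < d" "k < d" "g \<in> carrier G" for i k g
      using that by (simp add: V_def)
    have zero: "Z (i, k) g \<oplus>\<^bsub>K\<^esub> Y (i, k) g = \<zero>\<^bsub>K\<^esub>" if "i < d" "k < d" "g \<in> carrier G" "g \<notin> H" for i k g
    proof -
      have "Z (i, k) g = \<zero>\<^bsub>K\<^esub>" "Y (i, k) g = \<zero>\<^bsub>K\<^esub>"
        using that unfolding H_def matrix_support_def by blast+
      then show ?thesis by simp
    qed
    have V: "V \<in> carrier ?R"
      unfolding V_def by (rule matrix_carrierI[OF H(1)]) (use Z(1) Y(1) zero in \<open>auto intro!: R.a_closed\<close>)
    have V_supp: "matrix_support d V \<subseteq> H"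
      using zero V_apply unfolding matrix_support_def by fastforce
    have "r \<otimes>\<^bsub>rows d\<^esub> s = first_row d (V \<otimes>\<^bsub>?R\<^esub> M)"
    proof (rule row_eqI)
      show "r \<otimes>\<^bsub>rows d\<^esub> s \<in> carrier (rows d)" by (rule rows.m_closed) (use r s sub in auto)
      show "first_row d (V \<otimes>\<^bsub>?R\<^esub> M) \<in> carrier (rows d)" by (rule mem[OF matrix_mult_closed[OF V M]])
      fix k g assume kg: "k < d" "g \<in> carrier G"
      have cl: "Z (0, fst q) (snd q) \<in> carrier K" "Y (0, fst q) (snd q) \<in> carrier K"
          "M (fst q, k) (inv\<^bsub>G\<^esub> (snd q) \<otimes>\<^bsub>G\<^esub> g) \<in> carrier K" "fst q < d" "snd q \<in> carrier G"
        if "q \<in> {..<d} \<times> H" for q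
        using that Z(1) Y(1) M d kg H(2) by (auto simp: subset_iff)
      have "(V \<otimes>\<^bsub>?R\<^esub> M) (0, k) g
          = (\<Oplus>\<^bsub>K\<^esub>q\<in>{..<d} \<times> H. V (0, fst q) (snd q) \<otimes>\<^bsub>K\<^esub> M (fst q, k) (inv\<^bsub>G\<^esub> (snd q) \<otimes>\<^bsub>G\<^esub> g))"
        by (rule matrix_mult_apply[OF V M d kg H V_supp])
      also have "\<dots> = (\<Oplus>\<^bsub>K\<^esub>q\<in>{..<d} \<times> H. Z (0, fst q) (snd q) \<otimes>\<^bsub>K\<^esub> M (fst q, k) (inv\<^bsub>G\<^esub> (snd q) \<otimes>\<^bsub>G\<^esub> g)
          \<oplus>\<^bsub>K\<^esub> Y (0, fst q) (snd q) \<otimes>\<^bsub>K\<^esub> M (fst q, k) (inv\<^bsub>G\<^esub> (snd q) \<otimes>\<^bsub>G\<^esub> g))"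
      proof (rule R.finsum_cong')
        fix q assume q: "q \<in> {..<d} \<times> H"
        show "V (0, fst q) (snd q) \<otimes>\<^bsub>K\<^esub> M (fst q, k) (inv\<^bsub>G\<^esub> (snd q) \<otimes>\<^bsub>G\<^esub> g)
          = Z (0, fst q) (snd q) \<otimes>\<^bsub>K\<^esub> M (fst q, k) (inv\<^bsub>G\<^esub> (snd q) \<otimes>\<^bsub>G\<^esub> g)
          \<oplus>\<^bsub>K\<^esub> Y (0, fst q) (snd q) \<otimes>\<^bsub>K\<^esub> M (fst q, k) (inv\<^bsub>G\<^esub> (snd q) \<otimes>\<^bsub>G\<^esub> g)"
          unfolding V_apply[OF d cl(4,5)[OF q]] by (rule R.l_distr[OF cl(1-3)[OF q]])
      qed (use cl in \<open>auto intro!: R.a_closed R.m_closed\<close>)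
      also have "\<dots> = (Z \<otimes>\<^bsub>?R\<^esub> M) (0, k) g \<oplus>\<^bsub>K\<^esub> (Y \<otimes>\<^bsub>?R\<^esub> M) (0, k) g"
        unfolding matrix_mult_apply[OF Z(1) M d kg H supp(1)] matrix_mult_apply[OF Y(1) M d kg H supp(2)]
        by (rule R.finsum_addf) (use cl in \<open>auto intro!: R.m_closed\<close>)
      finally show "(r \<otimes>\<^bsub>rows d\<^esub> s) k g = first_row d (V \<otimes>\<^bsub>?R\<^esub> M) k g"
        unfolding row_mult_apply[OF kg] Z(2) Y(2) first_row_apply[OF kg(1)]
        by (simp only: residue_ring_simps(4))
    qed
    then show ?thesis using V by blast
  qed
  \<comment> \<open>Inverses are positive powers, the exponent of the group being \<open>p\<close>.\<close>
  show "inv\<^bsub>rows d\<^esub> r \<in> ?N" if r: "r \<in> ?N" for r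
  proof -
    have rc: "r \<in> carrier (rows d)" using r sub by blast
    have pow: "r [^]\<^bsub>rows d\<^esub> Suc n \<in> ?N" for n
    proof (induction n)
      case 0
      show ?case using r rc by (simp only: rows.nat_pow_Suc rows.nat_pow_0 rows.l_one)
    next
      case (Suc n)
      then show ?case using closed[OF Suc r] by (simp only: rows.nat_pow_Suc)
    qed
    have "p = Suc (Suc (p - 2))" using p1 by simp
    then obtain n where n: "p = Suc (Suc n)" by (rule that)
    have "r [^]\<^bsub>rows d\<^esub> Suc n \<otimes>\<^bsub>rows d\<^esub> r = r [^]\<^bsub>rows d\<^esub> p"
      by (simp only: rows.nat_pow_Suc[of r "Suc n", symmetric] n[symmetric])
    then have "r [^]\<^bsub>rows d\<^esub> Suc n \<otimes>\<^bsub>rows d\<^esub> r = \<one>\<^bsub>rows d\<^esub>"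
      unfolding row_exponent[OF rc] .
    then have "inv\<^bsub>rows d\<^esub> r = r [^]\<^bsub>rows d\<^esub> Suc n"
      using rc subsetD[OF sub pow] by (rule rows.inv_equality)
    then show ?thesis using pow by simp
  qed
qed

text \<open>The witness is the matrix whose only nonzero entry is the group element \<open>g\<close> at position \<open>(0, i)\<close>.\<close>

lemma translated_row_in_row_space:
  assumes d: "d > 0" and M: "M \<in> carrier (matrix_ring d GR)" and i: "i < d" and g: "g \<in> carrier G"
  shows "(\<lambda>k\<in>{..<d}. \<lambda>u\<in>carrier G. M (i, k) (inv\<^bsub>G\<^esub> g \<otimes>\<^bsub>G\<^esub> u))
     \<in> (\<lambda>Z. first_row d (Z \<otimes>\<^bsub>matrix_ring d GR\<^esub> M)) ` carrier (matrix_ring d GR)"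
proof (rule image_eqI)
  let ?R = "matrix_ring d GR"
  define Z where "Z = (\<lambda>(a, l)\<in>{..<d} \<times> {..<d}. \<lambda>h\<in>carrier G. if a = 0 \<and> l = i \<and> h = g then \<one>\<^bsub>K\<^esub> else \<zero>\<^bsub>K\<^esub>)"
  show Z: "Z \<in> carrier ?R"
    unfolding Z_def by (rule matrix_carrierI[of "{g}"]) auto
  have Z_apply: "Z (a, l) h = (if a = 0 \<and> l = i \<and> h = g then \<one>\<^bsub>K\<^esub> else \<zero>\<^bsub>K\<^esub>)"
    if "a < d" "l < d" "h \<in> carrier G" for a l h
    using that by (simp add: Z_def)
  have supp: "matrix_support d Z \<subseteq> {g}"
  proof (rule subsetI, rule ccontr)
    fix h assume h: "h \<in> matrix_support d Z" "h \<notin> {g}"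
    then obtain a l where al: "a < d" "l < d" "h \<in> carrier G" "Z (a, l) h \<noteq> \<zero>\<^bsub>K\<^esub>"
      unfolding matrix_support_def by blast
    then show False using Z_apply[OF al(1-3)] h(2) by simp
  qed
  have entry: "(Z \<otimes>\<^bsub>?R\<^esub> M) (0, k) u = M (i, k) (inv\<^bsub>G\<^esub> g \<otimes>\<^bsub>G\<^esub> u)" if ku: "k < d" "u \<in> carrier G" for k u
  proof -
    let ?m = "\<lambda>q. M (fst q, k) (inv\<^bsub>G\<^esub> (snd q) \<otimes>\<^bsub>G\<^esub> u)"
    have mq: "?m q \<in> carrier K" if "q \<in> {..<d} \<times> {g}" for q using that M ku g by auto
    then have mc: "?m \<in> {..<d} \<times> {g} \<rightarrow> carrier K" by (rule Pi_I)
    have "(Z \<otimes>\<^bsub>?R\<^esub> M) (0, k) u = (\<Oplus>\<^bsub>K\<^esub>q\<in>{..<d} \<times> {g}. Z (0, fst q) (snd q) \<otimes>\<^bsub>K\<^esub> ?m q)"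
      by (rule matrix_mult_apply[OF Z M d ku _ _ supp]) (use g in auto)
    also have "\<dots> = (\<Oplus>\<^bsub>K\<^esub>q\<in>{..<d} \<times> {g}. if (i, g) = q then ?m q else \<zero>\<^bsub>K\<^esub>)"
    proof (rule R.finsum_cong'[OF refl Pi_I])
      fix q assume q: "q \<in> {..<d} \<times> {g}"
      then have "?m q \<in> carrier K" by (rule mq)
      then show "Z (0, fst q) (snd q) \<otimes>\<^bsub>K\<^esub> ?m q = (if (i, g) = q then ?m q else \<zero>\<^bsub>K\<^esub>)"
        using Z_apply[OF d, of "fst q" "snd q"] q g by (cases q) auto
      show "(if (i, g) = q then ?m q else \<zero>\<^bsub>K\<^esub>) \<in> carrier K" using mq[OF q] by simp
    qed
    also have "\<dots> = M (i, k) (inv\<^bsub>G\<^esub> g \<otimes>\<^bsub>G\<^esub> u)"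
      using R.finsum_singleton[OF _ _ mc, of "(i, g)"] i by simp
    finally show ?thesis .
  qed
  show "(\<lambda>k\<in>{..<d}. \<lambda>u\<in>carrier G. M (i, k) (inv\<^bsub>G\<^esub> g \<otimes>\<^bsub>G\<^esub> u)) = first_row d (Z \<otimes>\<^bsub>?R\<^esub> M)"
  proof (rule row_eqI)
    show "(\<lambda>k\<in>{..<d}. \<lambda>u\<in>carrier G. M (i, k) (inv\<^bsub>G\<^esub> g \<otimes>\<^bsub>G\<^esub> u)) \<in> carrier (rows d)"
    proof (rule row_carrierI[of "(\<otimes>\<^bsub>G\<^esub>) g ` matrix_support d M"])
      show "finite ((\<otimes>\<^bsub>G\<^esub>) g ` matrix_support d M)" using finite_matrix_support[OF M] by simp
      show "M (i, k) (inv\<^bsub>G\<^esub> g \<otimes>\<^bsub>G\<^esub> u) \<in> carrier K" if "k < d" "u \<in> carrier G" for k u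
        using M i g that by auto
      fix k u assume ku: "k < d" "u \<in> carrier G" "u \<notin> (\<otimes>\<^bsub>G\<^esub>) g ` matrix_support d M"
      have "u = g \<otimes>\<^bsub>G\<^esub> (inv\<^bsub>G\<^esub> g \<otimes>\<^bsub>G\<^esub> u)" using g ku by (simp add: G.m_assoc[symmetric])
      then have "inv\<^bsub>G\<^esub> g \<otimes>\<^bsub>G\<^esub> u \<notin> matrix_support d M" using ku(3) by blast
      then have "M (i, k) (inv\<^bsub>G\<^esub> g \<otimes>\<^bsub>G\<^esub> u) = \<zero>\<^bsub>K\<^esub>"
        using g ku i unfolding matrix_support_def by auto
      then show "M (i, k) (inv\<^bsub>G\<^esub> g \<otimes>\<^bsub>G\<^esub> u) = 0" by (simp only: residue_ring_simps(2))
    qed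
    have "(Z \<otimes>\<^bsub>?R\<^esub> M) (0, k) \<in> carrier GR" if "k < d" for k
      by (rule matrix_entry_closed[OF matrix_mult_closed[OF Z M] d that])
    then show "first_row d (Z \<otimes>\<^bsub>?R\<^esub> M) \<in> carrier (rows d)"
      by (simp add: first_row_def)
    show "(\<lambda>k\<in>{..<d}. \<lambda>u\<in>carrier G. M (i, k) (inv\<^bsub>G\<^esub> g \<otimes>\<^bsub>G\<^esub> u)) k u = first_row d (Z \<otimes>\<^bsub>?R\<^esub> M) k u"
      if "k < d" "u \<in> carrier G" for k u
      using that by (simp add: first_row_apply entry)
  qed
qed

text \<open>If the unit row at \<open>j\<close> is not in the row space, a character \<open>\<chi>\<close> separates it from the row space. The
  configuration \<open>x\<close> of its values at all unit rows is nonzero, and every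
  coefficient of \<open>M x\<close> is the value of \<open>\<chi>\<close> at a translate of a row of \<open>M\<close>, hence zero; this
  contradicts injectivity. If all unit rows are in the row space, their preimages are the rows of a
  left inverse.\<close>

lemma injective_matrix_action_left_inverse:
  assumes d: "d > 0" and M: "M \<in> carrier (matrix_ring d GR)" and inj: "inj_on (matrix_action d M) (configs d)"
  obtains Z where "Z \<in> carrier (matrix_ring d GR)" "Z \<otimes>\<^bsub>matrix_ring d GR\<^esub> M = \<one>\<^bsub>matrix_ring d GR\<^esub>"
proof -
  let ?R = "matrix_ring d GR"
  define N where "N = (\<lambda>Z. first_row d (Z \<otimes>\<^bsub>?R\<^esub> M)) ` carrier ?R"
  have N: "subgroup N (rows d)" unfolding N_def by (rule row_space_subgroup[OF d M])
  interpret rows: comm_group "rows d" by (rule comm_group_rows)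
  have units: "unit_row d j \<one>\<^bsub>G\<^esub> \<in> N" if j: "j < d" for j
  proof (rule ccontr)
    assume "unit_row d j \<one>\<^bsub>G\<^esub> \<notin> N"
    then obtain \<chi> where \<chi>: "\<chi> \<in> hom (rows d) (add_monoid K)" "\<And>n. n \<in> N \<Longrightarrow> \<chi> n = 0"
        "\<chi> (unit_row d j \<one>\<^bsub>G\<^esub>) = 1"
      using rows.separating_character[OF p row_exponent N unit_row_closed] by blast
    have \<chi>u: "\<chi> (unit_row d k h) \<in> carrier K" for k h
      using hom_in_carrier[OF \<chi>(1) unit_row_closed] by simp
    define x where "x = (\<lambda>g\<in>carrier G. \<lambda>k\<in>{..<d}. \<chi> (unit_row d k g))"
    have x_apply: "x g k = \<chi> (unit_row d k g)" if "g \<in> carrier G" "k < d" for g k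
      using that by (simp add: x_def)
    have x: "x \<in> configs d" using \<chi>u by (auto simp: x_def)
    define z where "z = (\<lambda>g\<in>carrier G. \<lambda>k\<in>{..<d}. \<zero>\<^bsub>K\<^esub>)"
    have z: "z \<in> configs d" by (auto simp: z_def)
    have z_apply: "z g k = \<zero>\<^bsub>K\<^esub>" if "g \<in> carrier G" "k < d" for g k using that by (simp add: z_def)
    define H where "H = matrix_support d M"
    have H: "finite H" "H \<subseteq> carrier G" "matrix_support d M \<subseteq> H"
      using finite_matrix_support[OF M] matrix_support_subset by (auto simp: H_def)
    have Mz: "matrix_action d M z g i = \<zero>\<^bsub>K\<^esub>" if gi: "g \<in> carrier G" "i < d" for g i
      unfolding matrix_action_apply[OF M z gi H]
    proof (rule R.finsum_zero_eqI)
      fix q assume "q \<in> {..<d} \<times> H"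
      then have q: "fst q < d" "snd q \<in> carrier G" using H(2) by auto
      then show "M (i, fst q) (snd q) \<otimes>\<^bsub>K\<^esub> z (g \<otimes>\<^bsub>G\<^esub> snd q) (fst q) = \<zero>\<^bsub>K\<^esub>"
        using z_apply[of "g \<otimes>\<^bsub>G\<^esub> snd q" "fst q"] matrix_coeff_closed[OF M gi(2) q] gi(1) by simp
    qed
    have Mx: "matrix_action d M x g i = \<zero>\<^bsub>K\<^esub>" if gi: "g \<in> carrier G" "i < d" for g i
    proof -
      define r where "r = (\<lambda>k\<in>{..<d}. \<lambda>u\<in>carrier G. M (i, k) (inv\<^bsub>G\<^esub> g \<otimes>\<^bsub>G\<^esub> u))"
      have r_apply: "r k u = M (i, k) (inv\<^bsub>G\<^esub> g \<otimes>\<^bsub>G\<^esub> u)" if "k < d" "u \<in> carrier G" for k u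
        using that by (simp add: r_def)
      have rN: "r \<in> N" unfolding r_def N_def by (rule translated_row_in_row_space[OF d M gi(2,1)])
      have r: "r \<in> carrier (rows d)" using subgroup.mem_carrier[OF N rN] .
      define \<tau> where "\<tau> q = (fst q, g \<otimes>\<^bsub>G\<^esub> snd q)" for q :: "nat \<times> 'g"
      have im: "{..<d} \<times> (\<otimes>\<^bsub>G\<^esub>) g ` H = \<tau> ` ({..<d} \<times> H)" by (force simp: \<tau>_def)
      have rz: "r k u = 0" if "k < d" "u \<in> carrier G" "u \<notin> (\<otimes>\<^bsub>G\<^esub>) g ` H" for k u
      proof -
        have "u = g \<otimes>\<^bsub>G\<^esub> (inv\<^bsub>G\<^esub> g \<otimes>\<^bsub>G\<^esub> u)" using gi that by (simp add: G.m_assoc[symmetric])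
        then have "inv\<^bsub>G\<^esub> g \<otimes>\<^bsub>G\<^esub> u \<notin> matrix_support d M" using that(3) unfolding H_def by blast
        then have "M (i, k) (inv\<^bsub>G\<^esub> g \<otimes>\<^bsub>G\<^esub> u) = \<zero>\<^bsub>K\<^esub>"
          using gi that unfolding matrix_support_def by auto
        then show ?thesis unfolding r_apply[OF that(1,2)] by (simp only: residue_ring_simps(2))
      qed
      have "\<chi> r = (\<Oplus>\<^bsub>K\<^esub>q\<in>{..<d} \<times> (\<otimes>\<^bsub>G\<^esub>) g ` H. r (fst q) (snd q) \<otimes>\<^bsub>K\<^esub> \<chi> (unit_row d (fst q) (snd q)))"
        by (rule row_functional_expansion[OF \<chi>(1) r _ _ rz]) (use H gi in auto)
      also have "\<dots> = (\<Oplus>\<^bsub>K\<^esub>q\<in>{..<d} \<times> H. r (fst (\<tau> q)) (snd (\<tau> q)) \<otimes>\<^bsub>K\<^esub> \<chi> (unit_row d (fst (\<tau> q)) (snd (\<tau> q))))"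
        unfolding im
      proof (rule R.finsum_reindex)
        show "inj_on \<tau> ({..<d} \<times> H)" using H(2) gi by (auto simp: inj_on_def \<tau>_def subset_iff)
        have "r k u \<in> carrier K" if "k < d" "u \<in> carrier G" for k u by (rule row_coeff_closed[OF r that])
        then show "(\<lambda>q. r (fst q) (snd q) \<otimes>\<^bsub>K\<^esub> \<chi> (unit_row d (fst q) (snd q))) \<in> \<tau> ` ({..<d} \<times> H) \<rightarrow> carrier K"
          using \<chi>u H(2) gi by (auto simp: \<tau>_def subset_iff intro!: R.m_closed)
      qed
      also have "\<dots> = (\<Oplus>\<^bsub>K\<^esub>q\<in>{..<d} \<times> H. M (i, fst q) (snd q) \<otimes>\<^bsub>K\<^esub> x (g \<otimes>\<^bsub>G\<^esub> snd q) (fst q))"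
      proof (rule R.finsum_cong')
        fix q assume "q \<in> {..<d} \<times> H"
        then have q: "fst q < d" "snd q \<in> carrier G" using H(2) by auto
        have gq: "g \<otimes>\<^bsub>G\<^esub> snd q \<in> carrier G" using gi q by simp
        have "inv\<^bsub>G\<^esub> g \<otimes>\<^bsub>G\<^esub> (g \<otimes>\<^bsub>G\<^esub> snd q) = snd q" using gi q by (simp add: G.m_assoc[symmetric])
        then show "r (fst (\<tau> q)) (snd (\<tau> q)) \<otimes>\<^bsub>K\<^esub> \<chi> (unit_row d (fst (\<tau> q)) (snd (\<tau> q)))
            = M (i, fst q) (snd q) \<otimes>\<^bsub>K\<^esub> x (g \<otimes>\<^bsub>G\<^esub> snd q) (fst q)"
          unfolding \<tau>_def fst_conv snd_conv r_apply[OF q(1) gq] x_apply[OF gq q(1)] by simp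
      qed (use M x gi H(2) in \<open>auto simp: subset_iff intro!: R.m_closed\<close>)
      also have "\<dots> = matrix_action d M x g i" by (rule matrix_action_apply[OF M x gi H, symmetric])
      finally have "matrix_action d M x g i = 0" using \<chi>(2)[OF rN] by simp
      then show ?thesis by (simp only: residue_ring_simps(2))
    qed
    have "matrix_action d M x = matrix_action d M z"
      by (rule config_eqI[OF matrix_action_closed[OF M x] matrix_action_closed[OF M z]]) (simp only: Mx Mz)
    then have "x = z" using inj_onD[OF inj] x z by blast
    then have "x \<one>\<^bsub>G\<^esub> j = z \<one>\<^bsub>G\<^esub> j" by simp
    then show False
      unfolding x_apply[OF G.one_closed j] z_apply[OF G.one_closed j] \<chi>(3) residue_ring_simps(2) by simp
  qed
  have "\<exists>Z. Z \<in> carrier ?R \<and> unit_row d j \<one>\<^bsub>G\<^esub> = first_row d (Z \<otimes>\<^bsub>?R\<^esub> M)" if "j < d" for j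
    using units[OF that] unfolding N_def by blast
  then obtain F where F: "\<And>j. j < d \<Longrightarrow> F j \<in> carrier ?R"
      "\<And>j. j < d \<Longrightarrow> unit_row d j \<one>\<^bsub>G\<^esub> = first_row d (F j \<otimes>\<^bsub>?R\<^esub> M)" by metis
  define Z where "Z = (\<lambda>(j, l)\<in>{..<d} \<times> {..<d}. F j (0, l))"
  have Z_apply: "Z (j, l) = F j (0, l)" if "j < d" "l < d" for j l using that by (simp add: Z_def)
  have "F j (0, l) \<in> carrier GR" if "j < d" "l < d" for j l using matrix_entry_closed[OF F(1)[OF that(1)] d that(2)] .
  then have Z: "Z \<in> carrier ?R" by (auto simp: Z_def matrix_ring_def)
  have "Z \<otimes>\<^bsub>?R\<^esub> M = \<one>\<^bsub>?R\<^esub>"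
  proof (rule matrix_eqI[OF matrix_mult_closed[OF Z M] matrix_one_closed])
    fix j k g assume j: "j < d" and kg: "k < d" "g \<in> carrier G"
    define H where "H = matrix_support d Z \<union> matrix_support d (F j)"
    have H: "finite H" "H \<subseteq> carrier G" "matrix_support d Z \<subseteq> H" "matrix_support d (F j) \<subseteq> H"
      using finite_matrix_support[OF Z] finite_matrix_support[OF F(1)[OF j]] matrix_support_subset
      by (auto simp: H_def)
    have "(Z \<otimes>\<^bsub>?R\<^esub> M) (j, k) g = (F j \<otimes>\<^bsub>?R\<^esub> M) (0, k) g"
      unfolding matrix_mult_apply[OF Z M j kg H(1-3)] matrix_mult_apply[OF F(1)[OF j] M d kg H(1,2,4)]
    proof (rule R.finsum_cong')
      show "Z (j, fst q) (snd q) \<otimes>\<^bsub>K\<^esub> M (fst q, k) (inv\<^bsub>G\<^esub> snd q \<otimes>\<^bsub>G\<^esub> g) =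
          F j (0, fst q) (snd q) \<otimes>\<^bsub>K\<^esub> M (fst q, k) (inv\<^bsub>G\<^esub> snd q \<otimes>\<^bsub>G\<^esub> g)"
        if "q \<in> {..<d} \<times> H" for q
        using that Z_apply[OF j, of "fst q"] by auto
    qed (use F(1)[OF j] M d kg H(2) in \<open>auto simp: subset_iff intro!: R.m_closed\<close>)
    also have "\<dots> = unit_row d j \<one>\<^bsub>G\<^esub> k g"
      using F(2)[OF j] first_row_apply[OF kg(1)] by simp
    also have "\<dots> = \<one>\<^bsub>?R\<^esub> (j, k) g"
      unfolding matrix_one_apply[OF j kg] using kg by (auto simp: unit_row_def residue_ring_simps)
    finally show "(Z \<otimes>\<^bsub>?R\<^esub> M) (j, k) g = \<one>\<^bsub>?R\<^esub> (j, k) g" .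
  qed
  then show thesis by (rule that[OF Z])
qed

text \<open>The case \<open>d = 0\<close> is separate because stable finiteness only speaks about nonempty matrices.\<close>

proposition surjunctive_vec_if_directly_finite:
  assumes fin: "d > 0 \<Longrightarrow> directly_finite (matrix_ring d GR)"
  shows "surjunctive_alphabet G (vec d)"
  unfolding surjunctive_alphabet_def
proof (intro allI impI)
  fix f assume f: "additive_cellular_automaton G (vec d) f \<and> inj_on f (carrier G \<rightarrow>\<^sub>E carrier (vec d))"
  obtain M where M: "M \<in> carrier (matrix_ring d GR)" "\<And>x. x \<in> configs d \<Longrightarrow> f x = matrix_action d M x"
    using additive_cellular_automaton_is_matrix_action[OF conjunct1[OF f]] by blast
  have fc: "f x \<in> configs d" if "x \<in> configs d" for x
    unfolding M(2)[OF that] by (rule matrix_action_closed[OF M(1) that])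
  have "configs d \<subseteq> f ` configs d"
  proof (cases "d > 0")
    case True
    let ?R = "matrix_ring d GR"
    have "inj_on f (configs d)" using f by simp
    then have "inj_on (matrix_action d M) (configs d)" using inj_on_cong[of "configs d" f] M(2) by blast
    then obtain Z where Z: "Z \<in> carrier ?R" "Z \<otimes>\<^bsub>?R\<^esub> M = \<one>\<^bsub>?R\<^esub>"
      using injective_matrix_action_left_inverse[OF True M(1)] by blast
    then have MZ: "M \<otimes>\<^bsub>?R\<^esub> Z = \<one>\<^bsub>?R\<^esub>"
      using fin[OF True] M(1) unfolding directly_finite_def by blast
    show ?thesis
    proof
      fix y assume y: "y \<in> configs d"
      have "f (matrix_action d Z y) = y"
        unfolding M(2)[OF matrix_action_closed[OF Z(1) y]] matrix_action_mult[OF M(1) Z(1) y] MZ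
        by (rule matrix_action_one[OF y])
      then show "y \<in> f ` configs d" using matrix_action_closed[OF Z(1) y] by (rule image_eqI[OF sym])
    qed
  next
    case False
    have eq: "x = y" if "x \<in> configs d" "y \<in> configs d" for x y
      by (rule config_eqI[OF that]) (use False in simp)
    show ?thesis
    proof
      fix y assume y: "y \<in> configs d"
      have "y = f y" by (rule eq[OF y fc[OF y]])
      then show "y \<in> f ` configs d" using y by (rule image_eqI)
    qed
  qed
  moreover have "f ` configs d \<subseteq> configs d" by (rule image_subsetI) (rule fc)
  ultimately have "f ` configs d = configs d" by (rule subset_antisym[rotated])
  then show "f ` (carrier G \<rightarrow>\<^sub>E carrier (vec d)) = carrier G \<rightarrow>\<^sub>E carrier (vec d)"
    by simp
qed

end

section \<open>From stable finiteness to \<open>A\<close>-surjunctivity\<close>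

lemma (in group) additive_cellular_automaton_restrict:
  assumes A: "comm_group A" and B: "subgroup B A" and f: "additive_cellular_automaton G A f"
    and inv: "\<And>x. x \<in> carrier G \<rightarrow>\<^sub>E B \<Longrightarrow> f x \<in> carrier G \<rightarrow>\<^sub>E B"
  shows "comm_group (A\<lparr>carrier := B\<rparr>)" "additive_cellular_automaton G (A\<lparr>carrier := B\<rparr>) f"
proof -
  interpret A: comm_group A by (rule A)
  have BA: "B \<subseteq> carrier A" by (rule subgroup.subset[OF B])
  show comm: "comm_group (A\<lparr>carrier := B\<rparr>)"
    by (rule group.group_comm_groupI[OF subgroup.subgroup_is_group[OF B A.is_group]])
      (use BA in \<open>auto simp: A.m_comm subset_iff\<close>)
  have sub: "carrier G \<rightarrow>\<^sub>E B \<subseteq> carrier G \<rightarrow>\<^sub>E carrier A" using BA by (intro PiE_mono) auto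
  note f' = f[unfolded additive_cellular_automaton_iff[OF A]]
  note hom = conjunct1[OF f'] and equi = conjunct1[OF conjunct2[OF f']] and loc = conjunct2[OF conjunct2[OF f']]
  show "additive_cellular_automaton G (A\<lparr>carrier := B\<rparr>) f"
    unfolding additive_cellular_automaton_iff[OF comm]
  proof (intro conjI)
    show "f \<in> hom (product_group (carrier G) (\<lambda>_. A\<lparr>carrier := B\<rparr>)) (product_group (carrier G) (\<lambda>_. A\<lparr>carrier := B\<rparr>))"
    proof (rule homI)
      fix x assume "x \<in> carrier (product_group (carrier G) (\<lambda>_. A\<lparr>carrier := B\<rparr>))"
      then show "f x \<in> carrier (product_group (carrier G) (\<lambda>_. A\<lparr>carrier := B\<rparr>))" using inv[of x] by simp
    next
      fix x y assume "x \<in> carrier (product_group (carrier G) (\<lambda>_. A\<lparr>carrier := B\<rparr>))"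
        "y \<in> carrier (product_group (carrier G) (\<lambda>_. A\<lparr>carrier := B\<rparr>))"
      then have xy: "x \<in> carrier G \<rightarrow>\<^sub>E B" "y \<in> carrier G \<rightarrow>\<^sub>E B" by simp_all
      show "f (x \<otimes>\<^bsub>product_group (carrier G) (\<lambda>_. A\<lparr>carrier := B\<rparr>)\<^esub> y)
          = f x \<otimes>\<^bsub>product_group (carrier G) (\<lambda>_. A\<lparr>carrier := B\<rparr>)\<^esub> f y"
        using hom_mult[OF hom, of x y] subsetD[OF sub xy(1)] subsetD[OF sub xy(2)] by simp
    qed
    show "\<forall>\<gamma>\<in>carrier G. \<forall>x\<in>carrier G \<rightarrow>\<^sub>E carrier (A\<lparr>carrier := B\<rparr>). f (shift G \<gamma> x) = shift G \<gamma> (f x)"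
      using equi sub by (simp add: subset_iff)
    show "\<exists>W. finite W \<and> W \<subseteq> carrier G \<and> (\<forall>x\<in>carrier G \<rightarrow>\<^sub>E carrier (A\<lparr>carrier := B\<rparr>).
        (\<forall>w\<in>W. x w = \<one>\<^bsub>A\<lparr>carrier := B\<rparr>\<^esub>) \<longrightarrow> f x \<one> = \<one>\<^bsub>A\<lparr>carrier := B\<rparr>\<^esub>)"
    proof -
      obtain W where W: "finite W" "W \<subseteq> carrier G"
          "\<And>x. x \<in> carrier G \<rightarrow>\<^sub>E carrier A \<Longrightarrow> \<forall>w\<in>W. x w = \<one>\<^bsub>A\<^esub> \<Longrightarrow> f x \<one> = \<one>\<^bsub>A\<^esub>"
        using loc by (elim exE conjE) (rule that, auto)
      have "f x \<one> = \<one>\<^bsub>A\<^esub>" if "x \<in> carrier G \<rightarrow>\<^sub>E B" "\<forall>w\<in>W. x w = \<one>\<^bsub>A\<^esub>" for x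
        by (rule W(3)[OF subsetD[OF sub that(1)] that(2)])
      then show ?thesis using W(1,2) by (intro exI[of _ W]) simp
    qed
  qed
qed

lemma (in comm_group) exists_prime_order_element:
  assumes fin: "finite (carrier G)" and a: "a \<in> carrier G" "a \<noteq> \<one>"
  obtains p b where "Factorial_Ring.prime (p::nat)" "b \<in> carrier G" "b \<noteq> \<one>" "b [^] p = \<one>"
proof -
  have ord: "ord a \<noteq> 1" "ord a > 0" using ord_eq_1[OF a(1)] a(2) ord_ge_1[OF fin a(1)] by auto
  obtain p where p: "Factorial_Ring.prime p" "p dvd ord a" using prime_factor_nat[OF ord(1)] by blast
  define b where "b = a [^] (ord a div p)"
  have "b [^] p = a [^] (ord a div p * p)" using a(1) by (simp add: b_def nat_pow_pow)
  also have "\<dots> = \<one>" using p(2) a(1) by (simp add: pow_ord_eq_1)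
  finally have "b [^] p = \<one>" .
  moreover have "b \<noteq> \<one>"
  proof
    assume "b = \<one>"
    then have "ord a dvd ord a div p" using a(1) by (simp add: b_def pow_eq_id)
    then have "ord a \<le> ord a div p" using p(2) ord(2) by (intro dvd_imp_le) (auto elim: dvdE)
    moreover have "ord a div p < ord a" using ord(2) prime_gt_1_nat[OF p(1)] by (intro div_less_dividend)
    ultimately show False by simp
  qed
  moreover have "b \<in> carrier G" using a by (simp add: b_def)
  ultimately show thesis using that[OF p(1)] by blast
qed

text \<open>Induction on the order of the alphabet \<open>A\<close>. With \<open>D\<close> the \<open>p\<close>-th powers and \<open>T\<close> the elements of
  exponent \<open>p\<close>, the automaton is surjective on \<open>D\<close>-valued configurations by induction and on \<open>T\<close>-valued ones
  by hypothesis. The choice of \<open>p\<close> ensures that \<open>T\<close> is nontrivial, so that \<open>D\<close> is smaller than \<open>A\<close>.\<close>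

lemma (in group) surjunctive_alphabet_if_prime_vectors:
  assumes vecs: "\<And>(p::nat) (d::nat). Factorial_Ring.prime p \<Longrightarrow>
    surjunctive_alphabet G (product_group {..<d} (\<lambda>_. add_monoid (residue_ring (int p))))"
  shows "comm_group A \<Longrightarrow> finite (carrier A) \<Longrightarrow> surjunctive_alphabet G A"
proof (induction "card (carrier A)" arbitrary: A rule: less_induct)
  case less
  interpret A: comm_group A by (rule less.prems(1))
  let ?P = "product_group (carrier G) (\<lambda>_. A)"
  interpret P: group ?P by (rule product_group) (rule A.is_group)
  have Pc: "carrier ?P = carrier G \<rightarrow>\<^sub>E carrier A" by simp
  show ?case
    unfolding surjunctive_alphabet_def
  proof (intro allI impI)
    fix f assume "additive_cellular_automaton G A f \<and> inj_on f (carrier G \<rightarrow>\<^sub>E carrier A)"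
    then have f: "additive_cellular_automaton G A f" and inj: "inj_on f (carrier G \<rightarrow>\<^sub>E carrier A)" by auto
    have hom: "f \<in> hom ?P ?P" using f by (simp add: additive_cellular_automaton_def)
    have fc: "f x \<in> carrier G \<rightarrow>\<^sub>E carrier A" if "x \<in> carrier G \<rightarrow>\<^sub>E carrier A" for x
      using hom_in_carrier[OF hom] that unfolding Pc by blast
    show "f ` (carrier G \<rightarrow>\<^sub>E carrier A) = carrier G \<rightarrow>\<^sub>E carrier A"
    proof (cases "carrier A = {\<one>\<^bsub>A\<^esub>}")
      case True
      have eq: "x = y" if "x \<in> carrier G \<rightarrow>\<^sub>E carrier A" "y \<in> carrier G \<rightarrow>\<^sub>E carrier A" for x y
        by (rule PiE_ext[OF that]) (use that True in \<open>auto simp: PiE_iff\<close>)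
      show ?thesis
      proof (rule subset_antisym)
        show "f ` (carrier G \<rightarrow>\<^sub>E carrier A) \<subseteq> carrier G \<rightarrow>\<^sub>E carrier A"
          by (rule image_subsetI) (rule fc)
        show "carrier G \<rightarrow>\<^sub>E carrier A \<subseteq> f ` (carrier G \<rightarrow>\<^sub>E carrier A)"
        proof
          fix y assume y: "y \<in> carrier G \<rightarrow>\<^sub>E carrier A"
          have "y = f y" by (rule eq[OF y fc[OF y]])
          then show "y \<in> f ` (carrier G \<rightarrow>\<^sub>E carrier A)" using y by (rule image_eqI)
        qed
      qed
    next
      case False
      then obtain a where a: "a \<in> carrier A" "a \<noteq> \<one>\<^bsub>A\<^esub>" using A.one_closed by blast
      obtain p b where p: "Factorial_Ring.prime (p::nat)" and b: "b \<in> carrier A" "b \<noteq> \<one>\<^bsub>A\<^esub>" "b [^]\<^bsub>A\<^esub> p = \<one>\<^bsub>A\<^esub>"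
        using A.exists_prime_order_element[OF less.prems(2) a] by blast
      have pow_mult: "(x \<otimes>\<^bsub>A\<^esub> y) [^]\<^bsub>A\<^esub> p = x [^]\<^bsub>A\<^esub> p \<otimes>\<^bsub>A\<^esub> y [^]\<^bsub>A\<^esub> p"
        if "x \<in> carrier A" "y \<in> carrier A" for x y
        using that by (rule A.nat_pow_distrib)
      have pow_inv: "(inv\<^bsub>A\<^esub> x) [^]\<^bsub>A\<^esub> p = inv\<^bsub>A\<^esub> (x [^]\<^bsub>A\<^esub> p)" if "x \<in> carrier A" for x
        using that by (rule A.nat_pow_inv)
      define T where "T = {x \<in> carrier A. x [^]\<^bsub>A\<^esub> p = \<one>\<^bsub>A\<^esub>}"
      define D where "D = (\<lambda>x. x [^]\<^bsub>A\<^esub> p) ` carrier A"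
      have T: "subgroup T A"
      proof (rule A.subgroupI)
        show "T \<noteq> {}" using A.one_closed A.nat_pow_one unfolding T_def by blast
      qed (auto simp: T_def pow_mult pow_inv)
      have D: "subgroup D A"
      proof (rule A.subgroupI)
        show "D \<noteq> {}" using A.one_closed unfolding D_def by blast
        show "inv\<^bsub>A\<^esub> x \<in> D" if "x \<in> D" for x using that pow_inv[symmetric] unfolding D_def by auto
        show "x \<otimes>\<^bsub>A\<^esub> y \<in> D" if "x \<in> D" "y \<in> D" for x y using that pow_mult[symmetric] unfolding D_def by auto
      qed (auto simp: D_def)
      have pw: "(x [^]\<^bsub>?P\<^esub> n) g = x g [^]\<^bsub>A\<^esub> n" if "g \<in> carrier G" for x g and n :: nat
        using that by (induction n) auto
      have f_pow: "f (x [^]\<^bsub>?P\<^esub> p) = f x [^]\<^bsub>?P\<^esub> p" if "x \<in> carrier G \<rightarrow>\<^sub>E carrier A" for x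
      proof -
        have h: "group_hom ?P ?P f" using hom P.is_group by (simp add: group_hom_def group_hom_axioms_def)
        show ?thesis using group_hom.hom_nat_pow[OF h, of x p] that unfolding Pc by simp
      qed
      have power_config: "x [^]\<^bsub>?P\<^esub> p \<in> carrier G \<rightarrow>\<^sub>E D" if x: "x \<in> carrier G \<rightarrow>\<^sub>E carrier A" for x
      proof -
        have "x [^]\<^bsub>?P\<^esub> p \<in> carrier ?P" by (rule P.nat_pow_closed) (use x in simp)
        then have "x [^]\<^bsub>?P\<^esub> p \<in> extensional (carrier G)" unfolding Pc by (simp add: PiE_iff)
        moreover have "(x [^]\<^bsub>?P\<^esub> p) g \<in> D" if "g \<in> carrier G" for g
          unfolding pw[OF that] D_def using PiE_mem[OF x that] by blast
        ultimately show ?thesis by (simp add: PiE_iff)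
      qed
      have root: "\<exists>w\<in>carrier G \<rightarrow>\<^sub>E carrier A. x = w [^]\<^bsub>?P\<^esub> p" if x: "x \<in> carrier G \<rightarrow>\<^sub>E D" for x
      proof -
        have "\<exists>v. v \<in> carrier A \<and> x g = v [^]\<^bsub>A\<^esub> p" if "g \<in> carrier G" for g
          using PiE_mem[OF x that] unfolding D_def by blast
        then obtain v where v: "\<And>g. g \<in> carrier G \<Longrightarrow> v g \<in> carrier A \<and> x g = v g [^]\<^bsub>A\<^esub> p" by metis
        have w: "restrict v (carrier G) \<in> carrier G \<rightarrow>\<^sub>E carrier A" using v by auto
        have "x = restrict v (carrier G) [^]\<^bsub>?P\<^esub> p"
          by (rule PiE_ext[OF x power_config[OF w]]) (use v pw in simp)
        then show ?thesis using w by blast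
      qed
      have invD: "f x \<in> carrier G \<rightarrow>\<^sub>E D" if x: "x \<in> carrier G \<rightarrow>\<^sub>E D" for x
      proof -
        obtain w where w: "w \<in> carrier G \<rightarrow>\<^sub>E carrier A" "x = w [^]\<^bsub>?P\<^esub> p" using root[OF x] by blast
        show ?thesis unfolding w(2) f_pow[OF w(1)] by (rule power_config[OF fc[OF w(1)]])
      qed
      have torsion: "x \<in> carrier G \<rightarrow>\<^sub>E T \<longleftrightarrow> x \<in> carrier G \<rightarrow>\<^sub>E carrier A \<and> x [^]\<^bsub>?P\<^esub> p = \<one>\<^bsub>?P\<^esub>" for x
      proof
        assume x: "x \<in> carrier G \<rightarrow>\<^sub>E T"
        then have xA: "x \<in> carrier G \<rightarrow>\<^sub>E carrier A" by (auto simp: PiE_iff T_def)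
        have "x [^]\<^bsub>?P\<^esub> p = \<one>\<^bsub>?P\<^esub>"
        proof (rule PiE_ext[of _ "carrier G" "\<lambda>_. carrier A"])
          show "x [^]\<^bsub>?P\<^esub> p \<in> carrier G \<rightarrow>\<^sub>E carrier A" "\<one>\<^bsub>?P\<^esub> \<in> carrier G \<rightarrow>\<^sub>E carrier A"
            using P.nat_pow_closed[of x p] P.one_closed xA unfolding Pc by blast+
          show "(x [^]\<^bsub>?P\<^esub> p) g = \<one>\<^bsub>?P\<^esub> g" if "g \<in> carrier G" for g
            unfolding pw[OF that] using PiE_mem[OF x that] that by (simp add: T_def)
        qed
        then show "x \<in> carrier G \<rightarrow>\<^sub>E carrier A \<and> x [^]\<^bsub>?P\<^esub> p = \<one>\<^bsub>?P\<^esub>" using xA by blast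
      next
        assume x: "x \<in> carrier G \<rightarrow>\<^sub>E carrier A \<and> x [^]\<^bsub>?P\<^esub> p = \<one>\<^bsub>?P\<^esub>"
        have "x g [^]\<^bsub>A\<^esub> p = \<one>\<^bsub>A\<^esub>" if "g \<in> carrier G" for g
          unfolding pw[OF that, symmetric] using x that by simp
        then show "x \<in> carrier G \<rightarrow>\<^sub>E T" using x by (auto simp: PiE_iff T_def)
      qed
      have f_one: "f \<one>\<^bsub>?P\<^esub> = \<one>\<^bsub>?P\<^esub>" by (rule hom_one[OF hom P.is_group P.is_group])
      have invT: "f x \<in> carrier G \<rightarrow>\<^sub>E T" if "x \<in> carrier G \<rightarrow>\<^sub>E T" for x
        using that f_pow[of x] fc[of x] f_one unfolding torsion by simp
      have TA: "carrier G \<rightarrow>\<^sub>E T \<subseteq> carrier G \<rightarrow>\<^sub>E carrier A"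
        using subgroup.subset[OF T] by (intro PiE_mono) auto
      have DA: "carrier G \<rightarrow>\<^sub>E D \<subseteq> carrier G \<rightarrow>\<^sub>E carrier A"
        using subgroup.subset[OF D] by (intro PiE_mono) auto
      note D_CA = additive_cellular_automaton_restrict[OF less.prems(1) D f invD]
      note T_CA = additive_cellular_automaton_restrict[OF less.prems(1) T f invT]
      have "card D < card (carrier A)"
      proof -
        have "card D \<le> card (carrier A)" unfolding D_def by (rule card_image_le[OF less.prems(2)])
        \<comment> \<open>Taking \<open>p\<close>-th powers is not injective, as it kills \<open>b\<close>.\<close>
        moreover have "card D \<noteq> card (carrier A)"
        proof
          assume "card D = card (carrier A)"
          then have "inj_on (\<lambda>x. x [^]\<^bsub>A\<^esub> p) (carrier A)"
            unfolding D_def using eq_card_imp_inj_on[OF less.prems(2)] by blast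
          then have "b = \<one>\<^bsub>A\<^esub>" by (rule inj_onD) (use b in simp_all)
          then show False using b(2) by simp
        qed
        ultimately show ?thesis by simp
      qed
      then have "surjunctive_alphabet G (A\<lparr>carrier := D\<rparr>)"
        using D_CA(1) finite_subset[OF subgroup.subset[OF D] less.prems(2)] by (intro less.hyps) auto
      then have D_surj: "f ` (carrier G \<rightarrow>\<^sub>E D) = carrier G \<rightarrow>\<^sub>E D"
        using D_CA(2) inj_on_subset[OF inj DA] unfolding surjunctive_alphabet_def by simp
      have "surjunctive_alphabet G (A\<lparr>carrier := T\<rparr>)"
      proof -
        let ?T = "A\<lparr>carrier := T\<rparr>"
        interpret T: comm_group ?T by (rule T_CA(1))
        have "finite (carrier ?T)" using finite_subset[OF subgroup.subset[OF T] less.prems(2)] by simp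
        moreover have "w [^]\<^bsub>?T\<^esub> p = \<one>\<^bsub>?T\<^esub>" if "w \<in> carrier ?T" for w
          using that by (simp add: T_def nat_pow_def)
        ultimately obtain d :: nat where
            d: "?T \<cong> product_group {..<d} (\<lambda>_. add_monoid (residue_ring (int p)))"
          using elementary_abelian_iso_vector_group[OF p T_CA(1)] by blast
        have V: "comm_group (product_group {..<d} (\<lambda>_. add_monoid (residue_ring (int p))))"
          by (rule T.iso_imp_comm_group[OF d]) (intro group.is_monoid product_group prime_residue_ring(2)[OF p])
        show ?thesis
          by (rule surjunctive_alphabet_iso[OF V T_CA(1) T.iso_sym[OF d] vecs[OF p]])
      qed
      then have T_surj: "f ` (carrier G \<rightarrow>\<^sub>E T) = carrier G \<rightarrow>\<^sub>E T"
        using T_CA(2) inj_on_subset[OF inj TA] unfolding surjunctive_alphabet_def by simp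
      have "y \<in> f ` (carrier G \<rightarrow>\<^sub>E carrier A)" if y: "y \<in> carrier G \<rightarrow>\<^sub>E carrier A" for y
      proof -
        have "y [^]\<^bsub>?P\<^esub> p \<in> f ` (carrier G \<rightarrow>\<^sub>E D)" unfolding D_surj by (rule power_config[OF y])
        then obtain z where z: "z \<in> carrier G \<rightarrow>\<^sub>E D" "y [^]\<^bsub>?P\<^esub> p = f z" by blast
        obtain w where w: "w \<in> carrier G \<rightarrow>\<^sub>E carrier A" "z = w [^]\<^bsub>?P\<^esub> p" using root[OF z(1)] by blast
        have yfw: "y [^]\<^bsub>?P\<^esub> p = f w [^]\<^bsub>?P\<^esub> p" using z(2) w f_pow by simp
        have yP: "y \<in> carrier ?P" and fwP: "f w \<in> carrier ?P" and wP: "w \<in> carrier ?P"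
          using y fc[OF w(1)] w(1) unfolding Pc by auto
        interpret PC: comm_group ?P
          by (rule group.group_comm_groupI[OF P.is_group]) (auto simp: PiE_iff A.m_comm)
        \<comment> \<open>\<open>y\<close> and \<open>f w\<close> have the same \<open>p\<close>-th power, so their quotient is torsion.\<close>
        define t where "t = y \<otimes>\<^bsub>?P\<^esub> inv\<^bsub>?P\<^esub> (f w)"
        have tP: "t \<in> carrier ?P" unfolding t_def by (intro P.m_closed P.inv_closed yP fwP)
        have "t [^]\<^bsub>?P\<^esub> p = y [^]\<^bsub>?P\<^esub> p \<otimes>\<^bsub>?P\<^esub> inv\<^bsub>?P\<^esub> (f w [^]\<^bsub>?P\<^esub> p)"
          unfolding t_def PC.nat_pow_distrib[OF yP P.inv_closed[OF fwP]] P.nat_pow_inv[OF fwP] ..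
        also have "\<dots> = \<one>\<^bsub>?P\<^esub>" unfolding yfw by (rule P.r_inv[OF P.nat_pow_closed[OF fwP]])
        finally have "t \<in> carrier G \<rightarrow>\<^sub>E T" using tP unfolding torsion Pc by blast
        then have "t \<in> f ` (carrier G \<rightarrow>\<^sub>E T)" unfolding T_surj .
        then obtain s where s: "s \<in> carrier G \<rightarrow>\<^sub>E T" "t = f s" by blast
        have sP: "s \<in> carrier ?P" using s(1) TA unfolding Pc by blast
        have "f (s \<otimes>\<^bsub>?P\<^esub> w) = t \<otimes>\<^bsub>?P\<^esub> f w" unfolding s(2) by (rule hom_mult[OF hom sP wP])
        also have "\<dots> = y" 
          unfolding t_def P.m_assoc[OF yP P.inv_closed[OF fwP] fwP] P.l_inv[OF fwP] by (rule P.r_one[OF yP])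
        finally have "y = f (s \<otimes>\<^bsub>?P\<^esub> w)" by (rule sym)
        moreover have "s \<otimes>\<^bsub>?P\<^esub> w \<in> carrier G \<rightarrow>\<^sub>E carrier A" using P.m_closed[OF sP wP] unfolding Pc .
        ultimately show ?thesis by (rule image_eqI)
      qed
      then have "carrier G \<rightarrow>\<^sub>E carrier A \<subseteq> f ` (carrier G \<rightarrow>\<^sub>E carrier A)" by (rule subsetI)
      moreover have "f ` (carrier G \<rightarrow>\<^sub>E carrier A) \<subseteq> carrier G \<rightarrow>\<^sub>E carrier A"
        by (rule image_subsetI) (rule fc)
      ultimately show ?thesis by (rule subset_antisym[rotated])
    qed
  qed
qed

text \<open>Stable finiteness is transferred to the prime fields from their copies inside the infinite type
  \<open>'k\<close>.\<close>

theorem A_surjunctive_if_Kaplansky_stable_finiteness: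
  fixes G :: "('g, 'm) monoid_scheme"
  assumes G: "group G" and inf: "infinite (UNIV :: 'k set)"
    and kap: "Kaplansky_stable_finiteness TYPE('k) G"
  shows "A_surjunctive TYPE('b) G"
proof -
  have vecs: "surjunctive_alphabet G (product_group {..<d} (\<lambda>_. add_monoid (residue_ring (int p))))"
    if p: "Factorial_Ring.prime p" for p d :: nat
  proof -
    let ?K = "residue_ring (int p)"
    interpret K: field ?K by (rule prime_residue_ring(1)[OF p])
    interpret KG: prime_group_ring G p
      by (intro prime_group_ring.intro group_ring_data.intro prime_group_ring_axioms.intro G K.ring_axioms p)
    have "finite (carrier ?K)" by (simp add: residue_ring_simps)
    then obtain \<phi> :: "int \<Rightarrow> 'k" where \<phi>: "inj_on \<phi> (carrier ?K)"
      using inf by (meson finite_imp_inj_to_nat_seg infinite_countable_subset comp_inj_on inj_on_subset subset_UNIV)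
    let ?L = "image_ring \<phi> ?K"
    interpret L: field ?L by (rule K.inj_imp_image_ring_is_field[OF \<phi>])
    interpret \<phi>: group_ring_hom G ?K ?L \<phi>
    proof (intro group_ring_hom.intro KG.group_ring_data_axioms group_ring_data.intro G L.ring_axioms)
      show "ring_hom_ring ?K ?L \<phi>"
        by (rule ring_hom_ringI2[OF K.ring_axioms L.ring_axioms])
          (use inj_imp_image_ring_iso[OF \<phi>] in \<open>simp add: ring_iso_def\<close>)
    qed
    have "stably_finite (group_ring ?L G)"
      using kap L.field_axioms unfolding Kaplansky_stable_finiteness_def by blast
    then have "directly_finite (matrix_ring d (group_ring ?L G))" if "d > 0"
      using that unfolding stably_finite_def by simp
    then show ?thesis
      using KG.surjunctive_vec_if_directly_finite \<phi>.directly_finite_pullback[OF \<phi>] by blast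
  qed
  show ?thesis
    unfolding A_surjunctive_def topspace_config_space
  proof (intro allI impI, elim conjE)
    fix A :: "'b monoid" and f
    assume A: "comm_group A" "finite (carrier A)"
      and f: "additive_cellular_automaton G A f" "inj_on f (carrier G \<rightarrow>\<^sub>E carrier A)"
    have "surjunctive_alphabet G A"
      using vecs A by (rule group.surjunctive_alphabet_if_prime_vectors[OF G])
    then show "f ` (carrier G \<rightarrow>\<^sub>E carrier A) = carrier G \<rightarrow>\<^sub>E carrier A"
      using f unfolding surjunctive_alphabet_def by simp
  qed
qed

theorem theorem1p11:
  fixes G :: "('g, 'm) monoid_scheme"
  assumes "group G"
    and "infinite (UNIV :: 'k set)"
    and "infinite (UNIV :: 'b set)"
  shows "Kaplansky_stable_finiteness TYPE('k) G \<longleftrightarrow> A_surjunctive TYPE('b) G"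
  using A_surjunctive_if_Kaplansky_stable_finiteness[OF assms(1,2)]
    stably_finite_if_A_surjunctive[OF assms(1,3)]
  unfolding Kaplansky_stable_finiteness_def by blast

end
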